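(* Let $G\in\mathcal C^\infty(\bar\Omega,\mathbb R^{3\times3}_{\mathrm{sym,pos}})$ satisfy $R_{1212}(x',0)=R_{1213}(x',0)=R_{1223}(x',0)=0$ for all $x'\in\omega$, let $\bar{\mathcal G}=G(\cdot,0)$, let $y_0\in W^{2,2}(\omega,\mathbb R^3)$ with $(\nabla y_0)^{\mathsf T}\nabla y_0=\bar{\mathcal G}_{2\times2}$ satisfy $\Pi_{y_0}=-\frac1{\sqrt{\bar{\mathcal G}^{33}}}[\Gamma^3_{ij}(x',0)]_{i,j=1,2}$, and let $y\in W^{2,2}(\omega,\mathbb R^3)$ with $(\nabla y)^{\mathsf T}\nabla y=\bar{\mathcal G}_{2\times2}$, with Cosserat field $\vec b$. Then there exists $R\in SO(3)$ such that $$\int_\omega|\nabla y-R\nabla y_0|^2dx'\le C\int_\omega\Big|\big((\nabla y)^{\mathsf T}\nabla\vec b\big)_{\mathrm{sym}}-\frac12\partial_3G(x',0)_{2\times2}\Big|^2dx',$$ with $C>0$ depending on $G,\omega$ but independent of $y$.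
   Context: $\omega\subset\mathbb R^2$ open, bounded, connected, Lipschitz; $\Omega=\omega\times(-1/2,1/2)$. $F_{2\times2}$ principal minor, $F_{\mathrm{sym}}=\frac12(F+F^{\mathsf T})$. Cosserat field $\vec b=(\nabla y)(\bar{\mathcal G}_{2\times2})^{-1}(\bar{\mathcal G}_{13},\bar{\mathcal G}_{23})^{\mathsf T}+\sqrt{\det\bar{\mathcal G}/\det\bar{\mathcal G}_{2\times2}}\,\vec\nu$ with $\vec\nu=\frac{\partial_1y\times\partial_2y}{|\cdot|}$; $\Pi_{y}=(\nabla y)^{\mathsf T}\nabla\vec\nu$; $\bar{\mathcal G}^{33}=\langle\bar{\mathcal G}^{-1}e_3,e_3\rangle$. $\Gamma^i_{kl}=\frac12G^{im}(\partial_lG_{mk}+\partial_kG_{ml}-\partial_mG_{kl})$; $R_{iklm}=\frac12(\partial_{kl}G_{im}+\partial_{im}G_{kl}-\partial_{km}G_{il}-\partial_{il}G_{km})+G_{np}(\Gamma^n_{kl}\Gamma^p_{im}-\Gamma^n_{km}\Gamma^p_{il})$. *)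

theory Defs
  imports "HOL-Analysis.Analysis"
begin

definition pd :: "'n::finite \<Rightarrow> (real^'n \<Rightarrow> real) \<Rightarrow> real^'n \<Rightarrow> real" where
  "pd i f x = deriv (\<lambda>t. f (x + t *\<^sub>R axis i 1)) 0"

fun iter_pd :: "'n::finite list \<Rightarrow> (real^'n \<Rightarrow> real) \<Rightarrow> real^'n \<Rightarrow> real" where
  "iter_pd [] f = f"
| "iter_pd (i # is) f = pd i (iter_pd is f)"

definition smooth_on :: "(real^'n::finite) set \<Rightarrow> (real^'n \<Rightarrow> real) \<Rightarrow> bool" where
  "smooth_on U f \<longleftrightarrow> (\<forall>is. continuous_on U (iter_pd is f) \<and>
      (\<forall>i. \<forall>x\<in>U. (\<lambda>t. iter_pd is f (x + t *\<^sub>R axis i 1)) differentiable (at 0)))"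

definition lipschitz_domain :: "(real^2) set \<Rightarrow> bool" where
  "lipschitz_domain \<omega> \<longleftrightarrow> (\<forall>p\<in>frontier \<omega>. \<exists>r>0. \<exists>Q::real^2^2. \<exists>g::real\<Rightarrow>real. \<exists>L.
      orthogonal_matrix Q \<and> (\<forall>s t. \<bar>g s - g t\<bar> \<le> L * \<bar>s - t\<bar>) \<and>
      \<omega> \<inter> ball p r = {x \<in> ball p r. (Q *v (x - p)) $ 2 < g ((Q *v (x - p)) $ 1)})"

definition lift :: "real^2 \<Rightarrow> real^3" where
  "lift x = vector [x $ 1, x $ 2, 0]"

definition cyl :: "(real^2) set \<Rightarrow> (real^3) set" where
  "cyl \<omega> = {z. (vector [z $ 1, z $ 2] :: real^2) \<in> \<omega> \<and> -1/2 < z $ 3 \<and> z $ 3 < 1/2}"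

definition smooth_metric_on :: "(real^3) set \<Rightarrow> (real^3 \<Rightarrow> real^3^3) \<Rightarrow> bool" where
  "smooth_metric_on \<Omega> G \<longleftrightarrow>
     (\<exists>U. open U \<and> closure \<Omega> \<subseteq> U \<and> (\<forall>i j. smooth_on U (\<lambda>z. G z $ i $ j))) \<and>
     (\<forall>z\<in>closure \<Omega>. transpose (G z) = G z \<and> (\<forall>v. v \<noteq> 0 \<longrightarrow> v \<bullet> (G z *v v) > 0))"

definition Gamma :: "(real^3 \<Rightarrow> real^3^3) \<Rightarrow> 3 \<Rightarrow> 3 \<Rightarrow> 3 \<Rightarrow> real^3 \<Rightarrow> real" where
  "Gamma G i k l x = 1/2 * (\<Sum>m\<in>UNIV. matrix_inv (G x) $ i $ m *
      (pd l (\<lambda>z. G z $ m $ k) x + pd k (\<lambda>z. G z $ m $ l) x - pd m (\<lambda>z. G z $ k $ l) x))"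

definition riem :: "(real^3 \<Rightarrow> real^3^3) \<Rightarrow> 3 \<Rightarrow> 3 \<Rightarrow> 3 \<Rightarrow> 3 \<Rightarrow> real^3 \<Rightarrow> real" where
  "riem G i k l m x =
     1/2 * (pd k (pd l (\<lambda>z. G z $ i $ m)) x + pd i (pd m (\<lambda>z. G z $ k $ l)) x
          - pd k (pd m (\<lambda>z. G z $ i $ l)) x - pd i (pd l (\<lambda>z. G z $ k $ m)) x)
     + (\<Sum>n\<in>UNIV. \<Sum>p\<in>UNIV. G x $ n $ p *
          (Gamma G n k l x * Gamma G p i m x - Gamma G n k m x * Gamma G p i l x))"

definition test_fun :: "(real^2) set \<Rightarrow> (real^2 \<Rightarrow> real) \<Rightarrow> bool" where
  "test_fun \<omega> \<phi> \<longleftrightarrow> smooth_on UNIV \<phi> \<and> compact (closure {x. \<phi> x \<noteq> 0})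
      \<and> closure {x. \<phi> x \<noteq> 0} \<subseteq> \<omega>"

definition loc_int :: "(real^2) set \<Rightarrow> (real^2 \<Rightarrow> real) \<Rightarrow> bool" where
  "loc_int \<omega> f \<longleftrightarrow> (\<forall>K. compact K \<and> K \<subseteq> \<omega> \<longrightarrow> set_integrable lebesgue K f)"

definition weak_pd :: "(real^2) set \<Rightarrow> (real^2 \<Rightarrow> real) \<Rightarrow> 2 \<Rightarrow> (real^2 \<Rightarrow> real) \<Rightarrow> bool" where
  "weak_pd \<omega> f i g \<longleftrightarrow> loc_int \<omega> f \<and> loc_int \<omega> g \<and>
     (\<forall>\<phi>. test_fun \<omega> \<phi> \<longrightarrow>
        (LINT x:\<omega>|lebesgue. f x * pd i \<phi> x) = - (LINT x:\<omega>|lebesgue. g x * \<phi> x))"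

definition weak_jacobian :: "(real^2) set \<Rightarrow> (real^2 \<Rightarrow> real^3) \<Rightarrow> (real^2 \<Rightarrow> real^2^3) \<Rightarrow> bool" where
  "weak_jacobian \<omega> f Df \<longleftrightarrow> (\<forall>k j. weak_pd \<omega> (\<lambda>x. f x $ k) j (\<lambda>x. Df x $ k $ j))"

definition L2 :: "(real^2) set \<Rightarrow> (real^2 \<Rightarrow> 'a::euclidean_space) \<Rightarrow> bool" where
  "L2 \<omega> f \<longleftrightarrow> f \<in> borel_measurable (restrict_space lebesgue \<omega>) \<and>
     set_integrable lebesgue \<omega> (\<lambda>x. (norm (f x))\<^sup>2)"

definition W22 :: "(real^2) set \<Rightarrow> (real^2 \<Rightarrow> real^3) \<Rightarrow> (real^2 \<Rightarrow> real^2^3) \<Rightarrow> bool" where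
  "W22 \<omega> y Dy \<longleftrightarrow> L2 \<omega> y \<and> L2 \<omega> Dy \<and> weak_jacobian \<omega> y Dy \<and>
     (\<exists>H :: 2 \<Rightarrow> real^2 \<Rightarrow> real^2^3. \<forall>j. weak_jacobian \<omega> (\<lambda>x. column j (Dy x)) (H j) \<and> L2 \<omega> (H j))"

definition ix :: "2 \<Rightarrow> 3" where
  "ix i = (if i = 1 then 1 else 2)"

definition upper2 :: "real^3^3 \<Rightarrow> real^2^2" where
  "upper2 M = (\<chi> i j. M $ ix i $ ix j)"

definition Gbar :: "(real^3 \<Rightarrow> real^3^3) \<Rightarrow> real^2 \<Rightarrow> real^3^3" where
  "Gbar G x = G (lift x)"

definition unit_normal :: "(real^2 \<Rightarrow> real^2^3) \<Rightarrow> real^2 \<Rightarrow> real^3" where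
  "unit_normal Dy x = (let c = cross3 (column 1 (Dy x)) (column 2 (Dy x)) in (1 / norm c) *\<^sub>R c)"

definition cosserat :: "(real^3 \<Rightarrow> real^3^3) \<Rightarrow> (real^2 \<Rightarrow> real^2^3) \<Rightarrow> real^2 \<Rightarrow> real^3" where
  "cosserat G Dy x =
     Dy x *v (matrix_inv (upper2 (Gbar G x)) *v vector [Gbar G x $ 1 $ 3, Gbar G x $ 2 $ 3])
     + sqrt (det (Gbar G x) / det (upper2 (Gbar G x))) *\<^sub>R unit_normal Dy x"

definition symm :: "real^2^2 \<Rightarrow> real^2^2" where
  "symm F = (1/2) *\<^sub>R (F + transpose F)"

definition d3G2 :: "(real^3 \<Rightarrow> real^3^3) \<Rightarrow> real^2 \<Rightarrow> real^2^2" where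
  "d3G2 G x = (\<chi> i j. pd 3 (\<lambda>z. G z $ ix i $ ix j) (lift x))"

definition SO3 :: "(real^3^3) set" where
  "SO3 = {R. orthogonal_matrix R \<and> det R = 1}"

end

theory Submission
  imports Defs
begin

text \<open>
  Let \<open>M\<close> and \<open>M0\<close> be the frames formed by the two tangent vectors and the unit normal of \<open>y\<close> and
  \<open>y0\<close>. Both have the Gram matrix \<open>diag(G2x2, 1)\<close>, so \<open>R = M (diag(G2x2, 1))^-1 M0^T\<close> is a field of
  rotations with \<open>R M0 = M\<close>. Differentiating this identity, \<open>M^T (d_j R) M0\<close> is the difference of the
  connection matrices \<open>M^T d_j M\<close> and \<open>M0^T d_j M0\<close>; it is antisymmetric, and by the Koszul formula only
  the entries given by the difference of the second fundamental forms survive. That difference is, up to the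
  factor \<open>1/sqrt(G^33)\<close>, the strain \<open>((grad y)^T grad b)_sym - 1/2 d_3 G\<close>, because the strain of \<open>y0\<close>
  vanishes. A Poincare inequality in the form of a double integral of \<open>|R(x) - R(z)|^2\<close> then yields a point
  \<open>z\<close> whose rotation \<open>R(z)\<close> satisfies the estimate.

  No mollification is needed: a weak derivative is turned into an identity
  \<open>f(x + h) - f(x) = \<integral> g(x + t h) dt\<close> for almost every \<open>x\<close>, from which the product rule and the
  Poincare inequality follow.
\<close>

section \<open>Test functions\<close>

text \<open>The constant must not depend on \<open>y\<close>, so every bound is pointwise and in
  terms of \<open>G\<close>: the isometry condition bounds the columns of \<open>Dy\<close> by the
  diagonal of \<open>G\<close>, and the derivative of the rotation field is computed algebraically
  from the frames, with coefficients bounded by \<open>G\<close> alone. The same bound places the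
  frames in the class of bounded functions with square integrable weak derivatives. This class is
  closed under products, so Gram matrices, normals and rotations can be differentiated although
  \<open>y\<close> is only twice weakly differentiable; the normal stays in it because its
  normalising factor is a function of \<open>G\<close> only.

  The Poincare inequality is used as a double integral for two reasons. The mean of a field of
  rotations is in general not a rotation, whereas almost every value R(z) is one. And a double
  integral over two different sets obeys a triangle inequality, so the estimate can be handed from
  ball to ball through the connected domain and up to its Lipschitz boundary.\<close>

primrec Ck :: "nat \<Rightarrow> (real \<Rightarrow> real) \<Rightarrow> bool" where
  "Ck 0 p \<longleftrightarrow> True"
| "Ck (Suc k) p \<longleftrightarrow> (\<exists>p'. (\<forall>t. (p has_real_derivative p' t) (at t)) \<and> Ck k p')"

lemma Ck_SucI: "(\<And>t. (p has_real_derivative p' t) (at t)) \<Longrightarrow> Ck k p' \<Longrightarrow> Ck (Suc k) p"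
  by auto

lemma Ck_Suc_imp: "Ck (Suc k) p \<Longrightarrow> Ck k p"
  by (induction k arbitrary: p) auto

lemma Ck_const: "Ck k (\<lambda>_. c)"
proof (induction k arbitrary: c)
  case (Suc k)
  show ?case by (rule Ck_SucI[where p' = "\<lambda>_. 0"]) (auto intro!: derivative_eq_intros Suc)
qed simp

lemma Ck_add: "Ck k p \<Longrightarrow> Ck k q \<Longrightarrow> Ck k (\<lambda>t. p t + q t)"
proof (induction k arbitrary: p q)
  case (Suc k)
  then obtain p' q' where "\<And>t. (p has_real_derivative p' t) (at t)" "Ck k p'"
    "\<And>t. (q has_real_derivative q' t) (at t)" "Ck k q'" by auto
  then show ?case
    by (intro Ck_SucI[where p' = "\<lambda>t. p' t + q' t"] Suc.IH) (auto intro!: derivative_eq_intros)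
qed simp

lemma Ck_mult: "Ck k p \<Longrightarrow> Ck k q \<Longrightarrow> Ck k (\<lambda>t. p t * q t)"
proof (induction k arbitrary: p q)
  case (Suc k)
  then obtain p' q' where d: "\<And>t. (p has_real_derivative p' t) (at t)" "Ck k p'"
    "\<And>t. (q has_real_derivative q' t) (at t)" "Ck k q'" by auto
  have "Ck k (\<lambda>t. p' t * q t + p t * q' t)"
    using Suc.prems by (intro Ck_add Suc.IH d) (auto intro: Ck_Suc_imp simp del: Ck.simps)
  then show ?case
    using d by (intro Ck_SucI[where p' = "\<lambda>t. p' t * q t + p t * q' t"])
      (auto intro!: derivative_eq_intros)
qed simp

lemma Ck_affine: "Ck k p \<Longrightarrow> Ck k (\<lambda>t. p (m * t + c))"
proof (induction k arbitrary: p)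
  case (Suc k)
  then obtain p' where d: "\<And>t. (p has_real_derivative p' t) (at t)" "Ck k p'" by auto
  have "((\<lambda>t. p (m * t + c)) has_real_derivative p' (m * t + c) * m) (at t)" for t
    by (rule DERIV_chain2[OF d(1)]) (auto intro!: derivative_eq_intros)
  then show ?case
    using d Suc.IH by (intro Ck_SucI[where p' = "\<lambda>t. p' (m * t + c) * m"] Ck_mult Ck_const)
qed simp

text \<open>\<open>Ck 0\<close> imposes nothing, so \<open>Ck k\<close> is only k-fold
  differentiability; demanding all orders makes every derivative continuous as well. The grading by
  \<open>k\<close> is what allows products and affine substitutions to be treated by
  induction.\<close>

definition smooth1 :: "(real \<Rightarrow> real) \<Rightarrow> bool" where
  "smooth1 p \<longleftrightarrow> (\<forall>k. Ck k p)"

lemma smooth1_deriv: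
  assumes "smooth1 p"
  shows smooth1_has_deriv: "(p has_real_derivative deriv p t) (at t)"
    and smooth1_deriv_smooth1: "smooth1 (deriv p)"
proof -
  obtain p' where "\<And>t. (p has_real_derivative p' t) (at t)"
    using assms unfolding smooth1_def by (metis Ck.simps(2))
  then show d: "(p has_real_derivative deriv p t) (at t)" for t
    by (metis DERIV_imp_deriv)
  have "Ck k (deriv p)" for k
  proof -
    obtain p' where p': "\<And>t. (p has_real_derivative p' t) (at t)" "Ck k p'"
      using assms unfolding smooth1_def by (metis Ck.simps(2))
    then have "p' = deriv p" by (auto simp: fun_eq_iff intro: DERIV_imp_deriv[symmetric])
    then show ?thesis using p' by simp
  qed
  then show "smooth1 (deriv p)" by (simp add: smooth1_def)
qed

lemma smooth1_isCont: "smooth1 p \<Longrightarrow> isCont p t"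
  using smooth1_has_deriv DERIV_isCont by blast

lemma smooth1_continuous_on: "smooth1 p \<Longrightarrow> continuous_on S p"
  using smooth1_isCont continuous_at_imp_continuous_on by blast

lemma smooth1_mult: "smooth1 p \<Longrightarrow> smooth1 q \<Longrightarrow> smooth1 (\<lambda>t. p t * q t)"
  by (simp add: smooth1_def Ck_mult)

lemma smooth1_affine: "smooth1 p \<Longrightarrow> smooth1 (\<lambda>t. p (m * t + c))"
  by (simp add: smooth1_def Ck_affine)

lemma deriv_zero_outside:
  assumes p: "smooth1 p" and z: "\<And>t. t \<notin> {a..b} \<Longrightarrow> p t = 0" and t: "t \<notin> {a..b}"
  shows "deriv p t = 0"
proof -
  have "open (- {a..b})" by auto
  have "((\<lambda>_. 0) has_real_derivative 0) (at t)" by simp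
  then have "(p has_real_derivative 0) (at t)"
    by (rule DERIV_cong_ev[OF refl _ refl, THEN iffD1, rotated])
      (use eventually_nhds_in_open[OF \<open>open (- {a..b})\<close>, of t] t z in
        \<open>auto elim!: eventually_mono\<close>)
  then show ?thesis by (rule DERIV_imp_deriv)
qed

text \<open>Every derivative of exp(-1/t), extended by 0 to t \<le> 0, is again a polynomial in 1/t
  times exp(-1/t). Carrying the polynomial along makes the family closed under differentiation, so
  smoothness is a plain induction.\<close>

definition flat_exp :: "real poly \<Rightarrow> real \<Rightarrow> real" where
  "flat_exp P t = (if t > 0 then poly P (1/t) * exp (- 1/t) else 0)"

lemma tendsto_poly_div_exp_0: "((\<lambda>x. poly P x / exp x) \<longlongrightarrow> (0::real)) at_top"
proof -
  have "((\<lambda>x. \<Sum>i\<le>degree P. coeff P i * (x ^ i / exp x)) \<longlongrightarrow> (\<Sum>i\<le>degree P. coeff P i * 0)) at_top"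
    by (intro tendsto_intros tendsto_power_div_exp_0)
  then show ?thesis by (simp add: poly_altdef sum_divide_distrib)
qed

lemma flat_exp_deriv_0: "(flat_exp P has_real_derivative 0) (at 0)"
proof -
  have "((\<lambda>t. (flat_exp P t - flat_exp P 0) / (t - 0)) \<longlongrightarrow> 0) (at 0)"
  proof (rule filterlim_split_at)
    show "((\<lambda>t. (flat_exp P t - flat_exp P 0) / (t - 0)) \<longlongrightarrow> 0) (at_left 0)"
      by (rule tendsto_eventually) (auto simp: flat_exp_def eventually_at_filter)
    \<comment> \<open>\<open>pCons 0 P\<close> is the polynomial s P(s): the additional factor s =
      1/t is the denominator of the difference quotient at 0.\<close>
    have "((\<lambda>t. poly (pCons 0 P) (inverse t) / exp (inverse t)) \<longlongrightarrow> 0) (at_right (0::real))"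
      by (rule filterlim_compose[OF tendsto_poly_div_exp_0 filterlim_inverse_at_top_right])
    moreover have "eventually (\<lambda>t. poly (pCons 0 P) (inverse t) / exp (inverse t)
        = (flat_exp P t - flat_exp P 0) / (t - 0)) (at_right 0)"
      by (auto simp: flat_exp_def eventually_at_filter exp_minus field_simps)
    ultimately show "((\<lambda>t. (flat_exp P t - flat_exp P 0) / (t - 0)) \<longlongrightarrow> 0) (at_right 0)"
      by (rule Lim_transform_eventually)
  qed
  then show ?thesis by (simp add: has_field_derivative_iff)
qed

text \<open>With s = 1/t the chain rule gives s^2 (P(s) - P'(s)) exp(-s); the polynomial
  \<open>[:0,0,1:]\<close> is the factor s^2.\<close>

lemma flat_exp_deriv:
  "(flat_exp P has_real_derivative flat_exp ([:0,0,1:] * (P - pderiv P)) t) (at t)"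
proof (cases t "0::real" rule: linorder_cases)
  case less
  have "((\<lambda>_. 0) has_real_derivative 0) (at t)" by simp
  then have "(flat_exp P has_real_derivative 0) (at t)"
    by (rule DERIV_cong_ev[OF refl _ refl, THEN iffD1, rotated])
      (use eventually_nhds_in_open[of "{..<0}" t] less in
        \<open>auto elim!: eventually_mono simp: flat_exp_def\<close>)
  then show ?thesis using less by (simp add: flat_exp_def)
next
  case equal
  then show ?thesis using flat_exp_deriv_0 by (simp add: flat_exp_def)
next
  case greater
  have "((\<lambda>s. poly P (1/s) * exp (- 1/s)) has_real_derivative
      poly ([:0,0,1:] * (P - pderiv P)) (1/t) * exp (- 1/t)) (at t)"
  proof -
    have "((\<lambda>s. poly P (1/s)) has_real_derivative poly (pderiv P) (1/t) * (- 1/t^2)) (at t)"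
      by (rule DERIV_chain2[OF poly_DERIV])
        (use greater in \<open>auto intro!: derivative_eq_intros simp: power2_eq_square\<close>)
    then show ?thesis
      using greater by (auto intro!: derivative_eq_intros simp: field_simps power2_eq_square)
  qed
  then have "(flat_exp P has_real_derivative poly ([:0,0,1:] * (P - pderiv P)) (1/t) * exp (- 1/t)) (at t)"
    by (rule DERIV_cong_ev[OF refl _ refl, THEN iffD1, rotated])
      (use eventually_nhds_in_open[of "{0<..}" t] greater in
        \<open>auto elim!: eventually_mono simp: flat_exp_def\<close>)
  then show ?thesis using greater by (simp add: flat_exp_def)
qed

lemma smooth1_flat_exp: "smooth1 (flat_exp P)"
proof -
  have "Ck k (flat_exp P)" for k
  proof (induction k arbitrary: P)
    case (Suc k)
    show ?case by (rule Ck_SucI[OF flat_exp_deriv Suc])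
  qed simp
  then show ?thesis by (simp add: smooth1_def)
qed

text \<open>Since \<open>exp (- 1 / (n t))\<close> tends to \<open>1\<close> for \<open>t > 0\<close>, these functions tend to the indicator of
  the open interval.\<close>

definition bump1 :: "real \<Rightarrow> real \<Rightarrow> nat \<Rightarrow> real \<Rightarrow> real" where
  "bump1 a b n t = flat_exp 1 (real n * t + - (real n * a)) * flat_exp 1 ((- real n) * t + real n * b)"

lemma smooth1_bump1: "smooth1 (bump1 a b n)"
  unfolding bump1_def[abs_def] by (intro smooth1_mult smooth1_affine smooth1_flat_exp)

lemma flat_exp_1_le: "0 \<le> flat_exp 1 t" "flat_exp 1 t \<le> 1"
  by (auto simp: flat_exp_def)

lemma bump1_le: "0 \<le> bump1 a b n t" "bump1 a b n t \<le> 1"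
  unfolding bump1_def by (auto intro!: mult_nonneg_nonneg mult_le_one flat_exp_1_le)

lemma bump1_zero_outside: 
  assumes "t \<notin> {a..b}" shows "bump1 a b n t = 0"
proof -
  have "real n * t + - (real n * a) \<le> 0 \<or> (- real n) * t + real n * b \<le> 0"
    using assms using mult_left_mono[of t a "real n"] mult_left_mono[of b t "real n"] by (auto simp: not_le)
  then show ?thesis by (auto simp: bump1_def flat_exp_def)
qed

lemma flat_exp_1_tendsto: "s > 0 \<Longrightarrow> (\<lambda>n. flat_exp 1 (real n * s)) \<longlonglongrightarrow> 1"
proof -
  assume s: "s > 0"
  have "(\<lambda>n. exp (- (1/s) * inverse (real n))) \<longlonglongrightarrow> exp (- (1/s) * 0)"
    by (intro tendsto_intros lim_inverse_n)
  moreover have "eventually (\<lambda>n. exp (- (1/s) * inverse (real n)) = flat_exp 1 (real n * s)) sequentially"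
    by (rule eventually_mono[OF eventually_gt_at_top[of "0::nat"]]) (use s in \<open>auto simp: flat_exp_def field_simps\<close>)
  ultimately show ?thesis by (simp add: Lim_transform_eventually)
qed

lemma bump1_tendsto: "(\<lambda>n. bump1 a b n t) \<longlonglongrightarrow> indicator {a<..<b} t"
proof (cases "t \<in> {a<..<b}")
  case True
  have "(\<lambda>n. flat_exp 1 (real n * (t - a)) * flat_exp 1 (real n * (b - t))) \<longlonglongrightarrow> 1 * 1"
    using True by (intro tendsto_intros flat_exp_1_tendsto) auto
  then show ?thesis using True by (simp add: bump1_def algebra_simps)
next
  case False
  have "real n * t + - (real n * a) \<le> 0 \<or> (- real n) * t + real n * b \<le> 0" for n
    using False using mult_left_mono[of t a "real n"] mult_left_mono[of b t "real n"] by (auto simp: not_less)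
  then have "bump1 a b n t = 0" for n unfolding bump1_def flat_exp_def by (smt (verit) mult_eq_0_iff)
  then show ?thesis using False by simp
qed

definition tens :: "(real \<Rightarrow> real) \<Rightarrow> (real \<Rightarrow> real) \<Rightarrow> real^2 \<Rightarrow> real" where
  "tens p q x = p (x $ 1) * q (x $ 2)"

text \<open>Derivatives in arbitrary directions are kept because the Poincare inequality compares
  two points along the segment joining them, not along coordinate axes.\<close>

definition dird :: "'a::real_vector \<Rightarrow> ('a \<Rightarrow> real) \<Rightarrow> 'a \<Rightarrow> real" where
  "dird h f x = deriv (\<lambda>t. f (x + t *\<^sub>R h)) 0"

lemma pd_eq_dird: "pd i f = dird (axis i 1) f"
  by (auto simp: pd_def dird_def)

lemma tens_has_dird:
  assumes "smooth1 p" "smooth1 q"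
  shows "((\<lambda>t. tens p q (x + t *\<^sub>R h)) has_real_derivative
     h $ 1 * tens (deriv p) q (x + s *\<^sub>R h) + h $ 2 * tens p (deriv q) (x + s *\<^sub>R h)) (at s)"
proof -
  have *: "((\<lambda>t. r (x $ i + t * h $ i)) has_real_derivative deriv r (x $ i + s * h $ i) * h $ i) (at s)"
    if "smooth1 r" for r i
    by (rule DERIV_chain2[OF smooth1_has_deriv[OF that]]) (auto intro!: derivative_eq_intros)
  show ?thesis unfolding tens_def
    by (auto intro!: derivative_eq_intros *[OF assms(1)] *[OF assms(2)] simp: algebra_simps)
qed

lemma dird_tens:
  assumes "smooth1 p" "smooth1 q"
  shows "dird h (tens p q) x = h $ 1 * tens (deriv p) q x + h $ 2 * tens p (deriv q) x"
  unfolding dird_def using tens_has_dird[OF assms, of x h 0] by (intro DERIV_imp_deriv) simp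

lemma pd_tens:
  assumes "smooth1 p" "smooth1 q"
  shows "pd 1 (tens p q) = tens (deriv p) q" "pd 2 (tens p q) = tens p (deriv q)"
  by (auto simp: fun_eq_iff pd_eq_dird dird_tens[OF assms] axis_def)

lemma continuous_on_tens:
  assumes "smooth1 p" "smooth1 q"
  shows "continuous_on S (tens p q)"
  unfolding tens_def[abs_def]
  by (intro continuous_intros continuous_on_compose2[OF smooth1_continuous_on[OF assms(1)]]
       continuous_on_compose2[OF smooth1_continuous_on[OF assms(2)]]) auto

lemma iter_pd_tens:
  assumes "smooth1 p" "smooth1 q"
  shows "\<exists>p' q'. smooth1 p' \<and> smooth1 q' \<and> iter_pd is (tens p q) = tens p' q'"
proof (induction "is")
  case Nil
  then show ?case using assms by auto
next
  case (Cons i "is")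
  then obtain p' q' where *: "smooth1 p'" "smooth1 q'" "iter_pd is (tens p q) = tens p' q'" by auto
  have "i = 1 \<or> i = 2" using exhaust_2 by blast
  then show ?case using * pd_tens[OF *(1,2)] smooth1_deriv_smooth1 by fastforce
qed

lemma smooth_on_tens:
  assumes "smooth1 p" "smooth1 q"
  shows "smooth_on UNIV (tens p q)"
  unfolding smooth_on_def
proof (intro allI conjI ballI)
  fix "is" :: "2 list" and i :: 2 and x :: "real^2"
  obtain p' q' where *: "smooth1 p'" "smooth1 q'" "iter_pd is (tens p q) = tens p' q'"
    using iter_pd_tens[OF assms] by blast
  show "continuous_on UNIV (iter_pd is (tens p q))"
    using * continuous_on_tens by simp
  show "(\<lambda>t. iter_pd is (tens p q) (x + t *\<^sub>R axis i 1)) differentiable at 0"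
    using tens_has_dird[OF *(1,2), of x "axis i 1" 0] real_differentiable_def * by auto
qed

text \<open>Products of one-variable functions suffice as test functions, and their mixed partial derivatives
  trivially commute.\<close>

definition bumps :: "(real^2) set \<Rightarrow> (real^2 \<Rightarrow> real) set" where
  "bumps S = {tens p q |p q. smooth1 p \<and> smooth1 q \<and>
     (\<exists>a b. cbox a b \<subseteq> S \<and> (\<forall>t. t \<notin> {a$1..b$1} \<longrightarrow> p t = 0) \<and> (\<forall>t. t \<notin> {a$2..b$2} \<longrightarrow> q t = 0))}"

lemma bumpsE:
  assumes "\<phi> \<in> bumps S"
  obtains p q a b where "\<phi> = tens p q" "smooth1 p" "smooth1 q" "cbox a b \<subseteq> S"
    "\<And>t. t \<notin> {a$1..b$1} \<Longrightarrow> p t = 0" "\<And>t. t \<notin> {a$2..b$2} \<Longrightarrow> q t = 0"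
    "\<And>x. x \<notin> cbox a b \<Longrightarrow> \<phi> x = 0"
proof -
  obtain p q a b where *: "\<phi> = tens p q" "smooth1 p" "smooth1 q" "cbox a b \<subseteq> S"
    "\<And>t. t \<notin> {a$1..b$1} \<Longrightarrow> p t = 0" "\<And>t. t \<notin> {a$2..b$2} \<Longrightarrow> q t = 0"
    using assms unfolding bumps_def by blast
  have "\<phi> x = 0" if "x \<notin> cbox a b" for x
    using that * unfolding mem_box_cart forall_2 by (auto simp: tens_def)
  with * that show thesis by blast
qed

lemma bumpsI:
  assumes "smooth1 p" "smooth1 q" "cbox a b \<subseteq> S"
    "\<And>t. t \<notin> {a$1..b$1} \<Longrightarrow> p t = 0" "\<And>t. t \<notin> {a$2..b$2} \<Longrightarrow> q t = 0"
  shows "tens p q \<in> bumps S"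
  using assms unfolding bumps_def by blast

lemma pd_bumps:
  assumes "\<phi> \<in> bumps S" shows "pd i \<phi> \<in> bumps S"
proof -
  obtain p q a b where *: "\<phi> = tens p q" "smooth1 p" "smooth1 q" "cbox a b \<subseteq> S"
    "\<And>t. t \<notin> {a$1..b$1} \<Longrightarrow> p t = 0" "\<And>t. t \<notin> {a$2..b$2} \<Longrightarrow> q t = 0"
    using assms by (rule bumpsE) blast
  have "i = 1 \<or> i = 2" using exhaust_2 by blast
  then show ?thesis
  proof
    assume "i = 1"
    then have "pd i \<phi> = tens (deriv p) q" using * pd_tens by simp
    then show ?thesis
      using * by (simp only:) (intro bumpsI[where a=a and b=b] smooth1_deriv_smooth1; (assumption | rule deriv_zero_outside[of p]; assumption))
  next
    assume "i = 2"
    then have "pd i \<phi> = tens p (deriv q)" using * pd_tens by simp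
    then show ?thesis
      using * by (simp only:) (intro bumpsI[where a=a and b=b] smooth1_deriv_smooth1; (assumption | rule deriv_zero_outside[of q]; assumption))
  qed
qed

lemma pd_commute_bumps:
  assumes "\<phi> \<in> bumps S" shows "pd i (pd j \<phi>) = pd j (pd i \<phi>)"
proof -
  obtain p q where *: "\<phi> = tens p q" "smooth1 p" "smooth1 q" using assms by (rule bumpsE) blast
  note s = *(2,3) *(2,3)[THEN smooth1_deriv_smooth1]
  have "i = 1 \<or> i = 2" "j = 1 \<or> j = 2" using exhaust_2 by blast+
  then show ?thesis unfolding *(1) using s by (auto simp: pd_tens)
qed

lemma test_fun_bumps:
  assumes "\<phi> \<in> bumps S" shows "test_fun S \<phi>"
proof -
  obtain p q a b where *: "\<phi> = tens p q" "smooth1 p" "smooth1 q" "cbox a b \<subseteq> S"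
    "\<And>x. x \<notin> cbox a b \<Longrightarrow> \<phi> x = 0" using assms by (rule bumpsE) blast
  then have "{x. \<phi> x \<noteq> 0} \<subseteq> cbox a b" by auto
  then have c: "closure {x. \<phi> x \<noteq> 0} \<subseteq> cbox a b" by (simp add: closure_minimal closed_cbox)
  then have "compact (closure {x. \<phi> x \<noteq> 0})"
    using compact_cbox bounded_subset bounded_cbox compact_closure by (metis bounded_subset \<open>{x. \<phi> x \<noteq> 0} \<subseteq> cbox a b\<close>)
  then show ?thesis unfolding test_fun_def using c * smooth_on_tens by auto
qed

text \<open>Weak derivatives are tested with bumps that travel along a segment; the assumption keeps
  the travelling supporting box inside \<open>S'\<close>.\<close>

lemma shift_bumps:
  assumes "\<phi> \<in> bumps S" "\<And>x. x \<in> S \<Longrightarrow> x + c \<in> S'"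
  shows "(\<lambda>x. \<phi> (x - c)) \<in> bumps S'"
proof -
  obtain p q a b where *: "\<phi> = tens p q" "smooth1 p" "smooth1 q" "cbox a b \<subseteq> S"
    "\<And>t. t \<notin> {a$1..b$1} \<Longrightarrow> p t = 0" "\<And>t. t \<notin> {a$2..b$2} \<Longrightarrow> q t = 0"
    using assms(1) by (rule bumpsE) blast
  have "(\<lambda>x. \<phi> (x - c)) = tens (\<lambda>t. p (1 * t + - c$1)) (\<lambda>t. q (1 * t + - c$2))"
    by (auto simp: *(1) tens_def fun_eq_iff)
  moreover have "cbox (a + c) (b + c) \<subseteq> S'"
  proof
    fix x assume "x \<in> cbox (a + c) (b + c)"
    then have "x - c \<in> cbox a b" by (auto simp: mem_box_cart algebra_simps)
    then show "x \<in> S'" using assms(2)[of "x - c"] *(4) by auto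
  qed
  moreover have "smooth1 (\<lambda>t. p (1 * t + - c$1))" "smooth1 (\<lambda>t. q (1 * t + - c$2))"
    using * by (blast intro: smooth1_affine)+
  ultimately show ?thesis
    using * by (simp only:) (rule bumpsI[where a="a+c" and b="b+c"]; auto simp: algebra_simps)
qed

lemma bumps_continuous_on:
  assumes "\<phi> \<in> bumps S" shows "continuous_on A \<phi>"
  using assms by (elim bumpsE) (auto intro: continuous_on_tens)

lemma bumps_bounded:
  assumes "\<phi> \<in> bumps S" shows "\<exists>M>0. \<forall>x. \<bar>\<phi> x\<bar> \<le> M"
proof -
  obtain p q a b where *: "\<And>x. x \<notin> cbox a b \<Longrightarrow> \<phi> x = 0" using assms by (rule bumpsE) blast
  have "compact (\<phi> ` cbox a b)"
    by (intro compact_continuous_image bumps_continuous_on[OF assms] compact_cbox)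
  then obtain M where "M > 0" "\<And>x. x \<in> cbox a b \<Longrightarrow> norm (\<phi> x) \<le> M"
    using compact_imp_bounded bounded_pos by (metis imageI)
  then have "\<bar>\<phi> x\<bar> \<le> M" for x using *[of x] by (cases "x \<in> cbox a b") auto
  then show ?thesis using \<open>M > 0\<close> by blast
qed

lemma bumps_measurable: "\<phi> \<in> bumps S \<Longrightarrow> \<phi> \<in> borel_measurable borel"
  by (simp add: bumps_continuous_on borel_measurable_continuous_onI)

lemma bumps_has_dird:
  assumes "\<phi> \<in> bumps S"
  shows "((\<lambda>t. \<phi> (x + t *\<^sub>R h)) has_real_derivative dird h \<phi> (x + s *\<^sub>R h)) (at s)"
  using assms by (elim bumpsE) (simp add: dird_tens tens_has_dird)

lemma dird_bumps_eq:
  assumes "\<phi> \<in> bumps S"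
  shows "dird h \<phi> = (\<lambda>x. h $ 1 * pd 1 \<phi> x + h $ 2 * pd 2 \<phi> x)"
  using assms by (elim bumpsE) (rule ext, simp add: dird_tens pd_tens)

lemma dird_bumps_bounded:
  assumes "\<phi> \<in> bumps S" shows "\<exists>M>0. \<forall>x. \<bar>dird h \<phi> x\<bar> \<le> M"
proof -
  obtain M1 where M1: "M1 > 0" "\<And>x. \<bar>pd 1 \<phi> x\<bar> \<le> M1"
    using bumps_bounded[OF pd_bumps[OF assms]] by metis
  obtain M2 where M2: "M2 > 0" "\<And>x. \<bar>pd 2 \<phi> x\<bar> \<le> M2"
    using bumps_bounded[OF pd_bumps[OF assms]] by metis
  show ?thesis
  proof (intro exI[of _ "\<bar>h$1\<bar> * M1 + \<bar>h$2\<bar> * M2 + 1"] conjI allI)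
    show "\<bar>h$1\<bar> * M1 + \<bar>h$2\<bar> * M2 + 1 > 0" using M1 M2 by (intro add_nonneg_pos) auto
    fix x
    have "\<bar>dird h \<phi> x\<bar> \<le> \<bar>h$1 * pd 1 \<phi> x\<bar> + \<bar>h$2 * pd 2 \<phi> x\<bar>"
      unfolding dird_bumps_eq[OF assms] by (rule abs_triangle_ineq)
    also have "\<dots> \<le> \<bar>h$1\<bar> * M1 + \<bar>h$2\<bar> * M2"
      by (intro add_mono) (auto simp: abs_mult intro!: mult_left_mono M1 M2)
    finally show "\<bar>dird h \<phi> x\<bar> \<le> \<bar>h$1\<bar> * M1 + \<bar>h$2\<bar> * M2 + 1" by simp
  qed
qed

lemma dird_bumps_continuous_on: "\<phi> \<in> bumps S \<Longrightarrow> continuous_on A (dird h \<phi>)"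
  unfolding dird_bumps_eq by (intro continuous_intros bumps_continuous_on[OF pd_bumps])

text \<open>Open boxes are an intersection-stable generator of the Borel sets, and the sets over
  which \<open>v\<close> integrates to zero form a Dynkin class; the integral over the whole space
  enters through complements. So \<open>v\<close> and 0 have the same integral over every Borel
  set.\<close>

lemma AE_zero_of_box_integrals:
  fixes v :: "'a::euclidean_space \<Rightarrow> real"
  assumes int: "integrable lborel v" and z: "(LBINT x. v x) = 0"
    and box: "\<And>c d. (LBINT x. indicator (box c d) x * v x) = 0"
  shows "AE x in lborel. v x = 0"
proof (rule density_unique_real[OF int, of "\<lambda>_. 0"])
  have [measurable]: "v \<in> borel_measurable borel" using int by auto
  let ?P = "\<lambda>A. (LBINT x. indicator A x * v x) = 0"
  let ?G = "range (\<lambda>(c, d). box c d :: 'a set)"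
  fix A :: "'a set" assume "A \<in> sets lborel"
  then have A: "A \<in> sigma_sets UNIV ?G" by (simp add: borel_eq_box)
  have G: "sigma_sets UNIV ?G = sets (borel :: 'a measure)" by (simp add: borel_eq_box)
  have st: "Int_stable ?G" by (auto simp: Int_stable_def box_Int_box)
  have cl: "?G \<subseteq> Pow UNIV" by simp
  have "?P A"
    using st cl A
  proof (induction rule: sigma_sets_induct_disjoint)
    case (basic A)
    then show ?case using box by auto
  next
    case (compl A)
    then have [measurable]: "A \<in> sets borel" using G by simp
    have "(LBINT x. indicator (UNIV - A) x * v x) = (LBINT x. v x - indicator A x * v x)"
      by (rule Bochner_Integration.integral_cong) (auto simp: indicator_def)
    also have "\<dots> = 0"
      using compl z integrable_mult_indicator[OF _ int, of A]
      by (subst Bochner_Integration.integral_diff[OF int]) auto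
    finally show ?case .
  next
    case (union A)
    then have [measurable]: "A i \<in> sets borel" for i using G by auto
    have "set_lebesgue_integral lborel (\<Union>i. A i) v = (\<Sum>i. set_lebesgue_integral lborel (A i) v)"
    proof (rule lebesgue_integral_countable_add)
      show "A i \<inter> A j = {}" if "i \<noteq> j" for i j
        using union(1) that by (auto simp: disjoint_family_on_def)
      show "set_integrable lborel (\<Union> (range A)) v"
        unfolding set_integrable_def by (rule integrable_mult_indicator[OF _ int]) auto
    qed auto
    then show ?case using union(3) by (simp add: set_lebesgue_integral_def)
  qed auto
  then show "set_lebesgue_integral lborel A v = set_lebesgue_integral lborel A (\<lambda>_. 0)"
    by (simp add: set_lebesgue_integral_def)
qed simp

lemma box_negligible_diff: "AE x in lebesgue. x \<in> cbox a b \<longrightarrow> x \<in> box a (b::'a::euclidean_space)"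
proof -
  have "cbox a b - box a b \<in> null_sets lebesgue"
    using negligible_frontier_interval[of a b] by (simp add: negligible_iff_null_sets)
  then show ?thesis by (auto dest: AE_not_in)
qed

lemma bump1_in_bumps:
  assumes "cbox a b \<subseteq> S"
  shows "tens (bump1 (a$1) (b$1) n) (bump1 (a$2) (b$2) n) \<in> bumps S"
  using assms by (auto intro!: bumpsI[where a=a and b=b] smooth1_bump1 bump1_zero_outside)

text \<open>The fundamental lemma of the calculus of variations. Product bumps lie between 0 and 1
  and tend to the indicator of an open box, so dominated convergence gives vanishing integrals over
  all boxes whose closure lies in \<open>S\<close>; these determine \<open>u\<close> almost
  everywhere.\<close>

lemma AE_zero_of_bumps:
  assumes S: "open S" and u: "loc_int S u"
    and z: "\<And>\<phi>. \<phi> \<in> bumps S \<Longrightarrow> (LINT x:S|lebesgue. u x * \<phi> x) = 0"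
  shows "AE x in lebesgue. x \<in> S \<longrightarrow> u x = 0"
proof -
  have box0: "(LINT x:box a b|lebesgue. u x) = 0" if ab: "cbox a b \<subseteq> S" for a b
  proof -
    define \<phi> where "\<phi> n = tens (bump1 (a$1) (b$1) n) (bump1 (a$2) (b$2) n)" for n
    have \<phi>: "\<phi> n \<in> bumps S" for n unfolding \<phi>_def by (rule bump1_in_bumps[OF ab])
    have le: "0 \<le> \<phi> n x" "\<phi> n x \<le> 1" for n x
      unfolding \<phi>_def tens_def by (auto intro!: bump1_le mult_le_one mult_nonneg_nonneg)
    have out: "\<phi> n x = 0" if "x \<notin> cbox a b" for n x
      using that bump1_zero_outside unfolding \<phi>_def tens_def mem_box_cart forall_2 
      by (metis atLeastAtMost_iff mult_eq_0_iff)
    have iu: "set_integrable lebesgue (cbox a b) u"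
      using u ab compact_cbox unfolding loc_int_def by blast
    have "(\<lambda>n. LINT x|lebesgue. indicator (cbox a b) x * u x * \<phi> n x) \<longlonglongrightarrow>
        (LINT x|lebesgue. indicator (cbox a b) x * u x * indicator (box a b) x)"
    proof (rule integral_dominated_convergence[where w="\<lambda>x. norm (indicator (cbox a b) x * u x)"])
      have m: "(\<lambda>x. indicator (cbox a b) x * u x) \<in> borel_measurable lebesgue"
        using iu unfolding set_integrable_def by (auto dest: borel_measurable_integrable)
      show "(\<lambda>x. indicator (cbox a b) x * u x * indicator (box a b) x) \<in> borel_measurable lebesgue"
        by (intro borel_measurable_times m borel_measurable_indicator) auto
      show "(\<lambda>x. indicator (cbox a b) x * u x * \<phi> n x) \<in> borel_measurable lebesgue" for n
        using bumps_measurable[OF \<phi>] by (intro borel_measurable_times m) (simp add: measurable_completion)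
      show "integrable lebesgue (\<lambda>x. norm (indicator (cbox a b) x * u x))"
        using iu unfolding set_integrable_def by (intro integrable_norm) simp
      have "(\<lambda>n. \<phi> n x) \<longlonglongrightarrow> indicator (box a b) x" for x
      proof -
        have "(\<lambda>n. \<phi> n x) \<longlonglongrightarrow> indicator {a$1<..<b$1} (x$1) * indicator {a$2<..<b$2} (x$2)"
          unfolding \<phi>_def tens_def by (intro tendsto_mult bump1_tendsto)
        moreover have "indicator {a$1<..<b$1} (x$1) * indicator {a$2<..<b$2} (x$2) = (indicator (box a b) x :: real)"
          by (auto simp: indicator_def mem_box_cart forall_2)
        ultimately show ?thesis by simp
      qed
      then show "AE x in lebesgue. (\<lambda>n. indicator (cbox a b) x * u x * \<phi> n x)
          \<longlonglongrightarrow> indicator (cbox a b) x * u x * indicator (box a b) x"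
        by (intro AE_I2 tendsto_mult tendsto_const)
      show "AE x in lebesgue. norm (indicator (cbox a b) x * u x * \<phi> n x) \<le> norm (indicator (cbox a b) x * u x)" for n
        using le[of n] by (intro AE_I2) (auto simp: abs_mult intro!: mult_left_le)
    qed
    moreover have "(LINT x|lebesgue. indicator (cbox a b) x * u x * \<phi> n x) = 0" for n
    proof -
      have "(LINT x|lebesgue. indicator (cbox a b) x * u x * \<phi> n x) = (LINT x:S|lebesgue. u x * \<phi> n x)"
        unfolding set_lebesgue_integral_def
        by (rule Bochner_Integration.integral_cong) (use ab out in \<open>auto simp: indicator_def\<close>)
      then show ?thesis using z[OF \<phi>] by simp
    qed
    moreover have "(LINT x|lebesgue. indicator (cbox a b) x * u x * indicator (box a b) x) = (LINT x:box a b|lebesgue. u x)"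
      unfolding set_lebesgue_integral_def
      by (rule Bochner_Integration.integral_cong) (use box_subset_cbox[of a b] in \<open>auto simp: indicator_def\<close>)
    ultimately show ?thesis using LIMSEQ_unique[OF _ tendsto_const] by auto
  qed
  have cb: "AE x in lebesgue. x \<in> cbox a b \<longrightarrow> u x = 0" if ab: "cbox a b \<subseteq> S" for a b
  proof -
    \<comment> \<open>\<open>u\<close> is only locally integrable, so it is cut off to one box,
      where it is integrable over the whole space, and then replaced by a Borel representative
      \<open>v'\<close>.\<close>
    define v where "v x = indicator (box a b) x * u x" for x
    have "set_integrable lebesgue (cbox a b) u"
      using u ab compact_cbox unfolding loc_int_def by blast
    then have "set_integrable lebesgue (box a b) u"
      by (rule set_integrable_subset) (auto intro: box_subset_cbox[THEN subsetD])
    then have iv: "integrable lebesgue v" unfolding set_integrable_def v_def by simp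
    obtain v' where v'[measurable]: "v' \<in> borel_measurable lborel" and ae: "AE x in lborel. v x = v' x"
      using completion_ex_borel_measurable_real[of v lborel] iv by (auto dest: borel_measurable_integrable)
    have ae': "AE x in lebesgue. v x = v' x" using ae by (rule AE_completion)
    have iv': "integrable lborel v'"
    proof -
      have "integrable lebesgue v'"
        using iv ae' by (subst integrable_cong_AE[of v' _ v]) (auto dest: borel_measurable_integrable intro: measurable_completion)
      then show ?thesis using integrable_completion[of v' lborel] v' by simp
    qed
    have B: "(LBINT x. indicator (box c d) x * v' x) = 0" for c d
    proof -
      \<comment> \<open>The intersection of two boxes is a box, possibly empty, and its closed box
        remains inside \<open>cbox a b\<close>, so \<open>box0\<close> applies to it.\<close>
      obtain c' d' where cd: "box c d \<inter> box a b = box c' d'" "cbox c' d' \<subseteq> cbox a b"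
      proof (rule that[of "\<chi> i. max (c$i) (a$i)" "\<chi> i. min (d$i) (b$i)"])
        show "box c d \<inter> box a b = box (\<chi> i. max (c$i) (a$i)) (\<chi> i. min (d$i) (b$i))"
          by (auto simp: mem_box_cart)
        show "cbox (\<chi> i. max (c$i) (a$i)) (\<chi> i. min (d$i) (b$i)) \<subseteq> cbox a b"
          by (auto simp: mem_box_cart)
      qed
      have "(LBINT x. indicator (box c d) x * v' x) = (\<integral>x. indicator (box c d) x * v' x \<partial>lebesgue)"
        by (rule integral_completion[symmetric]) auto
      also have "\<dots> = (\<integral>x. indicator (box c d) x * v x \<partial>lebesgue)"
        using iv ae' by (intro integral_cong_AE borel_measurable_times borel_measurable_indicator)
          (auto dest: borel_measurable_integrable intro: measurable_completion)
      also have "\<dots> = (LINT x:box c' d'|lebesgue. u x)"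
        unfolding set_lebesgue_integral_def cd(1)[symmetric] v_def
        by (rule Bochner_Integration.integral_cong) (auto simp: indicator_def)
      also have "\<dots> = 0" using cd ab by (intro box0) auto
      finally show ?thesis .
    qed
    have Z: "(LBINT x. v' x) = 0"
    proof -
      have "(LBINT x. v' x) = (\<integral>x. v' x \<partial>lebesgue)"
        by (rule integral_completion[symmetric]) auto
      also have "\<dots> = (\<integral>x. v x \<partial>lebesgue)"
        using iv ae' by (intro integral_cong_AE)
          (auto dest: borel_measurable_integrable intro: measurable_completion)
      also have "\<dots> = (LINT x:box a b|lebesgue. u x)"
        unfolding set_lebesgue_integral_def v_def by simp
      also have "\<dots> = 0" using box0[OF ab] .
      finally show ?thesis .
    qed
    have "AE x in lborel. v' x = 0" by (rule AE_zero_of_box_integrals[OF iv' Z B])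
    then have "AE x in lebesgue. v' x = 0" by (rule AE_completion)
    with ae' box_negligible_diff[of a b] show ?thesis
      by eventually_elim (auto simp: v_def)
  qed
  \<comment> \<open>Countably many closed boxes exhaust the open set, and a countable union of null
    sets is null.\<close>
  obtain \<D> where D: "countable \<D>" "\<D> \<subseteq> Pow S" "\<And>X. X \<in> \<D> \<Longrightarrow> \<exists>a b. X = cbox a b" "\<Union>\<D> = S"
    using open_countable_Union_open_cbox[OF S] by metis
  have "AE x in lebesgue. \<forall>X\<in>\<D>. x \<in> X \<longrightarrow> u x = 0"
  proof (subst AE_ball_countable[OF D(1)], intro ballI)
    fix X assume X: "X \<in> \<D>"
    then obtain a b where ab: "X = cbox a b" using D(3) by blast
    show "AE x in lebesgue. x \<in> X \<longrightarrow> u x = 0"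
      unfolding ab by (rule cb) (use D(2) X ab in blast)
  qed
  then show ?thesis by eventually_elim (use D(4) in blast)
qed

section \<open>Weak derivatives and translations\<close>

lemma integral_shift:
  fixes f :: "'a::euclidean_space \<Rightarrow> real"
  assumes [measurable]: "f \<in> borel_measurable borel"
  shows "(LBINT x. f (x + c)) = (LBINT x. f x)"
proof -
  have "(LBINT x. f x) = (\<integral>x. f x \<partial>(distr lborel borel ((+) c)))" by (simp add: lborel_distr_plus)
  also have "\<dots> = (LBINT x. f (c + x))" by (rule integral_distr) auto
  finally show ?thesis by (simp add: add.commute)
qed

lemma nn_integral_shift:
  fixes f :: "'a::euclidean_space \<Rightarrow> ennreal"
  assumes [measurable]: "f \<in> borel_measurable borel"
  shows "(\<integral>\<^sup>+x. f (x + c) \<partial>lborel) = (\<integral>\<^sup>+x. f x \<partial>lborel)"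
proof -
  have "(\<integral>\<^sup>+x. f x \<partial>lborel) = (\<integral>\<^sup>+x. f x \<partial>(distr lborel borel ((+) c)))" by (simp add: lborel_distr_plus)
  also have "\<dots> = (\<integral>\<^sup>+x. f (c + x) \<partial>lborel)" by (rule nn_integral_distr) auto
  finally show ?thesis by (simp add: add.commute)
qed

lemma integrable_shift:
  fixes f :: "'a::euclidean_space \<Rightarrow> real"
  assumes "integrable lborel f"
  shows "integrable lborel (\<lambda>x. f (x + c))"
proof -
  have [measurable]: "f \<in> borel_measurable borel" using assms by auto
  show ?thesis
    using assms nn_integral_shift[of "\<lambda>x. ennreal (norm (f x))" c] unfolding integrable_iff_bounded by simp
qed

text \<open>The average over a segment is an integral against this probability measure on the line.
  As a finite measure it forms a product with \<open>lborel\<close>, which makes Fubini available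
  for the segment parameter and the base point.\<close>

abbreviation unitm :: "real measure" where
  "unitm \<equiv> uniform_measure lborel {0..1}"

lemma finite_measure_unitm: "finite_measure unitm"
  by (rule finite_measureI) simp

interpretation unitm: finite_measure unitm by (rule finite_measure_unitm)

interpretation ulb: pair_sigma_finite unitm "lborel :: 'a::euclidean_space measure" ..

lemma emeasure_unitm_UNIV: "emeasure unitm UNIV = 1"
  by (subst emeasure_uniform_measure) auto

lemma measure_unitm_UNIV: "measure unitm UNIV = 1"
  using emeasure_unitm_UNIV by (simp add: measure_def)

lemma AE_unitm: "AE t in unitm. 0 \<le> t \<and> t \<le> 1"
  by (rule AE_uniform_measureI) auto

lemma integral_unitm:
  fixes f :: "real \<Rightarrow> real"
  assumes "f \<in> borel_measurable borel"
  shows "(\<integral>t. f t \<partial>unitm) = (LBINT t. f t * indicator {0..1} t)"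
proof -
  have "unitm = density lborel (\<lambda>x. ennreal (indicator {0..1} x))"
    by (simp add: uniform_measure_def ennreal_indicator divide_ennreal_def)
  then show ?thesis using assms by (simp add: integral_density mult.commute)
qed

lemma unitm_FTC:
  fixes F :: "real \<Rightarrow> real"
  assumes "\<And>t. (F has_real_derivative f t) (at t)" "\<And>t. isCont f t"
  shows "(\<integral>t. f t \<partial>unitm) = F 1 - F 0"
proof -
  have "f \<in> borel_measurable borel"
    using assms(2) by (intro borel_measurable_continuous_onI continuous_at_imp_continuous_on) auto
  then show ?thesis
    using integral_FTC_Icc_real[of 0 1 F f] assms by (simp add: integral_unitm)
qed

text \<open>Translation invariance bounds the integral over each slice by M times the L1 norm of
  \<open>g\<close>, uniformly in t, and \<open>unitm\<close> has total mass 1. This is the joint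
  integrability that Fubini asks for.\<close>

lemma integrable_unitm_lborel:
  fixes g :: "'a::euclidean_space \<Rightarrow> real"
  assumes g: "integrable lborel g" and k[measurable]: "k \<in> borel_measurable (unitm \<Otimes>\<^sub>M lborel)"
    and M: "\<And>p. \<bar>k p\<bar> \<le> M"
  shows "integrable (unitm \<Otimes>\<^sub>M lborel) (\<lambda>(t, x). g (x + t *\<^sub>R h) * k (t, x))"
proof (rule integrableI_bounded)
  have [measurable]: "g \<in> borel_measurable borel" using g by auto
  have M0: "0 \<le> M" using M[of undefined] by linarith
  show "(\<lambda>(t, x). g (x + t *\<^sub>R h) * k (t, x)) \<in> borel_measurable (unitm \<Otimes>\<^sub>M lborel)" by measurable
  have "(\<integral>\<^sup>+ p. ennreal (norm (case p of (t, x) \<Rightarrow> g (x + t *\<^sub>R h) * k (t, x))) \<partial>(unitm \<Otimes>\<^sub>M lborel))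
     = (\<integral>\<^sup>+ t. (\<integral>\<^sup>+ x. ennreal (norm (g (x + t *\<^sub>R h) * k (t, x))) \<partial>lborel) \<partial>unitm)"
    by (subst lborel.nn_integral_fst[symmetric]) (auto simp: case_prod_beta)
  also have "\<dots> \<le> (\<integral>\<^sup>+ t. (\<integral>\<^sup>+ x. ennreal M * ennreal (norm (g (x + t *\<^sub>R h))) \<partial>lborel) \<partial>unitm)"
    using M M0 by (intro nn_integral_mono)
      (auto simp: ennreal_mult[symmetric] abs_mult mult.commute[of M] intro!: ennreal_leI mult_left_mono)
  also have "\<dots> = ennreal M * (\<integral>\<^sup>+ x. ennreal (norm (g x)) \<partial>lborel)"
    using nn_integral_shift[of "\<lambda>x. ennreal (norm (g x))"] emeasure_unitm_UNIV
    by (simp add: nn_integral_cmult)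
  also have "\<dots> < \<infinity>"
    using g unfolding integrable_iff_bounded by (auto simp: ennreal_mult_less_top)
  finally show "(\<integral>\<^sup>+ p. ennreal (norm (case p of (t, x) \<Rightarrow> g (x + t *\<^sub>R h) * k (t, x))) \<partial>(unitm \<Otimes>\<^sub>M lborel)) < \<infinity>" .
qed

lemma AE_zero_of_bumps_lborel:
  assumes S: "open S" and u: "integrable lborel u"
    and z: "\<And>\<phi>. \<phi> \<in> bumps S \<Longrightarrow> (LBINT x. u x * \<phi> x) = 0"
  shows "AE x in lborel. x \<in> S \<longrightarrow> u x = 0"
proof -
  have [measurable]: "u \<in> borel_measurable borel" using u by auto
  have iu: "integrable lebesgue u" using u by (simp add: integrable_completion)
  have "AE x in lebesgue. x \<in> S \<longrightarrow> u x = 0"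
  proof (rule AE_zero_of_bumps[OF S])
    show "loc_int S u"
      unfolding loc_int_def set_integrable_def
      by (intro allI impI integrable_mult_indicator iu) (auto intro: lmeasurable_compact fmeasurableD)
    fix \<phi> assume \<phi>: "\<phi> \<in> bumps S"
    note [measurable] = bumps_measurable[OF \<phi>]
    obtain a b where ab: "cbox a b \<subseteq> S" "\<And>x. x \<notin> cbox a b \<Longrightarrow> \<phi> x = 0"
      using \<phi> by (rule bumpsE) blast
    have "(LINT x:S|lebesgue. u x * \<phi> x) = (\<integral>x. u x * \<phi> x \<partial>lebesgue)"
      unfolding set_lebesgue_integral_def
      by (rule Bochner_Integration.integral_cong) (use ab in \<open>auto simp: indicator_def\<close>)
    also have "\<dots> = (LBINT x. u x * \<phi> x)" by (rule integral_completion) measurable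
    finally show "(LINT x:S|lebesgue. u x * \<phi> x) = 0" using z[OF \<phi>] by simp
  qed
  then show ?thesis by (simp add: AE_completion_iff)
qed

text \<open>Bounded functions with a square integrable weak derivative in direction \<open>h\<close>. Both functions are Borel
  representatives that vanish outside the domain, so that all integrals run over the plane.\<close>

definition wd :: "(real^2) set \<Rightarrow> real^2 \<Rightarrow> (real^2 \<Rightarrow> real) \<Rightarrow> (real^2 \<Rightarrow> real) \<Rightarrow> bool" where
  "wd S h f g \<longleftrightarrow> f \<in> borel_measurable borel \<and> g \<in> borel_measurable borel \<and>
     (\<forall>x. x \<notin> S \<longrightarrow> f x = 0 \<and> g x = 0) \<and> (\<exists>M. \<forall>x. \<bar>f x\<bar> \<le> M) \<and>
     integrable lborel (\<lambda>x. (g x)\<^sup>2) \<and>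
     (\<forall>\<phi>\<in>bumps S. (LBINT x. f x * dird h \<phi> x) = - (LBINT x. g x * \<phi> x))"

lemma wdD:
  assumes "wd S h f g"
  shows "f \<in> borel_measurable borel" "g \<in> borel_measurable borel"
    "x \<notin> S \<Longrightarrow> f x = 0" "x \<notin> S \<Longrightarrow> g x = 0"
    "integrable lborel (\<lambda>x. (g x)\<^sup>2)"
    "\<phi> \<in> bumps S \<Longrightarrow> (LBINT x. f x * dird h \<phi> x) = - (LBINT x. g x * \<phi> x)"
  using assms unfolding wd_def by blast+

lemma wd_bounded:
  assumes "wd S h f g"
  shows "\<exists>M>0. \<forall>x. \<bar>f x\<bar> \<le> M"
proof -
  obtain M where M: "\<And>x. \<bar>f x\<bar> \<le> M" using assms unfolding wd_def by blast
  show ?thesis by (rule exI[of _ "max M 1"]) (use M in \<open>auto simp: le_max_iff_disj\<close>)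
qed

lemma abs_le_one_plus_square: "\<bar>t\<bar> \<le> 1 + (t::real)\<^sup>2"
proof -
  have "0 \<le> (\<bar>t\<bar> - 1)\<^sup>2" by simp
  then have "2 * \<bar>t\<bar> \<le> 1 + t\<^sup>2" by (simp add: power2_eq_square algebra_simps)
  then show ?thesis by linarith
qed

lemma integrable_mult_bounded:
  fixes k :: "real^2 \<Rightarrow> real"
  assumes k: "integrable lborel k" and [measurable]: "\<psi> \<in> borel_measurable borel" and M: "\<And>x. \<bar>\<psi> x\<bar> \<le> M"
  shows "integrable lborel (\<lambda>x. k x * \<psi> x)"
proof (rule Bochner_Integration.integrable_bound[OF integrable_mult_right[OF k, of M]])
  have [measurable]: "k \<in> borel_measurable borel" using k by simp
  show "(\<lambda>x. k x * \<psi> x) \<in> borel_measurable lborel" by measurable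
  have "norm (k x * \<psi> x) \<le> norm (M * k x)" for x
    using mult_left_mono[OF M[of x] abs_ge_zero[of "k x"]] M[of x]
    by (simp add: abs_mult mult.commute)
  then show "AE x in lborel. norm (k x * \<psi> x) \<le> norm (M * k x)" by simp
qed

locale bounded_open =
  fixes S :: "(real^2) set"
  assumes open_S: "open S" and bounded_S: "bounded S"
begin

lemma borel_S[measurable]: "S \<in> sets borel" using open_S by simp

lemma emeasure_S: "emeasure lborel S < \<infinity>"
  using bounded_S by (rule emeasure_bounded_finite)

lemma integrable_indicator_S: "integrable lborel (\<lambda>x. c * indicator S x :: real)"
  using emeasure_S by (intro integrable_mult_right) (simp add: integrable_indicator_iff less_top)

lemma integrable_bounded_supported:
  assumes [measurable]: "f \<in> borel_measurable borel" and "\<And>x. x \<notin> S \<Longrightarrow> f x = 0" "\<And>x. \<bar>f x\<bar> \<le> (M::real)"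
  shows "integrable lborel f"
proof (rule Bochner_Integration.integrable_bound[OF integrable_indicator_S[of M]])
  have "norm (f x) \<le> norm (M * indicator S x)" for x
    using assms(2,3)[of x] by (cases "x \<in> S") auto
  then show "AE x in lborel. norm (f x) \<le> norm (M * indicator S x)" by simp
qed simp

lemma integrable_of_square:
  assumes [measurable]: "g \<in> borel_measurable borel" and "\<And>x. x \<notin> S \<Longrightarrow> g x = 0"
    and sq: "integrable lborel (\<lambda>x. (g x)\<^sup>2 :: real)"
  shows "integrable lborel g"
proof (rule Bochner_Integration.integrable_bound)
  show "integrable lborel (\<lambda>x. 1 * indicator S x + (g x)\<^sup>2)"
    by (intro Bochner_Integration.integrable_add integrable_indicator_S sq)
  have "norm (g x) \<le> norm (1 * indicator S x + (g x)\<^sup>2)" for x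
    using assms(2)[of x] abs_le_one_plus_square[of "g x"] by (cases "x \<in> S") auto
  then show "AE x in lborel. norm (g x) \<le> norm (1 * indicator S x + (g x)\<^sup>2)" by simp
qed simp

lemma wd_integrable:
  assumes "wd S h f g" shows "integrable lborel f" "integrable lborel g"
proof -
  obtain M where M: "M > 0" "\<forall>x. \<bar>f x\<bar> \<le> M" using wd_bounded[OF assms] by auto
  show "integrable lborel f"
    by (rule integrable_bounded_supported[OF wdD(1)[OF assms] wdD(3)[OF assms], where M=M]) (use M in auto)
  show "integrable lborel g"
    by (rule integrable_of_square[OF wdD(2)[OF assms] wdD(4)[OF assms] wdD(5)[OF assms]])
qed

text \<open>A compact segment in an open set has a uniform distance to the complement, so nearby
  parallel translates remain inside. This is the set on which increments along \<open>h\<close> are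
  meaningful.\<close>

lemma open_segment_set: "open {x. closed_segment x (x + h) \<subseteq> S}"
proof (subst open_subopen, intro ballI)
  fix x assume "x \<in> {x. closed_segment x (x + h) \<subseteq> S}"
  then obtain e where e: "e > 0" "(\<Union>z\<in>closed_segment x (x + h). ball z e) \<subseteq> S"
    using compact_subset_open_imp_ball_epsilon_subset[OF _ open_S, of "closed_segment x (x + h)"] by auto
  have "ball x e \<subseteq> {x. closed_segment x (x + h) \<subseteq> S}"
  proof (intro subsetI CollectI)
    fix y z assume y: "y \<in> ball x e" and "z \<in> closed_segment y (y + h)"
    then obtain t where t: "0 \<le> t" "t \<le> 1" "z = y + t *\<^sub>R h"
      by (auto simp: in_segment algebra_simps)
    have "x + t *\<^sub>R h \<in> closed_segment x (x + h)"
      using t unfolding in_segment by (intro exI[of _ t]) (auto simp: algebra_simps)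
    moreover have "z \<in> ball (x + t *\<^sub>R h) e" using y t by (simp add: dist_norm algebra_simps)
    ultimately show "z \<in> S" using e by blast
  qed
  then show "\<exists>T. open T \<and> x \<in> T \<and> T \<subseteq> {x. closed_segment x (x + h) \<subseteq> S}"
    using e by (intro exI[of _ "ball x e"]) auto
qed

lemma in_segment_step: "closed_segment x (x + h) \<subseteq> A \<Longrightarrow> 0 \<le> t \<Longrightarrow> t \<le> 1 \<Longrightarrow> x + t *\<^sub>R h \<in> A"
  for x h :: "real^2"
proof -
  assume a: "closed_segment x (x + h) \<subseteq> A" "0 \<le> t" "t \<le> 1"
  have "x + t *\<^sub>R h \<in> closed_segment x (x + h)"
    unfolding in_segment by (intro exI[of _ t]) (use a in \<open>simp add: algebra_simps\<close>)
  then show "x + t *\<^sub>R h \<in> A" using a by blast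
qed

text \<open>The fundamental theorem of calculus for a weak derivative, by duality. Against a bump
  \<open>\<phi>\<close> supported where the whole segment stays in \<open>S\<close>, the increment
  of \<open>f\<close> becomes an increment of \<open>\<phi>\<close>, hence an average of directional
  derivatives of its translates. Each translate is an admissible test function in \<open>S\<close>,
  so the derivative moves over to \<open>g\<close>, and translating back gives the average of
  \<open>g\<close>.\<close>

lemma wd_translate:
  assumes wd: "wd S h f g"
  shows "AE x in lborel. closed_segment x (x + h) \<subseteq> S \<longrightarrow>
     f (x + h) - f x = (\<integral>t. g (x + t *\<^sub>R h) \<partial>unitm)"
proof -
  note [measurable] = wdD(1,2)[OF wd]
  note intf = wd_integrable(1)[OF wd] and intg = wd_integrable(2)[OF wd]
  define V where "V = {x. closed_segment x (x + h) \<subseteq> S}"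
  define u where "u x = f (x + h) - f x - (\<integral>t. g (x + t *\<^sub>R h) \<partial>unitm)" for x
  have pg: "integrable (unitm \<Otimes>\<^sub>M lborel) (\<lambda>(t, x). g (x + t *\<^sub>R h))"
    using integrable_unitm_lborel[OF intg, of "\<lambda>_. 1" 1 h] by simp
  have iG: "integrable lborel (\<lambda>x. \<integral>t. g (x + t *\<^sub>R h) \<partial>unitm)"
    using ulb.integrable_snd[of "\<lambda>t x. g (x + t *\<^sub>R h)"] pg by simp
  have iu: "integrable lborel u"
    unfolding u_def[abs_def] by (intro Bochner_Integration.integrable_diff integrable_shift intf iG)
  have "AE x in lborel. x \<in> V \<longrightarrow> u x = 0"
  proof (rule AE_zero_of_bumps_lborel[OF _ iu])
    show "open V" unfolding V_def by (rule open_segment_set)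
    fix \<phi> assume \<phi>: "\<phi> \<in> bumps V"
    note [measurable] = bumps_measurable[OF \<phi>]
    have [measurable]: "dird h \<phi> \<in> borel_measurable borel"
      by (intro borel_measurable_continuous_onI dird_bumps_continuous_on[OF \<phi>])
    obtain M where M: "M > 0" "\<And>x. \<bar>\<phi> x\<bar> \<le> M" using bumps_bounded[OF \<phi>] by blast
    obtain M' where M': "M' > 0" "\<And>x. \<bar>dird h \<phi> x\<bar> \<le> M'" using dird_bumps_bounded[OF \<phi>] by blast
    have ib: "integrable lborel (\<lambda>x. k x * \<phi> (x - c))" if "integrable lborel k" for k c
      using M by (intro integrable_mult_bounded[OF that, where M=M]) auto
    have ib0: "integrable lborel (\<lambda>x. k x * \<phi> x)" if "integrable lborel k" for k
      using ib[OF that, of 0] by simp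
    have ftc: "\<phi> (x - h) - \<phi> x = - (\<integral>t. dird h \<phi> (x - t *\<^sub>R h) \<partial>unitm)" for x
    proof -
      have "((\<lambda>t. \<phi> (x - t *\<^sub>R h)) has_real_derivative - dird h \<phi> (x - t *\<^sub>R h)) (at t)" for t
      proof -
        have "((\<lambda>t. \<phi> (x + (- t) *\<^sub>R h)) has_real_derivative dird h \<phi> (x + (- t) *\<^sub>R h) * (-1)) (at t)"
          by (rule DERIV_chain2[OF bumps_has_dird[OF \<phi>]]) (auto intro!: derivative_eq_intros)
        then show ?thesis by simp
      qed
      moreover have "continuous_on UNIV (\<lambda>t. - dird h \<phi> (x - t *\<^sub>R h))"
        by (intro continuous_on_minus continuous_on_compose2[OF dird_bumps_continuous_on[OF \<phi>, of UNIV h]]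
            continuous_on_diff continuous_on_scaleR continuous_on_id continuous_on_const) simp
      then have "isCont (\<lambda>t. - dird h \<phi> (x - t *\<^sub>R h)) t" for t
        by (simp only: continuous_on_eq_continuous_at[OF open_UNIV]) simp
      ultimately show ?thesis
        using unitm_FTC[of "\<lambda>t. \<phi> (x - t *\<^sub>R h)" "\<lambda>t. - dird h \<phi> (x - t *\<^sub>R h)"] by simp
    qed
    have weak: "(LBINT x. f x * dird h \<phi> (x - t *\<^sub>R h)) = - (LBINT x. g x * \<phi> (x - t *\<^sub>R h))"
      if "0 \<le> t" "t \<le> 1" for t
    proof -
      have "(\<lambda>x. \<phi> (x - t *\<^sub>R h)) \<in> bumps S"
        by (rule shift_bumps[OF \<phi>]) (use that in_segment_step in \<open>auto simp: V_def\<close>)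
      then have "(LBINT x. f x * dird h (\<lambda>x. \<phi> (x - t *\<^sub>R h)) x) = - (LBINT x. g x * \<phi> (x - t *\<^sub>R h))"
        by (rule wdD(6)[OF wd])
      moreover have "dird h (\<lambda>x. \<phi> (x - t *\<^sub>R h)) = (\<lambda>x. dird h \<phi> (x - t *\<^sub>R h))"
        unfolding dird_def by (rule ext) (simp add: algebra_simps)
      ultimately show ?thesis by simp
    qed
    have "(LBINT x. f (x + h) * \<phi> x - f x * \<phi> x) = (LBINT x. f x * (\<phi> (x - h) - \<phi> x))"
    proof -
      have "(LBINT x. f (x + h) * \<phi> x) = (LBINT x. f x * \<phi> (x - h))"
        using integral_shift[of "\<lambda>x. f x * \<phi> (x - h)" h] by simp
      then show ?thesis
        using ib[OF intf, of h] ib0[OF intf] ib0[OF integrable_shift[OF intf, of h]]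
        by (simp add: right_diff_distrib)
    qed
    also have "\<dots> = - (LBINT x. (\<integral>t. f x * dird h \<phi> (x - t *\<^sub>R h) \<partial>unitm))"
      by (simp add: ftc)
    also have "\<dots> = - (\<integral>t. (LBINT x. f x * dird h \<phi> (x - t *\<^sub>R h)) \<partial>unitm)"
      using integrable_unitm_lborel[OF intf, of "\<lambda>(t, x). dird h \<phi> (x - t *\<^sub>R h)" M' 0] M'
      by (subst ulb.Fubini_integral) (auto simp: case_prod_beta)
    also have "\<dots> = (\<integral>t. (LBINT x. g x * \<phi> (x - t *\<^sub>R h)) \<partial>unitm)"
      by (subst integral_minus[symmetric], rule integral_cong_AE) (use AE_unitm in \<open>auto simp: weak\<close>)
    also have "\<dots> = (\<integral>t. (LBINT x. g (x + t *\<^sub>R h) * \<phi> x) \<partial>unitm)"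
    proof (rule Bochner_Integration.integral_cong[OF refl])
      fix t show "(LBINT x. g x * \<phi> (x - t *\<^sub>R h)) = (LBINT x. g (x + t *\<^sub>R h) * \<phi> x)"
        using integral_shift[of "\<lambda>x. g x * \<phi> (x - t *\<^sub>R h)" "t *\<^sub>R h"] by simp
    qed
    also have "\<dots> = (LBINT x. (\<integral>t. g (x + t *\<^sub>R h) * \<phi> x \<partial>unitm))"
      using integrable_unitm_lborel[OF intg, of "\<lambda>(t, x). \<phi> x" M h] M
      by (subst ulb.Fubini_integral) (auto simp: case_prod_beta)
    finally have "(LBINT x. f (x + h) * \<phi> x - f x * \<phi> x) = (LBINT x. (\<integral>t. g (x + t *\<^sub>R h) \<partial>unitm) * \<phi> x)"
      by simp
    moreover have "(LBINT x. u x * \<phi> x) = (LBINT x. f (x + h) * \<phi> x - f x * \<phi> x)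
        - (LBINT x. (\<integral>t. g (x + t *\<^sub>R h) \<partial>unitm) * \<phi> x)"
      using ib0[OF intf] ib0[OF integrable_shift[OF intf, of h]] ib0[OF iG]
      by (simp add: u_def left_diff_distrib)
    ultimately show "(LBINT x. u x * \<phi> x) = 0" by simp
  qed
  then show ?thesis by eventually_elim (auto simp: V_def u_def)
qed

text \<open>Jensen's inequality, read off from the nonnegativity of the variance; if
  \<open>k\<close> is not square integrable, the right-hand side is infinite.\<close>

lemma square_integral_unitm_le:
  fixes k :: "real \<Rightarrow> real"
  assumes [measurable]: "k \<in> borel_measurable borel"
  shows "ennreal ((\<integral>t. k t \<partial>unitm)\<^sup>2) \<le> (\<integral>\<^sup>+t. ennreal ((k t)\<^sup>2) \<partial>unitm)"
proof (cases "integrable unitm (\<lambda>t. (k t)\<^sup>2)")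
  case True
  have ik: "integrable unitm k"
  proof (rule Bochner_Integration.integrable_bound)
    show "integrable unitm (\<lambda>t. 1 + (k t)\<^sup>2)" using True by simp
    show "AE x in unitm. norm (k x) \<le> norm (1 + (k x)\<^sup>2)"
      using abs_le_one_plus_square[of "k _"] by (intro AE_I2) auto
  qed simp
  define c where "c = (\<integral>t. k t \<partial>unitm)"
  have "0 \<le> (\<integral>t. (k t - c)\<^sup>2 \<partial>unitm)" by simp
  also have "\<dots> = (\<integral>t. (k t)\<^sup>2 - 2 * c * k t + c\<^sup>2 \<partial>unitm)"
    by (simp add: power2_diff algebra_simps)
  also have "\<dots> = (\<integral>t. (k t)\<^sup>2 \<partial>unitm) - 2 * c * c + c\<^sup>2"
    using True ik by (simp add: c_def[symmetric] measure_unitm_UNIV)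
  finally have "c\<^sup>2 \<le> (\<integral>t. (k t)\<^sup>2 \<partial>unitm)" by (simp add: power2_eq_square)
  then show ?thesis using True by (simp add: nn_integral_eq_integral c_def)
next
  case False
  then have "(\<integral>\<^sup>+t. ennreal ((k t)\<^sup>2) \<partial>unitm) = \<infinity>"
    by (simp add: integrable_iff_bounded not_less top_unique)
  then show ?thesis by simp
qed

lemma wd_translate_square:
  assumes wd: "wd S h f g"
  shows "AE x in lborel. closed_segment x (x + h) \<subseteq> S \<longrightarrow>
     ennreal ((f (x + h) - f x)\<^sup>2) \<le> (\<integral>\<^sup>+t. ennreal ((g (x + t *\<^sub>R h))\<^sup>2) \<partial>unitm)"
  using wd_translate[OF wd]
proof eventually_elim
  case (elim x)
  note [measurable] = wdD(1,2)[OF wd]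
  show ?case using elim square_integral_unitm_le[of "\<lambda>t. g (x + t *\<^sub>R h)"] by simp
qed

end

section \<open>The algebra of bounded functions with square integrable weak derivatives\<close>

lemma wdI:
  assumes "f \<in> borel_measurable borel" "g \<in> borel_measurable borel"
    "\<And>x. x \<notin> S \<Longrightarrow> f x = 0" "\<And>x. x \<notin> S \<Longrightarrow> g x = 0" "\<And>x. \<bar>f x\<bar> \<le> M"
    "integrable lborel (\<lambda>x. (g x)\<^sup>2)"
    "\<And>\<phi>. \<phi> \<in> bumps S \<Longrightarrow> (LBINT x. f x * dird h \<phi> x) = - (LBINT x. g x * \<phi> x)"
  shows "wd S h f g"
  using assms unfolding wd_def by auto

lemma integrable_square_add:
  fixes f g :: "'a::euclidean_space \<Rightarrow> real"
  assumes "integrable lborel (\<lambda>x. (f x)\<^sup>2)" "integrable lborel (\<lambda>x. (g x)\<^sup>2)"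
    and [measurable]: "f \<in> borel_measurable borel" "g \<in> borel_measurable borel"
  shows "integrable lborel (\<lambda>x. (f x + g x)\<^sup>2)"
proof (rule Bochner_Integration.integrable_bound)
  show "integrable lborel (\<lambda>x. 2 * (f x)\<^sup>2 + 2 * (g x)\<^sup>2)" using assms by simp
  have "(a + b)\<^sup>2 \<le> 2 * a\<^sup>2 + 2 * b\<^sup>2" for a b :: real
    using sum_squares_bound[of a b] by (simp add: power2_sum)
  then show "AE x in lborel. norm ((f x + g x)\<^sup>2) \<le> norm (2 * (f x)\<^sup>2 + 2 * (g x)\<^sup>2)"
    by simp
qed simp

lemma dird_bumps_measurable: "\<phi> \<in> bumps S \<Longrightarrow> dird h \<phi> \<in> borel_measurable borel"
  by (intro borel_measurable_continuous_onI dird_bumps_continuous_on)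

context bounded_open
begin

lemma integrable_mult_bump:
  assumes k: "integrable lborel k" and \<phi>: "\<phi> \<in> bumps S'"
  shows "integrable lborel (\<lambda>x. k x * \<phi> x)" "integrable lborel (\<lambda>x. k x * dird h \<phi> x)"
proof -
  obtain M where "\<forall>x. \<bar>\<phi> x\<bar> \<le> M" using bumps_bounded[OF \<phi>] by auto
  then show "integrable lborel (\<lambda>x. k x * \<phi> x)"
    by (intro integrable_mult_bounded[OF k bumps_measurable[OF \<phi>], where M=M]) auto
  obtain M where "\<forall>x. \<bar>dird h \<phi> x\<bar> \<le> M" using dird_bumps_bounded[OF \<phi>] by auto
  then show "integrable lborel (\<lambda>x. k x * dird h \<phi> x)"
    by (intro integrable_mult_bounded[OF k dird_bumps_measurable[OF \<phi>], where M=M]) auto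
qed

lemma wd_add:
  assumes 1: "wd S h f g" and 2: "wd S h f' g'"
  shows "wd S h (\<lambda>x. f x + f' x) (\<lambda>x. g x + g' x)"
proof -
  note [measurable] = wdD(1,2)[OF 1] wdD(1,2)[OF 2]
  obtain M where M: "\<forall>x. \<bar>f x\<bar> \<le> M" using wd_bounded[OF 1] by auto
  obtain M' where M': "\<forall>x. \<bar>f' x\<bar> \<le> M'" using wd_bounded[OF 2] by auto
  show ?thesis
  proof (rule wdI)
    show "\<bar>f x + f' x\<bar> \<le> M + M'" for x
      using spec[OF M, of x] spec[OF M', of x] by linarith
    show "integrable lborel (\<lambda>x. (g x + g' x)\<^sup>2)"
      by (rule integrable_square_add[OF wdD(5)[OF 1] wdD(5)[OF 2]]) measurable
    fix \<phi> assume \<phi>: "\<phi> \<in> bumps S"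
    show "(LBINT x. (f x + f' x) * dird h \<phi> x) = - (LBINT x. (g x + g' x) * \<phi> x)"
      using wdD(6)[OF 1 \<phi>] wdD(6)[OF 2 \<phi>] integrable_mult_bump[OF _ \<phi>] wd_integrable[OF 1] wd_integrable[OF 2]
      by (simp add: distrib_right)
  qed (use wdD(3,4)[OF 1] wdD(3,4)[OF 2] in auto)
qed

lemma wd_cmult:
  assumes 1: "wd S h f g"
  shows "wd S h (\<lambda>x. c * f x) (\<lambda>x. c * g x)"
proof -
  note [measurable] = wdD(1,2)[OF 1]
  obtain M where M: "\<forall>x. \<bar>f x\<bar> \<le> M" using wd_bounded[OF 1] by auto
  show ?thesis
  proof (rule wdI)
    show "\<bar>c * f x\<bar> \<le> \<bar>c\<bar> * M" for x using M by (simp add: abs_mult mult_left_mono)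
    show "integrable lborel (\<lambda>x. (c * g x)\<^sup>2)"
      using wdD(5)[OF 1] by (simp add: power_mult_distrib)
    fix \<phi> assume \<phi>: "\<phi> \<in> bumps S"
    show "(LBINT x. (c * f x) * dird h \<phi> x) = - (LBINT x. (c * g x) * \<phi> x)"
      using wdD(6)[OF 1 \<phi>] by (simp add: mult.assoc)
  qed (use wdD(3,4)[OF 1] in auto)
qed

lemma wd_diff:
  "wd S h f g \<Longrightarrow> wd S h f' g' \<Longrightarrow> wd S h (\<lambda>x. f x - f' x) (\<lambda>x. g x - g' x)"
  using wd_add[OF _ wd_cmult[of _ _ _ "-1"], of h f g f' g'] by simp

lemma wd_zero: "wd S h (\<lambda>_. 0) (\<lambda>_. 0)"
  by (rule wdI[where M=0]) auto

lemma wd_sum: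
  assumes "\<And>i. i \<in> I \<Longrightarrow> wd S h (f i) (g i)"
  shows "wd S h (\<lambda>x. \<Sum>i\<in>I. f i x) (\<lambda>x. \<Sum>i\<in>I. g i x)"
  using assms by (induction I rule: infinite_finite_induct) (auto intro: wd_zero wd_add)

lemma wd_direction:
  assumes 1: "wd S h f g" and 2: "wd S k f g'"
  shows "wd S (a *\<^sub>R h + b *\<^sub>R k) f (\<lambda>x. a * g x + b * g' x)"
proof -
  note [measurable] = wdD(1,2)[OF 1] wdD(1,2)[OF 2]
  obtain M where M: "\<forall>x. \<bar>f x\<bar> \<le> M" using wd_bounded[OF 1] by auto
  show ?thesis
  proof (rule wdI)
    show "\<bar>f x\<bar> \<le> M" for x using M by simp
    show "integrable lborel (\<lambda>x. (a * g x + b * g' x)\<^sup>2)"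
      by (rule integrable_square_add) (use wdD(5)[OF 1] wdD(5)[OF 2] in \<open>auto simp: power_mult_distrib\<close>)
    fix \<phi> assume \<phi>: "\<phi> \<in> bumps S"
    have "(LBINT x. f x * dird (a *\<^sub>R h + b *\<^sub>R k) \<phi> x) =
       (LBINT x. a * (f x * dird h \<phi> x) + b * (f x * dird k \<phi> x))"
      unfolding dird_bumps_eq[OF \<phi>] by (simp add: algebra_simps)
    also have "\<dots> = a * (LBINT x. f x * dird h \<phi> x) + b * (LBINT x. f x * dird k \<phi> x)"
      using integrable_mult_bump[OF _ \<phi>] wd_integrable[OF 1] by simp
    also have "\<dots> = - (LBINT x. (a * g x + b * g' x) * \<phi> x)"
      using wdD(6)[OF 1 \<phi>] wdD(6)[OF 2 \<phi>] integrable_mult_bump[OF _ \<phi>] wd_integrable[OF 1] wd_integrable[OF 2]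
      by (simp add: distrib_right mult.assoc)
    finally show "(LBINT x. f x * dird (a *\<^sub>R h + b *\<^sub>R k) \<phi> x) = - (LBINT x. (a * g x + b * g' x) * \<phi> x)" .
  qed (use wdD(3,4)[OF 1] wdD(3,4)[OF 2] in auto)
qed

lemma wd_scale_direction: "wd S h f g \<Longrightarrow> wd S (a *\<^sub>R h) f (\<lambda>x. a * g x)"
  using wd_direction[of h f g h g a 0] by simp

text \<open>This is how pointwise identities between frames are differentiated: each side has a weak
  derivative computed by the product rule, and the two must agree. Since both derivatives vanish
  outside \<open>S\<close>, the conclusion holds on the whole plane.\<close>

lemma wd_unique:
  assumes 1: "wd S h f g" and 2: "wd S h f' g'" and eq: "AE x in lborel. x \<in> S \<longrightarrow> f x = f' x"
  shows "AE x in lborel. g x = g' x"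
proof -
  note m[measurable] = wdD(1,2)[OF 1] wdD(1,2)[OF 2]
  have "AE x in lborel. f x = f' x"
    using eq by eventually_elim (use wdD(3)[OF 1] wdD(3)[OF 2] in metis)
  have "AE x in lborel. x \<in> S \<longrightarrow> g x - g' x = 0"
  proof (rule AE_zero_of_bumps_lborel[OF open_S])
    show "integrable lborel (\<lambda>x. g x - g' x)" using wd_integrable[OF 1] wd_integrable[OF 2] by simp
    fix \<phi> assume \<phi>: "\<phi> \<in> bumps S"
    note [measurable] = dird_bumps_measurable[OF \<phi>]
    have "(LBINT x. f x * dird h \<phi> x) = (LBINT x. f' x * dird h \<phi> x)"
      using \<open>AE x in lborel. f x = f' x\<close> by (intro integral_cong_AE) auto
    then show "(LBINT x. (g x - g' x) * \<phi> x) = 0"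
      using wdD(6)[OF 1 \<phi>] wdD(6)[OF 2 \<phi>] integrable_mult_bump[OF _ \<phi>] wd_integrable[OF 1] wd_integrable[OF 2]
      by (simp add: left_diff_distrib)
  qed
  then show ?thesis by eventually_elim (use wdD(4)[OF 1] wdD(4)[OF 2] in force)
qed

text \<open>Jensen on each segment, then Fubini, then translation invariance for every fixed
  parameter: averaging along the segment costs nothing, and the step length contributes
  \<open>s\<^sup>2\<close>.\<close>

lemma diff_square_le:
  assumes wd: "wd S h f g" and K[measurable]: "K \<in> sets borel"
    and seg: "\<And>x. x \<in> K \<Longrightarrow> closed_segment x (x + s *\<^sub>R h) \<subseteq> S"
  shows "integrable lborel (\<lambda>x. indicator K x * (f (x + s *\<^sub>R h) - f x)\<^sup>2)"
    and "(LBINT x. indicator K x * (f (x + s *\<^sub>R h) - f x)\<^sup>2) \<le> s\<^sup>2 * (LBINT x. (g x)\<^sup>2)"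
proof -
  note m[measurable] = wdD(1,2)[OF wd]
  let ?u = "\<lambda>x. indicator K x * (f (x + s *\<^sub>R h) - f x)\<^sup>2"
  have i2: "integrable lborel (\<lambda>x. (g x)\<^sup>2)" by (rule wdD(5)[OF wd])
  have "AE x in lborel. closed_segment x (x + s *\<^sub>R h) \<subseteq> S \<longrightarrow>
     ennreal ((f (x + s *\<^sub>R h) - f x)\<^sup>2) \<le> (\<integral>\<^sup>+t. ennreal ((s * g (x + t *\<^sub>R (s *\<^sub>R h)))\<^sup>2) \<partial>unitm)"
    by (rule wd_translate_square[OF wd_scale_direction[OF wd]])
  then have "AE x in lborel. ennreal (?u x) \<le> (\<integral>\<^sup>+t. ennreal ((s * g (x + t *\<^sub>R (s *\<^sub>R h)))\<^sup>2) \<partial>unitm)"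
    by eventually_elim (use seg in \<open>auto simp: indicator_def\<close>)
  then have "(\<integral>\<^sup>+x. ennreal (?u x) \<partial>lborel) \<le> (\<integral>\<^sup>+x. (\<integral>\<^sup>+t. ennreal ((s * g (x + t *\<^sub>R (s *\<^sub>R h)))\<^sup>2) \<partial>unitm) \<partial>lborel)"
    by (rule nn_integral_mono_AE)
  also have "\<dots> = (\<integral>\<^sup>+t. (\<integral>\<^sup>+x. ennreal ((s * g (x + t *\<^sub>R (s *\<^sub>R h)))\<^sup>2) \<partial>lborel) \<partial>unitm)"
    by (rule ulb.Fubini'[of "\<lambda>t x. ennreal ((s * g (x + t *\<^sub>R (s *\<^sub>R h)))\<^sup>2)"]) measurable
  also have "\<dots> = (\<integral>\<^sup>+t. (\<integral>\<^sup>+x. ennreal ((s * g x)\<^sup>2) \<partial>lborel) \<partial>unitm)"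
    using nn_integral_shift[of "\<lambda>x. ennreal ((s * g x)\<^sup>2)"] by simp
  also have "\<dots> = (\<integral>\<^sup>+x. ennreal ((s * g x)\<^sup>2) \<partial>lborel)"
    using emeasure_unitm_UNIV by simp
  also have "\<dots> = ennreal (s\<^sup>2 * (LBINT x. (g x)\<^sup>2))"
    using i2 by (subst nn_integral_eq_integral) (auto simp: power_mult_distrib)
  finally have le: "(\<integral>\<^sup>+x. ennreal (?u x) \<partial>lborel) \<le> ennreal (s\<^sup>2 * (LBINT x. (g x)\<^sup>2))" .
  show iu: "integrable lborel ?u"
  proof (rule integrableI_bounded)
    have "(\<integral>\<^sup>+ x. ennreal (norm (?u x)) \<partial>lborel) = (\<integral>\<^sup>+ x. ennreal (?u x) \<partial>lborel)" by simp
    also have "\<dots> < \<infinity>" using le by (rule order.strict_trans1) simp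
    finally show "(\<integral>\<^sup>+ x. ennreal (norm (?u x)) \<partial>lborel) < \<infinity>" .
  qed simp
  show "(LBINT x. ?u x) \<le> s\<^sup>2 * (LBINT x. (g x)\<^sup>2)"
    using le iu by (subst (asm) nn_integral_eq_integral) auto
qed

text \<open>The difference quotient of \<open>f^2\<close> differs from the average of \<open>2 f g\<close> over the segment by
  terms that are quadratic in increments of \<open>f\<close>, and these are bounded in mean square by the step length.\<close>

lemma wd_square:
  assumes wd: "wd S h f g"
  shows "wd S h (\<lambda>x. (f x)\<^sup>2) (\<lambda>x. 2 * f x * g x)"
proof -
  note m[measurable] = wdD(1,2)[OF wd]
  obtain B where B: "B > 0" "\<forall>x. \<bar>f x\<bar> \<le> B" using wd_bounded[OF wd] by auto
  note ig = wd_integrable(2)[OF wd] and if' = wd_integrable(1)[OF wd]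
  have if2: "integrable lborel (\<lambda>x. (f x)\<^sup>2)"
    unfolding power2_eq_square by (rule integrable_mult_bounded[OF if', of f B]) (use B in auto)
  have ifg: "integrable lborel (\<lambda>x. g x * f x)"
    by (rule integrable_mult_bounded[OF ig, of f B]) (use B in auto)
  define N where "N = (LBINT x. (g x)\<^sup>2)"
  have N0: "N \<ge> 0" unfolding N_def by simp
  show ?thesis
  proof (rule wdI)
    show "\<bar>(f x)\<^sup>2\<bar> \<le> B\<^sup>2" for x using B power_mono[of "\<bar>f x\<bar>" B 2] by simp
    have "integrable lborel (\<lambda>x. (g x)\<^sup>2 * (4 * (f x)\<^sup>2))"
    proof (rule integrable_mult_bounded[OF wdD(5)[OF wd], where M="4 * B\<^sup>2"])
      show "\<bar>4 * (f x)\<^sup>2\<bar> \<le> 4 * B\<^sup>2" for x using B power_mono[of "\<bar>f x\<bar>" B 2] by simp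
    qed measurable
    then show "integrable lborel (\<lambda>x. (2 * f x * g x)\<^sup>2)" by (simp add: power_mult_distrib mult.commute)
    fix \<phi> assume \<phi>: "\<phi> \<in> bumps S"
    note [measurable] = bumps_measurable[OF \<phi>] dird_bumps_measurable[OF \<phi>]
    obtain a b where ab: "cbox a b \<subseteq> S" "\<And>x. x \<notin> cbox a b \<Longrightarrow> \<phi> x = 0"
      using \<phi> by (rule bumpsE) blast
    obtain M where M: "M > 0" "\<forall>x. \<bar>\<phi> x\<bar> \<le> M" using bumps_bounded[OF \<phi>] by auto
    obtain M' where M': "M' > 0" "\<forall>x. \<bar>dird h \<phi> x\<bar> \<le> M'" using dird_bumps_bounded[OF \<phi>] by auto
    obtain e where e: "e > 0" "(\<Union>x\<in>cbox a b. ball x e) \<subseteq> S"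
      using compact_subset_open_imp_ball_epsilon_subset[OF compact_cbox open_S ab(1)] by auto
    define t where "t n = inverse (real (Suc n))" for n
    have t0: "t n > 0" for n by (simp add: t_def)
    have tlim: "t \<longlonglongrightarrow> 0" unfolding t_def[abs_def] by (rule LIMSEQ_inverse_real_of_nat)
    have ev: "\<forall>\<^sub>F n in sequentially. t n * norm h < e"
      by (rule order_tendstoD(2)[of _ "0 * norm h"]) (use tlim e in \<open>auto intro!: tendsto_mult_left_zero\<close>)
    \<comment> \<open>The difference quotient of \<open>f\<^sup>2\<close>, tested with
      \<open>\<phi>\<close> and transferred to \<open>\<phi>\<close> by translation. It tends to the
      left-hand side of the weak formulation, up to sign.\<close>
    define A where "A n = (LBINT x. (f x)\<^sup>2 * ((\<phi> (x - t n *\<^sub>R h) - \<phi> x) / t n))" for n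
    \<comment> \<open>The integral of f g \<open>\<phi>\<close> with \<open>f\<close> and
      \<open>g\<close> both evaluated at the intermediate point x + \<open>\<theta>\<close> t h,
      after translation. Only the smooth factor still depends on n, so the limit is
      immediate.\<close>
    define D where "D n \<theta> = (LBINT x. (g x * f x) * \<phi> (x - (\<theta> * t n) *\<^sub>R h))" for n \<theta>
    have deriv: "((\<lambda>s. \<phi> (x - s *\<^sub>R h)) has_real_derivative - dird h \<phi> (x - s *\<^sub>R h)) (at s)" for x s
    proof -
      have "((\<lambda>s. \<phi> (x + (- s) *\<^sub>R h)) has_real_derivative dird h \<phi> (x + (- s) *\<^sub>R h) * (-1)) (at s)"
        by (rule DERIV_chain2[OF bumps_has_dird[OF \<phi>]]) (auto intro!: derivative_eq_intros)
      then show ?thesis by simp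
    qed
    have limA: "A \<longlonglongrightarrow> (LBINT x. (f x)\<^sup>2 * (- dird h \<phi> x))"
      unfolding A_def
    proof (rule integral_dominated_convergence[where w="\<lambda>x. M' * (f x)\<^sup>2"])
      show "integrable lborel (\<lambda>x. M' * (f x)\<^sup>2)" using if2 by simp
      have "(\<lambda>n. (\<phi> (x - t n *\<^sub>R h) - \<phi> x) / t n) \<longlonglongrightarrow> - dird h \<phi> x" for x
      proof -
        have "((\<lambda>s. (\<phi> (x - (0 + s) *\<^sub>R h) - \<phi> (x - 0 *\<^sub>R h)) / s) \<longlongrightarrow> - dird h \<phi> (x - 0 *\<^sub>R h)) (at 0)"
          using deriv[of x 0] unfolding DERIV_def .
        then have "((\<lambda>n. (\<phi> (x - (0 + t n) *\<^sub>R h) - \<phi> (x - 0 *\<^sub>R h)) / t n) \<longlonglongrightarrow> - dird h \<phi> (x - 0 *\<^sub>R h))"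
          by (rule filterlim_compose)
            (use tlim t0 in \<open>auto simp: filterlim_at less_imp_neq[THEN not_sym]\<close>)
        then show ?thesis by simp
      qed
      then show "AE x in lborel. (\<lambda>n. (f x)\<^sup>2 * ((\<phi> (x - t n *\<^sub>R h) - \<phi> x) / t n)) \<longlonglongrightarrow> (f x)\<^sup>2 * (- dird h \<phi> x)"
        by (intro AE_I2 tendsto_mult tendsto_const)
      have "\<bar>(\<phi> (x - t n *\<^sub>R h) - \<phi> x) / t n\<bar> \<le> M'" for x n
      proof -
        obtain z where "\<phi> (x - t n *\<^sub>R h) - \<phi> (x - 0 *\<^sub>R h) = (t n - 0) * - dird h \<phi> (x - z *\<^sub>R h)"
          using MVT2[OF t0[of n], of "\<lambda>s. \<phi> (x - s *\<^sub>R h)" "\<lambda>s. - dird h \<phi> (x - s *\<^sub>R h)"] deriv by blast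
        then have "(\<phi> (x - t n *\<^sub>R h) - \<phi> x) / t n = - dird h \<phi> (x - z *\<^sub>R h)"
          using t0[of n] by (simp add: field_simps)
        then show ?thesis using M' by simp
      qed
      then show "AE x in lborel. norm ((f x)\<^sup>2 * ((\<phi> (x - t n *\<^sub>R h) - \<phi> x) / t n)) \<le> M' * (f x)\<^sup>2" for n
        unfolding real_norm_def abs_mult[of "(f _)\<^sup>2"]
        by (intro AE_I2) (simp add: mult.commute[of M'] mult_left_mono del: abs_divide)
    qed measurable
    have limD1: "(\<lambda>n. D n \<theta>) \<longlonglongrightarrow> (LBINT x. (g x * f x) * \<phi> x)" for \<theta>
      unfolding D_def
    proof (rule integral_dominated_convergence[where w="\<lambda>x. M * \<bar>g x * f x\<bar>"])
      show "integrable lborel (\<lambda>x. M * \<bar>g x * f x\<bar>)" using ifg by simp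
      have "isCont \<phi> x" for x
        using bumps_continuous_on[OF \<phi>, of UNIV] by (simp add: continuous_on_eq_continuous_at)
      moreover have "(\<lambda>n. x - (\<theta> * t n) *\<^sub>R h) \<longlonglongrightarrow> x - (\<theta> * 0) *\<^sub>R h" for x
        by (intro tendsto_intros tlim)
      ultimately have "(\<lambda>n. \<phi> (x - (\<theta> * t n) *\<^sub>R h)) \<longlonglongrightarrow> \<phi> x" for x
        using isCont_tendsto_compose[of x \<phi> "\<lambda>n. x - (\<theta> * t n) *\<^sub>R h"] by simp
      then show "AE x in lborel. (\<lambda>n. g x * f x * \<phi> (x - (\<theta> * t n) *\<^sub>R h)) \<longlonglongrightarrow> g x * f x * \<phi> x"
        by (intro AE_I2 tendsto_mult tendsto_const)
      show "AE x in lborel. norm (g x * f x * \<phi> (x - (\<theta> * t n) *\<^sub>R h)) \<le> M * \<bar>g x * f x\<bar>" for n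
        using M by (intro AE_I2) (simp add: abs_mult mult_left_mono mult.commute[of M])
    qed measurable
    have Dm: "D n \<in> borel_measurable unitm" for n unfolding D_def by measurable
    have Dbd: "\<bar>D n \<theta>\<bar> \<le> M * (LBINT x. \<bar>g x * f x\<bar>)" for n \<theta>
    proof -
      have "\<bar>D n \<theta>\<bar> \<le> (LBINT x. \<bar>(g x * f x) * \<phi> (x - (\<theta> * t n) *\<^sub>R h)\<bar>)"
        unfolding D_def by (rule integral_abs_bound)
      also have "\<dots> \<le> (LBINT x. M * \<bar>g x * f x\<bar>)"
      proof (rule integral_mono)
        show "integrable lborel (\<lambda>x. \<bar>(g x * f x) * \<phi> (x - (\<theta> * t n) *\<^sub>R h)\<bar>)"
          by (intro integrable_abs integrable_mult_bounded[OF ifg, where M=M]) (use M in auto)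
        show "integrable lborel (\<lambda>x. M * \<bar>g x * f x\<bar>)" using ifg by simp
        show "\<bar>(g x * f x) * \<phi> (x - (\<theta> * t n) *\<^sub>R h)\<bar> \<le> M * \<bar>g x * f x\<bar>" for x
          using M by (simp add: abs_mult mult_left_mono mult.commute[of M])
      qed
      finally show ?thesis by simp
    qed
    have limD: "(\<lambda>n. \<integral>\<theta>. D n \<theta> \<partial>unitm) \<longlonglongrightarrow> (\<integral>\<theta>. (LBINT x. (g x * f x) * \<phi> x) \<partial>unitm)"
    proof (rule integral_dominated_convergence[where w="\<lambda>_. M * (LBINT x. \<bar>g x * f x\<bar>)"])
      show "AE x in unitm. (\<lambda>n. D n x) \<longlonglongrightarrow> (LBINT x. (g x * f x) * \<phi> x)"
        by (intro AE_I2 limD1)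
      show "AE x in unitm. norm (D n x) \<le> M * (LBINT x. \<bar>g x * f x\<bar>)" for n
        using Dbd by (intro AE_I2) simp
    qed (use Dm in auto)
    \<comment> \<open>Two replacements separate \<open>A n\<close> from twice the average of
      \<open>D n\<close>: dropping the square of the increment, and moving \<open>f\<close> from x
      to the intermediate point. Each has an error of order \<open>t n\<close>.\<close>
    have est: "\<forall>\<^sub>F n in sequentially. \<bar>A n - 2 * (\<integral>\<theta>. D n \<theta> \<partial>unitm)\<bar> \<le> 3 * M * N * t n"
      using ev
    proof eventually_elim
      case (elim n)
      define s where "s = t n"
      let ?f = "\<lambda>\<theta> x. f (x + \<theta> *\<^sub>R (s *\<^sub>R h))" and ?g = "\<lambda>\<theta> x. g (x + \<theta> *\<^sub>R (s *\<^sub>R h))"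
      have s0: "s > 0" using t0 s_def by simp
      have seg: "closed_segment x (x + (\<theta> * s) *\<^sub>R h) \<subseteq> S" if x: "x \<in> cbox a b" and \<theta>: "0 \<le> \<theta>" "\<theta> \<le> 1" for x \<theta>
      proof -
        have "norm ((\<theta> * s) *\<^sub>R h) \<le> s * norm h" using \<theta> s0 by (simp add: abs_mult mult_left_le_one_le mult_right_mono)
        then have "x \<in> ball x e" "x + (\<theta> * s) *\<^sub>R h \<in> ball x e" using elim e s_def by (auto simp: dist_norm)
        then have "closed_segment x (x + (\<theta> * s) *\<^sub>R h) \<subseteq> ball x e"
          by (intro closed_segment_subset convex_ball)
        then show ?thesis using e x by blast
      qed
      have segs: "closed_segment x (x + s *\<^sub>R h) \<subseteq> S" if "x \<in> cbox a b" for x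
        using seg[OF that, of 1] by simp
      define G where "G x = (\<integral>\<theta>. g (x + (\<theta> * s) *\<^sub>R h) \<partial>unitm)" for x
      define \<Delta> where "\<Delta> \<theta> x = indicator (cbox a b) x * (f (x + (\<theta> * s) *\<^sub>R h) - f x)\<^sup>2" for \<theta> x
      have \<Delta>: "integrable lborel (\<Delta> \<theta>)" "(LBINT x. \<Delta> \<theta> x) \<le> s\<^sup>2 * N" if \<theta>: "0 \<le> \<theta>" "\<theta> \<le> 1" for \<theta>
      proof -
        show "integrable lborel (\<Delta> \<theta>)"
          unfolding \<Delta>_def by (rule diff_square_le(1)[OF wd]) (use seg \<theta> in auto)
        have "(LBINT x. \<Delta> \<theta> x) \<le> (\<theta> * s)\<^sup>2 * N"
          unfolding \<Delta>_def N_def by (rule diff_square_le(2)[OF wd]) (use seg \<theta> in auto)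
        also have "\<dots> \<le> s\<^sup>2 * N"
          using N0 \<theta> s0 by (intro mult_right_mono power_mono) (auto simp: mult_left_le_one_le)
        finally show "(LBINT x. \<Delta> \<theta> x) \<le> s\<^sup>2 * N" .
      qed
      have sh: "integrable lborel (\<lambda>x. (f (x + s *\<^sub>R h))\<^sup>2)"
        using integrable_shift[OF if2, of "s *\<^sub>R h"] .
      have iGpair: "integrable (unitm \<Otimes>\<^sub>M lborel) (\<lambda>(\<theta>, x). ?g \<theta> x * (f x * \<phi> x))"
      proof -
        have "\<bar>f x * \<phi> x\<bar> \<le> B * M" for x
          unfolding abs_mult using B M by (intro mult_mono) auto
        then show ?thesis
          using integrable_unitm_lborel[OF ig, of "\<lambda>p. f (snd p) * \<phi> (snd p)" "B * M" "s *\<^sub>R h"] by simp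
      qed
      have ipair: "integrable (unitm \<Otimes>\<^sub>M lborel) (\<lambda>(\<theta>, x). ?g \<theta> x * (?f \<theta> x * \<phi> x))"
      proof -
        have "\<bar>f z * \<phi> x\<bar> \<le> B * M" for x z
          unfolding abs_mult using B M by (intro mult_mono) auto
        then show ?thesis
          using integrable_unitm_lborel[OF ig, of "\<lambda>p. f (snd p + fst p *\<^sub>R (s *\<^sub>R h)) * \<phi> (snd p)" "B * M" "s *\<^sub>R h"] by simp
      qed
      have "A n = (1 / s) * (LBINT x. (f x)\<^sup>2 * \<phi> (x - s *\<^sub>R h) - (f x)\<^sup>2 * \<phi> x)"
        unfolding A_def s_def[symmetric]
        by (subst integral_mult_right_zero[symmetric]) (auto intro!: Bochner_Integration.integral_cong simp: field_simps)
      also have "(LBINT x. (f x)\<^sup>2 * \<phi> (x - s *\<^sub>R h) - (f x)\<^sup>2 * \<phi> x)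
          = (LBINT x. (f x)\<^sup>2 * \<phi> (x - s *\<^sub>R h)) - (LBINT x. (f x)\<^sup>2 * \<phi> x)"
        by (intro Bochner_Integration.integral_diff integrable_mult_bounded[OF if2, where M=M]) (use M in auto)
      also have "(LBINT x. (f x)\<^sup>2 * \<phi> (x - s *\<^sub>R h)) = (LBINT x. (f (x + s *\<^sub>R h))\<^sup>2 * \<phi> x)"
        using integral_shift[of "\<lambda>x. (f x)\<^sup>2 * \<phi> (x - s *\<^sub>R h)" "s *\<^sub>R h"] by simp
      also have "(LBINT x. (f (x + s *\<^sub>R h))\<^sup>2 * \<phi> x) - (LBINT x. (f x)\<^sup>2 * \<phi> x)
          = (LBINT x. ((f (x + s *\<^sub>R h))\<^sup>2 - (f x)\<^sup>2) * \<phi> x)"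
        using integrable_mult_bump(1)[OF sh \<phi>] integrable_mult_bump(1)[OF if2 \<phi>]
        by (simp add: left_diff_distrib)
      also have "\<dots> = (LBINT x. 2 * s * (G x * (f x * \<phi> x)) + \<Delta> 1 x * \<phi> x)"
      proof (rule integral_cong_AE)
        have "AE x in lborel. closed_segment x (x + s *\<^sub>R h) \<subseteq> S \<longrightarrow>
            f (x + s *\<^sub>R h) - f x = (\<integral>\<theta>. s * ?g \<theta> x \<partial>unitm)"
          by (rule wd_translate[OF wd_scale_direction[OF wd]])
        then show "AE x in lborel. ((f (x + s *\<^sub>R h))\<^sup>2 - (f x)\<^sup>2) * \<phi> x
            = 2 * s * (G x * (f x * \<phi> x)) + \<Delta> 1 x * \<phi> x"
        proof eventually_elim
          case (elim x)
          show ?case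
          proof (cases "x \<in> cbox a b")
            case True
            \<comment> \<open>Hence f(x + s h)^2 - f(x)^2 = 2 s G f + (s G)^2, and the last term is
              the squared increment \<open>\<Delta> 1\<close>.\<close>
            then have sG: "f (x + s *\<^sub>R h) = f x + s * G x" using elim segs by (simp add: G_def)
            show ?thesis using True unfolding \<Delta>_def by (simp add: sG power2_eq_square algebra_simps)
          next
            case False
            then show ?thesis using ab by simp
          qed
        qed
        show "(\<lambda>x. 2 * s * (G x * (f x * \<phi> x)) + \<Delta> 1 x * \<phi> x) \<in> borel_measurable lborel"
          unfolding G_def \<Delta>_def by measurable
      qed measurable
      also have "\<dots> = 2 * s * (LBINT x. G x * (f x * \<phi> x)) + (LBINT x. \<Delta> 1 x * \<phi> x)"
      proof -
        have "integrable lborel (\<lambda>x. G x * (f x * \<phi> x))"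
          using ulb.integrable_snd[OF iGpair] unfolding G_def by simp
        moreover have "integrable lborel (\<lambda>x. \<Delta> 1 x * \<phi> x)"
          using integrable_mult_bump(1)[OF \<Delta>(1)[of 1] \<phi>] by simp
        ultimately show ?thesis by simp
      qed
      also have "(LBINT x. G x * (f x * \<phi> x)) = (LBINT x. (\<integral>\<theta>. ?g \<theta> x * (f x * \<phi> x) \<partial>unitm))"
        unfolding G_def by simp
      also have "\<dots> = (\<integral>\<theta>. (LBINT x. ?g \<theta> x * (f x * \<phi> x)) \<partial>unitm)"
        by (rule ulb.Fubini_integral[OF iGpair])
      finally have A_eq: "A n = 2 * (\<integral>\<theta>. (LBINT x. ?g \<theta> x * (f x * \<phi> x)) \<partial>unitm)
          + (1 / s) * (LBINT x. \<Delta> 1 x * \<phi> x)" (is "_ = 2 * (\<integral>\<theta>. ?E \<theta> \<partial>unitm) + _")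
        using s0 by (simp add: field_simps)
      have D_eq: "D n \<theta> = (LBINT x. ?g \<theta> x * (?f \<theta> x * \<phi> x))" for \<theta>
        unfolding D_def s_def[symmetric]
        using integral_shift[of "\<lambda>x. g x * f x * \<phi> (x - (\<theta> * s) *\<^sub>R h)" "(\<theta> * s) *\<^sub>R h"] by (simp add: mult.assoc)
      have iE: "integrable unitm ?E" using ulb.integrable_fst[OF iGpair] by simp
      have iD: "integrable unitm (D n)" unfolding D_eq[abs_def] using ulb.integrable_fst[OF ipair] by simp
      let ?w = "\<lambda>\<theta> x. ?g \<theta> x * (f x * \<phi> x) - ?g \<theta> x * (?f \<theta> x * \<phi> x)"
      have ED: "\<bar>?E \<theta> - D n \<theta>\<bar> \<le> M * N * s" if \<theta>: "0 \<le> \<theta>" "\<theta> \<le> 1" for \<theta>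
      proof -
        have i1: "integrable lborel (\<lambda>x. ?g \<theta> x * (f x * \<phi> x))"
        proof -
          have "\<bar>f x * \<phi> x\<bar> \<le> B * M" for x
            unfolding abs_mult using B M by (intro mult_mono) auto
          then show ?thesis by (intro integrable_mult_bounded[OF integrable_shift[OF ig], where M="B * M"]) auto
        qed
        have i2: "integrable lborel (\<lambda>x. ?g \<theta> x * (?f \<theta> x * \<phi> x))"
        proof -
          have "\<bar>f z * \<phi> x\<bar> \<le> B * M" for x z
            unfolding abs_mult using B M by (intro mult_mono) auto
          then show ?thesis by (intro integrable_mult_bounded[OF integrable_shift[OF ig], where M="B * M"]) auto
        qed
        have ig2: "integrable lborel (\<lambda>x. (?g \<theta> x)\<^sup>2)"
          by (rule integrable_shift[OF wdD(5)[OF wd]])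
        have "\<bar>?E \<theta> - D n \<theta>\<bar> = \<bar>\<integral>x. ?w \<theta> x \<partial>lborel\<bar>"
          unfolding D_eq using i1 i2 by simp
        also have "\<dots> \<le> (LBINT x. \<bar>?w \<theta> x\<bar>)"
          by (rule integral_abs_bound)
        also have "\<dots> \<le> (LBINT x. M / 2 * (s * (?g \<theta> x)\<^sup>2 + \<Delta> \<theta> x / s))"
        proof (rule integral_mono)
          show "integrable lborel (\<lambda>x. \<bar>?w \<theta> x\<bar>)"
            by (intro integrable_abs Bochner_Integration.integrable_diff i1 i2)
          show "integrable lborel (\<lambda>x. M / 2 * (s * (?g \<theta> x)\<^sup>2 + \<Delta> \<theta> x / s))"
            by (intro integrable_mult_right Bochner_Integration.integrable_add integrable_divide ig2 \<Delta>(1)[OF \<theta>])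
          fix x
          define p q where "p = ?g \<theta> x" and "q = f x - ?f \<theta> x"
          have "\<bar>?w \<theta> x\<bar> = \<bar>p * q\<bar> * \<bar>\<phi> x\<bar>"
            unfolding p_def q_def abs_mult[symmetric] by (simp add: algebra_simps)
          also have "\<dots> \<le> M / 2 * (s * p\<^sup>2 + \<Delta> \<theta> x / s)"
          proof (cases "x \<in> cbox a b")
            case True
            then have "\<Delta> \<theta> x = q\<^sup>2" unfolding \<Delta>_def q_def by (simp add: power2_commute)
            \<comment> \<open>The weight s balances the two terms: \<open>q\<^sup>2\<close> has
              integral at most \<open>s\<^sup>2 * N\<close>, so after division by s both summands
              contribute order s.\<close>
            moreover have "2 * \<bar>p * q\<bar> \<le> s * p\<^sup>2 + q\<^sup>2 / s"
            proof -
              have "0 \<le> (s * \<bar>p\<bar> - \<bar>q\<bar>)\<^sup>2 / s" using s0 by simp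
              also have "\<dots> = s * p\<^sup>2 + q\<^sup>2 / s - 2 * \<bar>p * q\<bar>"
                using s0 by (simp add: power2_diff power_mult_distrib abs_mult field_simps) (simp add: power2_eq_square)
              finally show ?thesis by simp
            qed
            moreover have "\<bar>p * q\<bar> * \<bar>\<phi> x\<bar> \<le> \<bar>p * q\<bar> * M" using M by (intro mult_left_mono) auto
            moreover have "r * w \<le> M / 2 * R" if "2 * r \<le> R" "r * w \<le> r * M" for r R w
            proof -
              have "M * (2 * r) \<le> M * R" using that(1) M by (intro mult_left_mono) auto
              then show ?thesis using that(2) by (simp only: mult.commute[of M] times_divide_eq_left)
            qed
            ultimately show ?thesis by simp
          next
            case False
            then show ?thesis using ab M s0 unfolding \<Delta>_def by simp
          qed
          finally show "\<bar>?w \<theta> x\<bar>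
              \<le> M / 2 * (s * (?g \<theta> x)\<^sup>2 + \<Delta> \<theta> x / s)" unfolding p_def .
        qed
        also have "\<dots> = M / 2 * (s * N + (LBINT x. \<Delta> \<theta> x) / s)"
          using ig2 \<Delta>(1)[OF \<theta>] integral_shift[of "\<lambda>x. (g x)\<^sup>2" "\<theta> *\<^sub>R (s *\<^sub>R h)"] by (simp add: N_def)
        also have "\<dots> \<le> M / 2 * (s * N + s\<^sup>2 * N / s)"
          using \<Delta>(2)[OF \<theta>] M s0 by (intro mult_left_mono add_left_mono divide_right_mono) auto
        also have "\<dots> = M * N * s" using s0 by (simp add: power2_eq_square)
        finally show ?thesis .
      qed
      have "\<bar>(\<integral>\<theta>. ?E \<theta> \<partial>unitm) - (\<integral>\<theta>. D n \<theta> \<partial>unitm)\<bar> = \<bar>\<integral>\<theta>. ?E \<theta> - D n \<theta> \<partial>unitm\<bar>"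
        using iE iD by simp
      also have "\<dots> \<le> (\<integral>\<theta>. \<bar>?E \<theta> - D n \<theta>\<bar> \<partial>unitm)" by (rule integral_abs_bound)
      also have "\<dots> \<le> (\<integral>\<theta>. M * N * s \<partial>unitm)"
      proof (rule integral_mono_AE)
        show "AE \<theta> in unitm. \<bar>?E \<theta> - D n \<theta>\<bar> \<le> M * N * s"
          using AE_unitm by eventually_elim (use ED in blast)
      qed (use iE iD in auto)
      also have "\<dots> = M * N * s" by (simp add: measure_unitm_UNIV)
      finally have 1: "\<bar>(\<integral>\<theta>. ?E \<theta> \<partial>unitm) - (\<integral>\<theta>. D n \<theta> \<partial>unitm)\<bar> \<le> M * N * s" .
      have "\<bar>\<integral>x. \<Delta> 1 x * \<phi> x \<partial>lborel\<bar> \<le> (LBINT x. \<bar>\<Delta> 1 x * \<phi> x\<bar>)" by (rule integral_abs_bound)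
      also have "\<dots> \<le> (LBINT x. M * \<Delta> 1 x)"
      proof (rule integral_mono)
        show "integrable lborel (\<lambda>x. \<bar>\<Delta> 1 x * \<phi> x\<bar>)"
          using integrable_mult_bump(1)[OF \<Delta>(1)[of 1] \<phi>] by simp
        show "integrable lborel (\<lambda>x. M * \<Delta> 1 x)" using \<Delta>(1)[of 1] by simp
        show "\<bar>\<Delta> 1 x * \<phi> x\<bar> \<le> M * \<Delta> 1 x" for x
        proof -
          have "0 \<le> \<Delta> 1 x" unfolding \<Delta>_def by simp
          then show ?thesis using M by (simp add: abs_mult mult.commute[of M] mult_left_mono)
        qed
      qed
      also have "\<dots> \<le> M * (s\<^sup>2 * N)" using \<Delta>(2)[of 1] M by simp
      finally have "(1 / s) * \<bar>\<integral>x. \<Delta> 1 x * \<phi> x \<partial>lborel\<bar> \<le> (1 / s) * (M * (s\<^sup>2 * N))"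
        using s0 by (intro mult_left_mono) auto
      then have 2: "\<bar>(1 / s) * (LBINT x. \<Delta> 1 x * \<phi> x)\<bar> \<le> M * N * s"
        using s0 by (simp add: abs_mult power2_eq_square algebra_simps)
      \<comment> \<open>The factor 3 is 2 + 1: the shift of \<open>f\<close> enters
        \<open>A n\<close> twice and the squared increment once.\<close>
      have "\<bar>2 * p + q - 2 * r\<bar> \<le> 3 * M * N * s" if "\<bar>p - r\<bar> \<le> M * N * s" "\<bar>q\<bar> \<le> M * N * s" for p q r
      proof -
        have "3 * M * N * s = 3 * (M * N * s)" by simp
        then show ?thesis using that by linarith
      qed
      from this[OF 1 2] show ?case unfolding A_eq s_def[symmetric] .
    qed
    have "(\<lambda>n. A n - 2 * (\<integral>\<theta>. D n \<theta> \<partial>unitm)) \<longlonglongrightarrow> 0"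
    proof (rule Lim_null_comparison)
      show "\<forall>\<^sub>F n in sequentially. norm (A n - 2 * (\<integral>\<theta>. D n \<theta> \<partial>unitm)) \<le> 3 * M * N * t n"
        using est by simp
      show "(\<lambda>n. 3 * M * N * t n) \<longlonglongrightarrow> 0" using tlim by (rule tendsto_mult_right_zero)
    qed
    moreover have "(\<lambda>n. A n - 2 * (\<integral>\<theta>. D n \<theta> \<partial>unitm)) \<longlonglongrightarrow>
        (LBINT x. (f x)\<^sup>2 * (- dird h \<phi> x)) - 2 * (\<integral>\<theta>. (LBINT x. (g x * f x) * \<phi> x) \<partial>unitm)"
      by (intro tendsto_intros limA limD)
    ultimately have "(LBINT x. (f x)\<^sup>2 * (- dird h \<phi> x)) - 2 * (\<integral>\<theta>. (LBINT x. (g x * f x) * \<phi> x) \<partial>unitm) = 0"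
      using LIMSEQ_unique by blast
    then have "(LBINT x. (f x)\<^sup>2 * dird h \<phi> x) = - (2 * (LBINT x. (g x * f x) * \<phi> x))"
      by (simp add: measure_unitm_UNIV)
    also have "2 * (LBINT x. (g x * f x) * \<phi> x) = (LBINT x. 2 * f x * g x * \<phi> x)"
      by (subst integral_mult_right_zero[symmetric]) (simp add: mult_ac)
    finally show "(LBINT x. (f x)\<^sup>2 * dird h \<phi> x) = - (LBINT x. 2 * f x * g x * \<phi> x)" .
  qed (use wdD(3,4)[OF wd] in auto)
qed

text \<open>Polarisation: a product is a quarter of the difference of the squares of sum and
  difference, so the rule for squares suffices.\<close>

lemma wd_mult:
  assumes 1: "wd S h f g" and 2: "wd S h f' g'"
  shows "wd S h (\<lambda>x. f x * f' x) (\<lambda>x. g x * f' x + f x * g' x)"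
proof -
  have "wd S h (\<lambda>x. (1/4) * ((f x + f' x)\<^sup>2 - (f x - f' x)\<^sup>2))
     (\<lambda>x. (1/4) * (2 * (f x + f' x) * (g x + g' x) - 2 * (f x - f' x) * (g x - g' x)))"
    by (intro wd_cmult wd_diff[of h "\<lambda>x. (f x + f' x)\<^sup>2"] wd_square wd_add[OF 1 2] wd_diff[OF 1 2])
  moreover have "(\<lambda>x. (1/4) * ((f x + f' x)\<^sup>2 - (f x - f' x)\<^sup>2)) = (\<lambda>x. f x * f' x)"
    by (rule ext) (simp add: power2_eq_square algebra_simps)
  moreover have "(\<lambda>x. (1/4) * (2 * (f x + f' x) * (g x + g' x) - 2 * (f x - f' x) * (g x - g' x)))
      = (\<lambda>x. g x * f' x + f x * g' x)"
    by (rule ext) (simp add: field_simps)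
  ultimately show ?thesis by (simp only:)
qed

text \<open>The product u = f \<open>\<phi>\<close>, extended by zero, is differentiable along
  \<open>h\<close> on the whole plane with continuous derivative \<open>v\<close>. The integral of
  u(x + h) - u(x) is zero by translation invariance, and by the fundamental theorem and Fubini it
  equals the integral of \<open>v\<close>; this is integration by parts.\<close>

lemma wd_C1:
  assumes cf: "continuous_on S f" and cg: "continuous_on S g"
    and bf: "\<And>x. x \<in> S \<Longrightarrow> \<bar>f x\<bar> \<le> M" and bg: "\<And>x. x \<in> S \<Longrightarrow> \<bar>g x\<bar> \<le> M'"
    and d: "\<And>x. x \<in> S \<Longrightarrow> ((\<lambda>t. f (x + t *\<^sub>R h)) has_real_derivative g x) (at 0)"
  shows "wd S h (\<lambda>x. indicator S x * f x) (\<lambda>x. indicator S x * g x)"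
proof -
  have mf[measurable]: "(\<lambda>x. indicator S x * f x) \<in> borel_measurable borel"
    using borel_measurable_continuous_on_indicator[OF _ cf] by simp
  have mg[measurable]: "(\<lambda>x. indicator S x * g x) \<in> borel_measurable borel"
    using borel_measurable_continuous_on_indicator[OF _ cg] by simp
  show ?thesis
  proof (rule wdI)
    show "\<bar>indicator S x * f x\<bar> \<le> max M 0" for x
      using bf[of x] by (cases "x \<in> S") auto
    show "integrable lborel (\<lambda>x. (indicator S x * g x)\<^sup>2)"
    proof (rule integrable_bounded_supported)
      show "\<bar>(indicator S x * g x)\<^sup>2\<bar> \<le> M'\<^sup>2" for x
        using power_mono[OF bg[of x], of 2] by (cases "x \<in> S") auto
    qed auto
    fix \<phi> assume \<phi>: "\<phi> \<in> bumps S"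
    note [measurable] = bumps_measurable[OF \<phi>] dird_bumps_measurable[OF \<phi>]
    obtain a b where ab: "cbox a b \<subseteq> S" "\<And>x. x \<notin> cbox a b \<Longrightarrow> \<phi> x = 0"
      using \<phi> by (rule bumpsE) blast
    have ab': "dird h \<phi> x = 0" if "x \<notin> cbox a b" for x
    proof -
      have op: "open (- cbox a b)" by (simp add: closed_cbox open_Compl)
      have "((\<lambda>y. x + y *\<^sub>R h) \<longlongrightarrow> x + 0 *\<^sub>R h) (nhds 0)"
        by (intro tendsto_intros filterlim_ident)
      then have "eventually (\<lambda>t. x + t *\<^sub>R h \<in> - cbox a b) (nhds 0)"
        by (rule topological_tendstoD[OF _ op]) (use that in simp)
      then have "eventually (\<lambda>t. \<phi> (x + t *\<^sub>R h) = 0) (nhds 0)"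
        by eventually_elim (use ab in simp)
      then have "((\<lambda>t. \<phi> (x + t *\<^sub>R h)) has_real_derivative 0) (at 0)"
        by (subst DERIV_cong_ev[OF refl _ refl]) auto
      then show ?thesis unfolding dird_def by (rule DERIV_imp_deriv)
    qed
    define u where "u x = indicator S x * f x * \<phi> x" for x
    define v where "v x = indicator S x * g x * \<phi> x + indicator S x * f x * dird h \<phi> x" for x
    have uv0: "u x = 0" "v x = 0" if "x \<notin> cbox a b" for x using that ab ab' by (auto simp: u_def v_def)
    have du: "((\<lambda>t. u (x + t *\<^sub>R h)) has_real_derivative v x) (at 0)" for x
    proof (cases "x \<in> S")
      case True
      have lim: "((\<lambda>y. x + y *\<^sub>R h) \<longlongrightarrow> x + 0 *\<^sub>R h) (nhds 0)"
        by (intro tendsto_intros filterlim_ident)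
      then have ev: "eventually (\<lambda>t. x + t *\<^sub>R h \<in> S) (nhds 0)"
        by (rule topological_tendstoD[OF _ open_S]) (use True in simp)
      have "((\<lambda>t. f (x + t *\<^sub>R h) * \<phi> (x + t *\<^sub>R h)) has_real_derivative
          g x * \<phi> (x + 0 *\<^sub>R h) + dird h \<phi> (x + 0 *\<^sub>R h) * f (x + 0 *\<^sub>R h)) (at 0)"
        by (rule DERIV_mult[OF d[OF True] bumps_has_dird[OF \<phi>, of x h 0]])
      then have "((\<lambda>t. f (x + t *\<^sub>R h) * \<phi> (x + t *\<^sub>R h)) has_real_derivative v x) (at 0)"
        using True by (simp add: v_def algebra_simps)
      then show ?thesis
        by (rule DERIV_cong_ev[OF refl _ refl, THEN iffD2, rotated])
          (use ev in eventually_elim, simp add: u_def)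
    next
      case False
      then have x: "x \<in> - cbox a b" using ab by blast
      have lim: "((\<lambda>y. x + y *\<^sub>R h) \<longlongrightarrow> x + 0 *\<^sub>R h) (nhds 0)"
        by (intro tendsto_intros filterlim_ident)
      then have ev: "eventually (\<lambda>t. x + t *\<^sub>R h \<in> - cbox a b) (nhds 0)"
        by (rule topological_tendstoD) (use x in \<open>auto simp: closed_cbox open_Compl\<close>)
      then have ev: "eventually (\<lambda>t. u (x + t *\<^sub>R h) = 0) (nhds 0)"
        by eventually_elim (simp add: uv0)
      have "((\<lambda>_. 0) has_real_derivative v x) (at 0)" using x by (simp add: uv0)
      then show ?thesis
        by (rule DERIV_cong_ev[OF refl _ refl, THEN iffD2, rotated]) (use ev in simp)
    qed
    have du': "((\<lambda>t. u (x + t *\<^sub>R h)) has_real_derivative v (x + s *\<^sub>R h)) (at s)" for x s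
      using DERIV_shift[of "\<lambda>t. u (x + t *\<^sub>R h)" "v (x + s *\<^sub>R h)" 0 s] du[of "x + s *\<^sub>R h"]
      by (simp add: algebra_simps)
    \<comment> \<open>Continuity is glued from two open sets that cover the plane: \<open>S\<close>,
      where \<open>f\<close> and \<open>g\<close> are continuous, and the complement of the
      supporting box, where \<open>v\<close> is zero.\<close>
    have cv: "continuous_on UNIV v"
    proof -
      have "continuous_on S v"
        by (rule continuous_on_eq[where f="\<lambda>x. g x * \<phi> x + f x * dird h \<phi> x"])
          (auto simp: v_def intro!: continuous_intros cf cg bumps_continuous_on[OF \<phi>] dird_bumps_continuous_on[OF \<phi>])
      moreover have "continuous_on (- cbox a b) v"
        by (rule continuous_on_eq[where f="\<lambda>x. 0"]) (auto simp: uv0)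
      ultimately have "continuous_on (S \<union> - cbox a b) v"
        by (intro continuous_on_open_Un open_S) (auto simp: closed_cbox open_Compl)
      moreover have "S \<union> - cbox a b = UNIV" using ab by blast
      ultimately show ?thesis by simp
    qed
    have i1: "integrable lborel (\<lambda>x. indicator S x * g x)"
    proof (rule integrable_bounded_supported[OF mg])
      show "\<bar>indicator S x * g x\<bar> \<le> max M' 0" for x
        using bg[of x] by (cases "x \<in> S") auto
    qed simp
    have i2: "integrable lborel (\<lambda>x. indicator S x * f x)"
    proof (rule integrable_bounded_supported[OF mf])
      show "\<bar>indicator S x * f x\<bar> \<le> max M 0" for x
        using bf[of x] by (cases "x \<in> S") auto
    qed simp
    have iu: "integrable lborel u" unfolding u_def[abs_def] by (rule integrable_mult_bump[OF i2 \<phi>])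
    have iv: "integrable lborel v" unfolding v_def[abs_def]
      by (intro Bochner_Integration.integrable_add integrable_mult_bump[OF i2 \<phi>] integrable_mult_bump[OF i1 \<phi>])
    have [measurable]: "u \<in> borel_measurable borel" "v \<in> borel_measurable borel" using iu iv by auto
    have ftc: "u (x + h) - u x = (\<integral>t. v (x + t *\<^sub>R h) \<partial>unitm)" for x
    proof -
      have "continuous_on UNIV (\<lambda>t. v (x + t *\<^sub>R h))"
        by (intro continuous_on_compose2[OF cv] continuous_on_add continuous_on_scaleR continuous_on_id continuous_on_const) simp
      then have "isCont (\<lambda>t. v (x + t *\<^sub>R h)) t" for t
        by (simp only: continuous_on_eq_continuous_at[OF open_UNIV]) simp
      then show ?thesis using unitm_FTC[of "\<lambda>t. u (x + t *\<^sub>R h)" "\<lambda>t. v (x + t *\<^sub>R h)"] du' by simp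
    qed
    have "0 = (LBINT x. u (x + h)) - (LBINT x. u x)" using integral_shift[of u h] by simp
    also have "\<dots> = (LBINT x. u (x + h) - u x)"
      using iu integrable_shift[OF iu, of h] by simp
    also have "\<dots> = (LBINT x. (\<integral>t. v (x + t *\<^sub>R h) \<partial>unitm))" by (simp add: ftc)
    also have "\<dots> = (\<integral>t. (LBINT x. v (x + t *\<^sub>R h)) \<partial>unitm)"
      by (rule ulb.Fubini_integral) (use integrable_unitm_lborel[OF iv, of "\<lambda>_. 1" 1 h] in simp)
    also have "\<dots> = (LBINT x. v x)"
      by (simp add: integral_shift measure_unitm_UNIV)
    also have "\<dots> = (LBINT x. indicator S x * g x * \<phi> x) + (LBINT x. indicator S x * f x * dird h \<phi> x)"
      unfolding v_def by (intro Bochner_Integration.integral_add integrable_mult_bump[OF i2 \<phi>] integrable_mult_bump[OF i1 \<phi>])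
    finally show "(LBINT x. indicator S x * f x * dird h \<phi> x) = - (LBINT x. indicator S x * g x * \<phi> x)"
      by simp
  qed auto
qed

end

section \<open>The Poincare inequality\<close>

text \<open>In the plane a dilation by \<open>c\<close> has Jacobian \<open>c\<^sup>2\<close>, which
  is at least 1/4 here.\<close>

lemma nn_integral_affine_le:
  fixes k :: "real^2 \<Rightarrow> ennreal"
  assumes [measurable]: "k \<in> borel_measurable borel" and c: "\<bar>c\<bar> \<ge> 1/2"
  shows "(\<integral>\<^sup>+x. k (b + c *\<^sub>R x) \<partial>lborel) \<le> 4 * (\<integral>\<^sup>+x. k x \<partial>lborel)"
proof -
  have c0: "c \<noteq> 0" using c by auto
  have "(\<integral>\<^sup>+x. k x \<partial>lborel) = ennreal (\<bar>c\<bar> ^ 2) * (\<integral>\<^sup>+x. k (b + c *\<^sub>R x) \<partial>lborel)"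
    by (subst lborel_affine[OF c0, of b])
      (simp add: nn_integral_density nn_integral_distr nn_integral_cmult)
  then have "4 * (\<integral>\<^sup>+x. k x \<partial>lborel) = (ennreal 4 * ennreal (\<bar>c\<bar> ^ 2)) * (\<integral>\<^sup>+x. k (b + c *\<^sub>R x) \<partial>lborel)"
    by (simp add: mult.assoc)
  also have "ennreal 4 * ennreal (\<bar>c\<bar> ^ 2) = ennreal (4 * \<bar>c\<bar> ^ 2)" by (simp add: ennreal_mult')
  also have "1 * (\<integral>\<^sup>+x. k (b + c *\<^sub>R x) \<partial>lborel) \<le> ennreal (4 * \<bar>c\<bar> ^ 2) * (\<integral>\<^sup>+x. k (b + c *\<^sub>R x) \<partial>lborel)"
  proof (rule mult_right_mono)
    have "(1/2)^2 \<le> \<bar>c\<bar>^2" using c by (intro power_mono) auto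
    then have "1 \<le> 4 * \<bar>c\<bar>^2" by (simp add: power2_eq_square)
    then show "1 \<le> ennreal (4 * \<bar>c\<bar> ^ 2)" by simp
  qed simp
  finally show ?thesis by simp
qed

lemma ennreal_cancel_pos:
  assumes "ennreal b * X \<le> ennreal K * Y" "b > 0" "K \<ge> 0"
  shows "X \<le> ennreal (K / b) * Y"
proof -
  have "X = ennreal (1 / b) * (ennreal b * X)"
    using assms by (simp add: mult.assoc[symmetric] ennreal_mult[symmetric])
  also have "\<dots> \<le> ennreal (1 / b) * (ennreal K * Y)" using assms(1) by (rule mult_left_mono) simp
  also have "\<dots> = ennreal (K / b) * Y"
    using assms by (simp add: mult.assoc[symmetric] ennreal_mult[symmetric])
  finally show ?thesis .
qed

text \<open>Oscillation measured between two sets instead of against a mean value: it is monotone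
  and subadditive in the sets and satisfies a triangle inequality, so local estimates can be
  combined.\<close>

definition spread :: "(real^2) set \<Rightarrow> (real^2) set \<Rightarrow> (real^2 \<Rightarrow> real) \<Rightarrow> ennreal" where
  "spread A B f = (\<integral>\<^sup>+x. (\<integral>\<^sup>+z. indicator A x * indicator B z * ennreal ((f x - f z)\<^sup>2) \<partial>lborel) \<partial>lborel)"

definition dirichlet :: "(real^2 \<Rightarrow> real) \<Rightarrow> (real^2 \<Rightarrow> real) \<Rightarrow> ennreal" where
  "dirichlet g1 g2 = (\<integral>\<^sup>+x. ennreal ((g1 x)\<^sup>2 + (g2 x)\<^sup>2) \<partial>lborel)"

lemma spread_mono: "A' \<subseteq> A \<Longrightarrow> B' \<subseteq> B \<Longrightarrow> spread A' B' f \<le> spread A B f"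
  unfolding spread_def by (intro nn_integral_mono mult_right_mono mult_mono) (auto simp: indicator_def)

lemma spread_sym:
  assumes [measurable]: "A \<in> sets borel" "B \<in> sets borel" "f \<in> borel_measurable borel"
  shows "spread B A f = spread A B f"
proof -
  have "spread B A f = (\<integral>\<^sup>+z. (\<integral>\<^sup>+x. indicator B x * indicator A z * ennreal ((f x - f z)\<^sup>2) \<partial>lborel) \<partial>lborel)"
    unfolding spread_def by (rule lborel_pair.Fubini'[symmetric]) measurable
  also have "\<dots> = spread A B f"
    unfolding spread_def by (intro nn_integral_cong) (simp add: mult_ac power2_commute)
  finally show ?thesis .
qed

lemma spread_union:
  assumes [measurable]: "A \<in> sets borel" "A' \<in> sets borel" "B \<in> sets borel" "f \<in> borel_measurable borel"
  shows "spread (A \<union> A') B f \<le> spread A B f + spread A' B f"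
proof -
  let ?u = "\<lambda>A x z. indicator A x * indicator B z * ennreal ((f x - f z)\<^sup>2)"
  have "spread (A \<union> A') B f \<le> (\<integral>\<^sup>+x. (\<integral>\<^sup>+z. ?u A x z + ?u A' x z \<partial>lborel) \<partial>lborel)"
    unfolding spread_def by (intro nn_integral_mono) (auto simp: indicator_def)
  also have "\<dots> = spread A B f + spread A' B f"
    unfolding spread_def by (simp add: nn_integral_add)
  finally show ?thesis .
qed

text \<open>Insert f(w) with w in \<open>B\<close>, use (p + q)^2 \<le> 2 p^2 + 2 q^2, and integrate
  over all three points. The variable absent from a term contributes the measure of its set, which
  explains \<open>b\<close> on the left and \<open>d\<close> and \<open>a\<close> on the
  right.\<close>

lemma spread_trans:
  assumes [measurable]: "A \<in> sets borel" "B \<in> sets borel" "D \<in> sets borel" "f \<in> borel_measurable borel"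
    and nn: "a \<ge> 0" "d \<ge> 0"
    and e: "emeasure lborel A = ennreal a" "emeasure lborel B = ennreal b" "emeasure lborel D = ennreal d"
  shows "ennreal b * spread A D f \<le> ennreal (2 * d) * spread A B f + ennreal (2 * a) * spread B D f"
  unfolding spread_def
proof -
  let ?u = "\<lambda>A B x z. indicator A x * indicator B z * ennreal ((f x - f z)\<^sup>2)"
  have "ennreal b * (\<integral>\<^sup>+x. (\<integral>\<^sup>+z. ?u A D x z \<partial>lborel) \<partial>lborel)
     = (\<integral>\<^sup>+w. indicator B w \<partial>lborel) * (\<integral>\<^sup>+x. (\<integral>\<^sup>+z. ?u A D x z \<partial>lborel) \<partial>lborel)"
    by (simp add: e)
  also have "\<dots> = (\<integral>\<^sup>+w. (\<integral>\<^sup>+x. (\<integral>\<^sup>+z. indicator B w * (?u A D x z) \<partial>lborel) \<partial>lborel) \<partial>lborel)"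
    by (simp add: nn_integral_cmult nn_integral_multc)
  also have "\<dots> \<le> (\<integral>\<^sup>+w. (\<integral>\<^sup>+x. (\<integral>\<^sup>+z. indicator D z * (2 * (?u A B x w))
        + indicator A x * (2 * (?u B D w z)) \<partial>lborel) \<partial>lborel) \<partial>lborel)"
  proof (intro nn_integral_mono)
    fix w x z
    have "(f x - f z)\<^sup>2 \<le> 2 * (f x - f w)\<^sup>2 + 2 * (f w - f z)\<^sup>2"
      using sum_squares_bound[of "f x - f w" "f w - f z"] by (simp add: power2_eq_square algebra_simps)
    then have "ennreal ((f x - f z)\<^sup>2) \<le> ennreal (2 * (f x - f w)\<^sup>2 + 2 * (f w - f z)\<^sup>2)" by (rule ennreal_leI)
    also have "\<dots> = 2 * ennreal ((f x - f w)\<^sup>2) + 2 * ennreal ((f w - f z)\<^sup>2)"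
      by (simp add: ennreal_mult')
    finally show "indicator B w * (?u A D x z)
       \<le> indicator D z * (2 * (?u A B x w))
        + indicator A x * (2 * (?u B D w z))"
      by (auto simp: indicator_def)
  qed
  also have "\<dots> = (\<integral>\<^sup>+w. (\<integral>\<^sup>+x. (\<integral>\<^sup>+z. indicator D z * (2 * (?u A B x w)) \<partial>lborel) \<partial>lborel) \<partial>lborel)
      + (\<integral>\<^sup>+w. (\<integral>\<^sup>+x. (\<integral>\<^sup>+z. indicator A x * (2 * (?u B D w z)) \<partial>lborel) \<partial>lborel) \<partial>lborel)"
    by (simp add: nn_integral_add)
  also have "(\<integral>\<^sup>+w. (\<integral>\<^sup>+x. (\<integral>\<^sup>+z. indicator D z * (2 * (?u A B x w)) \<partial>lborel) \<partial>lborel) \<partial>lborel)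
      = ennreal (2 * d) * (\<integral>\<^sup>+w. (\<integral>\<^sup>+x. ?u A B x w \<partial>lborel) \<partial>lborel)"
  proof -
    have "(\<integral>\<^sup>+w. (\<integral>\<^sup>+x. (\<integral>\<^sup>+z. indicator D z * (2 * (?u A B x w)) \<partial>lborel) \<partial>lborel) \<partial>lborel)
      = (\<integral>\<^sup>+w. (\<integral>\<^sup>+x. ennreal (2 * d) * (?u A B x w) \<partial>lborel) \<partial>lborel)"
    proof (intro nn_integral_cong)
      fix w x
      have "(\<integral>\<^sup>+z. indicator D z * (2 * (?u A B x w)) \<partial>lborel)
          = ennreal d * (2 * (?u A B x w))"
        by (subst nn_integral_multc) (auto simp: e)
      also have "\<dots> = ennreal (2 * d) * (?u A B x w)"
        using nn by (simp add: ennreal_mult' mult_ac)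
      finally show "(\<integral>\<^sup>+z. indicator D z * (2 * (?u A B x w)) \<partial>lborel)
          = ennreal (2 * d) * (?u A B x w)" .
    qed
    then show ?thesis by (simp add: nn_integral_cmult)
  qed
  also have "(\<integral>\<^sup>+w. (\<integral>\<^sup>+x. ?u A B x w \<partial>lborel) \<partial>lborel)
      = (\<integral>\<^sup>+x. (\<integral>\<^sup>+w. ?u A B x w \<partial>lborel) \<partial>lborel)"
    by (rule lborel_pair.Fubini') measurable
  also have "(\<integral>\<^sup>+w. (\<integral>\<^sup>+x. (\<integral>\<^sup>+z. indicator A x * (2 * (?u B D w z)) \<partial>lborel) \<partial>lborel) \<partial>lborel)
      = ennreal (2 * a) * (\<integral>\<^sup>+w. (\<integral>\<^sup>+z. ?u B D w z \<partial>lborel) \<partial>lborel)"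
  proof -
    have "(\<integral>\<^sup>+x. (\<integral>\<^sup>+z. indicator A x * (2 * (?u B D w z)) \<partial>lborel) \<partial>lborel)
        = ennreal (2 * a) * (\<integral>\<^sup>+z. ?u B D w z \<partial>lborel)" for w
    proof -
      have "(\<integral>\<^sup>+z. indicator A x * (2 * (?u B D w z)) \<partial>lborel)
          = indicator A x * (2 * (\<integral>\<^sup>+z. ?u B D w z \<partial>lborel))" for x
        by (subst nn_integral_cmult, measurable, subst nn_integral_cmult, measurable)
      then have "(\<integral>\<^sup>+x. (\<integral>\<^sup>+z. indicator A x * (2 * (?u B D w z)) \<partial>lborel) \<partial>lborel)
          = ennreal a * (2 * (\<integral>\<^sup>+z. ?u B D w z \<partial>lborel))"
        by (simp only:) (subst nn_integral_multc, auto simp: e)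
      then show ?thesis using nn by (simp add: ennreal_mult' mult_ac)
    qed
    then show ?thesis by (simp only:) (rule nn_integral_cmult, measurable)
  qed
  finally show "ennreal b * (\<integral>\<^sup>+x. (\<integral>\<^sup>+z. ?u A D x z \<partial>lborel) \<partial>lborel)
     \<le> ennreal (2 * d) * (\<integral>\<^sup>+x. (\<integral>\<^sup>+z. ?u A B x z \<partial>lborel) \<partial>lborel)
      + ennreal (2 * a) * (\<integral>\<^sup>+x. (\<integral>\<^sup>+z. ?u B D x z \<partial>lborel) \<partial>lborel)" .
qed

context bounded_open
begin

text \<open>A Poincare inequality between \<open>A\<close> and \<open>B\<close> whose constant is
  fixed before the function. The energy is always that of the whole of \<open>S\<close>, so chaining
  links requires no record of where the connecting segments run.\<close>

definition linked :: "(real^2) set \<Rightarrow> (real^2) set \<Rightarrow> bool" where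
  "linked A B \<longleftrightarrow> (\<exists>C\<ge>0. \<forall>f g1 g2. wd S (axis 1 1) f g1 \<longrightarrow> wd S (axis 2 1) f g2 \<longrightarrow>
     spread A B f \<le> ennreal C * dirichlet g1 g2)"

lemma linkedE:
  assumes "linked A B"
  obtains C where "C \<ge> 0" "\<forall>f g1 g2. wd S (axis 1 1) f g1 \<longrightarrow> wd S (axis 2 1) f g2 \<longrightarrow>
     spread A B f \<le> ennreal C * dirichlet g1 g2"
  using assms unfolding linked_def by blast

lemma linkedI:
  assumes "C \<ge> 0" "\<And>f g1 g2. wd S (axis 1 1) f g1 \<Longrightarrow> wd S (axis 2 1) f g2 \<Longrightarrow>
     spread A B f \<le> ennreal C * dirichlet g1 g2"
  shows "linked A B"
  using assms unfolding linked_def by auto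

text \<open>At the point \<open>(1 - t) x + t z\<close> of the segment one substitutes for \<open>z\<close> if \<open>t\<close> is at least \<open>1/2\<close>
  and for \<open>x\<close> otherwise; the Jacobian is then bounded.\<close>

lemma linked_segments:
  assumes [measurable]: "A \<in> sets borel" "B \<in> sets borel" and sub: "A \<subseteq> S" "B \<subseteq> S"
    and seg: "\<And>x z. x \<in> A \<Longrightarrow> z \<in> B \<Longrightarrow> closed_segment x z \<subseteq> S"
  shows "linked A B"
proof -
  obtain D where D: "D > 0" "\<And>x. x \<in> S \<Longrightarrow> norm x \<le> D"
    using bounded_S unfolding bounded_pos by blast
  have fin: "emeasure lborel A < \<infinity>" "emeasure lborel B < \<infinity>"
    using emeasure_bounded_finite[OF bounded_subset[OF bounded_S sub(1)]]
      emeasure_bounded_finite[OF bounded_subset[OF bounded_S sub(2)]] by auto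
  define mA mB where "mA = measure lborel A" and "mB = measure lborel B"
  have eA: "emeasure lborel A = ennreal mA" and eB: "emeasure lborel B = ennreal mB"
    using fin by (auto simp: mA_def mB_def emeasure_eq_ennreal_measure less_top)
  have nn: "mA \<ge> 0" "mB \<ge> 0" by (auto simp: mA_def mB_def)
  \<comment> \<open>\<open>(2 * D)\<^sup>2\<close> bounds the squared length of a segment, 4 is the
    inverse Jacobian of the substitution, and \<open>mA\<close> or \<open>mB\<close> is the measure
    of the set of the variable that is not substituted.\<close>
  define C where "C = (2 * D)\<^sup>2 * (4 * (mA + mB))"
  show ?thesis
  proof (rule linkedI)
    show "C \<ge> 0" using nn by (simp add: C_def)
    fix f g1 g2 assume w1: "wd S (axis 1 1) f g1" and w2: "wd S (axis 2 1) f g2"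
    note [measurable] = wdD(1,2)[OF w1] wdD(2)[OF w2]
    define k where "k x = ennreal ((g1 x)\<^sup>2 + (g2 x)\<^sup>2)" for x
    have [measurable]: "k \<in> borel_measurable borel" unfolding k_def by measurable
    define I where "I = (\<integral>\<^sup>+x. k x \<partial>lborel)"
    let ?w = "\<lambda>x z. indicator A x * indicator B z :: ennreal" and ?D = "ennreal ((2 * D)\<^sup>2)"
      and ?k = "\<lambda>x h. \<integral>\<^sup>+t. k (x + t *\<^sub>R h) \<partial>unitm"
    \<comment> \<open>Cauchy-Schwarz: the derivative along h is at most |h| times the length of the
      gradient, and |h| \<le> 2 D because both end points lie in \<open>S\<close>.\<close>
    have key: "AE x in lborel. ?w x (x + h) * ennreal ((f x - f (x + h))\<^sup>2)
        \<le> ?w x (x + h) * (?D * ?k x h)" for h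
    proof -
      have "h = (h $ 1) *\<^sub>R axis 1 1 + (h $ 2) *\<^sub>R axis 2 1"
        by (simp add: vec_eq_iff forall_2 axis_def)
      then have w: "wd S h f (\<lambda>x. h $ 1 * g1 x + h $ 2 * g2 x)" using wd_direction[OF w1 w2] by metis
      show ?thesis using wd_translate_square[OF w]
      proof eventually_elim
        case (elim x)
        show ?case
        proof (cases "x \<in> A \<and> x + h \<in> B")
          case True
          then have "ennreal ((f (x + h) - f x)\<^sup>2) \<le> (\<integral>\<^sup>+t. ennreal ((h $ 1 * g1 (x + t *\<^sub>R h) + h $ 2 * g2 (x + t *\<^sub>R h))\<^sup>2) \<partial>unitm)"
            using elim seg by blast
          also have "\<dots> \<le> (\<integral>\<^sup>+t. ?D * k (x + t *\<^sub>R h) \<partial>unitm)"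
          proof (rule nn_integral_mono)
            fix t
            let ?a = "g1 (x + t *\<^sub>R h)" and ?b = "g2 (x + t *\<^sub>R h)"
            have "norm h \<le> norm (x + h) + norm x" using norm_triangle_ineq4[of "x + h" x] by simp
            also have "\<dots> \<le> 2 * D"
            proof -
              have "x \<in> S" "x + h \<in> S" using True sub by auto
              then show ?thesis using D(2)[of x] D(2)[of "x + h"] by simp
            qed
            finally have "(norm h)\<^sup>2 \<le> (2 * D)\<^sup>2" by (intro power_mono) auto
            moreover have "(norm h)\<^sup>2 = (h$1)\<^sup>2 + (h$2)\<^sup>2"
              unfolding norm_vec_def L2_set_def sum_2 by (simp add: real_sqrt_pow2)
            moreover have "(h$1 * ?a + h$2 * ?b)\<^sup>2 \<le> ((h$1)\<^sup>2 + (h$2)\<^sup>2) * (?a\<^sup>2 + ?b\<^sup>2)"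
            proof -
              have "((h$1)\<^sup>2 + (h$2)\<^sup>2) * (?a\<^sup>2 + ?b\<^sup>2) - (h$1 * ?a + h$2 * ?b)\<^sup>2 = (h$1 * ?b - h$2 * ?a)\<^sup>2"
                by (simp add: power2_eq_square algebra_simps)
              then show ?thesis by (metis diff_ge_0_iff_ge zero_le_power2)
            qed
            ultimately have "(h$1 * ?a + h$2 * ?b)\<^sup>2 \<le> (2 * D)\<^sup>2 * (?a\<^sup>2 + ?b\<^sup>2)"
              by (smt (verit) mult_right_mono sum_power2_ge_zero)
            then show "ennreal ((h$1 * ?a + h$2 * ?b)\<^sup>2) \<le> ?D * k (x + t *\<^sub>R h)"
              unfolding k_def by (subst ennreal_mult[symmetric]) (auto intro: ennreal_leI)
          qed
          also have "\<dots> = ?D * ?k x h"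
            by (rule nn_integral_cmult) measurable
          finally show ?thesis using True by (simp add: power2_commute)
        qed (auto simp: indicator_def)
      qed
    qed
    have t_bound: "(\<integral>\<^sup>+x. (\<integral>\<^sup>+z. ?w x z * k (x + t *\<^sub>R (z - x)) \<partial>lborel) \<partial>lborel)
        \<le> ennreal (4 * (mA + mB)) * I" for t
    proof (cases "\<bar>t\<bar> \<ge> 1/2")
      case True
      have "(\<integral>\<^sup>+x. (\<integral>\<^sup>+z. ?w x z * k (x + t *\<^sub>R (z - x)) \<partial>lborel) \<partial>lborel)
          \<le> (\<integral>\<^sup>+x. (\<integral>\<^sup>+z. indicator A x * k ((x - t *\<^sub>R x) + t *\<^sub>R z) \<partial>lborel) \<partial>lborel)"
        by (intro nn_integral_mono) (auto simp: indicator_def algebra_simps)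
      also have "\<dots> = (\<integral>\<^sup>+x. indicator A x * (\<integral>\<^sup>+z. k ((x - t *\<^sub>R x) + t *\<^sub>R z) \<partial>lborel) \<partial>lborel)"
        by (intro nn_integral_cong nn_integral_cmult) measurable
      also have "\<dots> \<le> (\<integral>\<^sup>+x. indicator A x * (4 * I) \<partial>lborel)"
        unfolding I_def by (intro nn_integral_mono mult_left_mono nn_integral_affine_le True) auto
      also have "\<dots> = emeasure lborel A * (4 * I)"
        by (subst nn_integral_multc) auto
      also have "\<dots> = ennreal (4 * mA) * I" using nn by (simp add: eA ennreal_mult mult_ac)
      also have "\<dots> \<le> ennreal (4 * (mA + mB)) * I" using nn by (intro mult_right_mono ennreal_leI) auto
      finally show ?thesis .
    next
      case False
      then have t: "\<bar>1 - t\<bar> \<ge> 1/2" by linarith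
      have "(\<integral>\<^sup>+x. (\<integral>\<^sup>+z. ?w x z * k (x + t *\<^sub>R (z - x)) \<partial>lborel) \<partial>lborel)
          = (\<integral>\<^sup>+z. (\<integral>\<^sup>+x. ?w x z * k (x + t *\<^sub>R (z - x)) \<partial>lborel) \<partial>lborel)"
        by (rule lborel_pair.Fubini'[symmetric]) measurable
      also have "\<dots> \<le> (\<integral>\<^sup>+z. (\<integral>\<^sup>+x. indicator B z * k (t *\<^sub>R z + (1 - t) *\<^sub>R x) \<partial>lborel) \<partial>lborel)"
        by (intro nn_integral_mono) (auto simp: indicator_def algebra_simps)
      also have "\<dots> = (\<integral>\<^sup>+z. indicator B z * (\<integral>\<^sup>+x. k (t *\<^sub>R z + (1 - t) *\<^sub>R x) \<partial>lborel) \<partial>lborel)"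
        by (intro nn_integral_cong nn_integral_cmult) measurable
      also have "\<dots> \<le> (\<integral>\<^sup>+x. indicator B x * (4 * I) \<partial>lborel)"
        unfolding I_def by (intro nn_integral_mono mult_left_mono nn_integral_affine_le t) auto
      also have "\<dots> = emeasure lborel B * (4 * I)"
        by (subst nn_integral_multc) auto
      also have "\<dots> = ennreal (4 * mB) * I" using nn by (simp add: eB ennreal_mult mult_ac)
      also have "\<dots> \<le> ennreal (4 * (mA + mB)) * I" using nn by (intro mult_right_mono ennreal_leI) auto
      finally show ?thesis .
    qed
    \<comment> \<open>The translation identity holds for almost every x once the increment is fixed.
      Hence z is written as x + h and h becomes the outer variable while \<open>key\<close> is
      applied.\<close>
    have "spread A B f = (\<integral>\<^sup>+x. (\<integral>\<^sup>+h. ?w x (x + h) * ennreal ((f x - f (x + h))\<^sup>2) \<partial>lborel) \<partial>lborel)"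
      unfolding spread_def
    proof (rule nn_integral_cong)
      fix x
      show "(\<integral>\<^sup>+z. ?w x z * ennreal ((f x - f z)\<^sup>2) \<partial>lborel)
        = (\<integral>\<^sup>+h. ?w x (x + h) * ennreal ((f x - f (x + h))\<^sup>2) \<partial>lborel)"
        using nn_integral_shift[of "\<lambda>z. ?w x z * ennreal ((f x - f z)\<^sup>2)" x]
        by (simp add: add.commute)
    qed
    also have "\<dots> = (\<integral>\<^sup>+h. (\<integral>\<^sup>+x. ?w x (x + h) * ennreal ((f x - f (x + h))\<^sup>2) \<partial>lborel) \<partial>lborel)"
      by (rule lborel_pair.Fubini'[symmetric]) measurable
    also have "\<dots> \<le> (\<integral>\<^sup>+h. (\<integral>\<^sup>+x. ?w x (x + h) * (?D * ?k x h) \<partial>lborel) \<partial>lborel)"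
      by (intro nn_integral_mono nn_integral_mono_AE key)
    also have "\<dots> = (\<integral>\<^sup>+x. (\<integral>\<^sup>+h. ?w x (x + h) * (?D * ?k x h) \<partial>lborel) \<partial>lborel)"
      by (rule lborel_pair.Fubini') measurable
    also have "\<dots> = (\<integral>\<^sup>+x. (\<integral>\<^sup>+z. ?w x z * (?D * ?k x (z - x)) \<partial>lborel) \<partial>lborel)"
    proof (rule nn_integral_cong)
      fix x
      show "(\<integral>\<^sup>+h. ?w x (x + h) * (?D * ?k x h) \<partial>lborel)
        = (\<integral>\<^sup>+z. ?w x z * (?D * ?k x (z - x)) \<partial>lborel)"
        using nn_integral_shift[of "\<lambda>z. ?w x z * (?D * ?k x (z - x))" x]
        by (simp add: add.commute)
    qed
    also have "\<dots> = (\<integral>\<^sup>+x. (\<integral>\<^sup>+z. (\<integral>\<^sup>+t. ?D * (?w x z * k (x + t *\<^sub>R (z - x))) \<partial>unitm) \<partial>lborel) \<partial>lborel)"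
      by (intro nn_integral_cong) (subst nn_integral_cmult, measurable, subst nn_integral_cmult, measurable, simp add: mult_ac)
    also have "\<dots> = (\<integral>\<^sup>+x. (\<integral>\<^sup>+t. (\<integral>\<^sup>+z. ?D * (?w x z * k (x + t *\<^sub>R (z - x))) \<partial>lborel) \<partial>unitm) \<partial>lborel)"
      by (intro nn_integral_cong ulb.Fubini') measurable
    also have "\<dots> = (\<integral>\<^sup>+t. (\<integral>\<^sup>+x. (\<integral>\<^sup>+z. ?D * (?w x z * k (x + t *\<^sub>R (z - x))) \<partial>lborel) \<partial>lborel) \<partial>unitm)"
      by (rule ulb.Fubini') measurable
    also have "\<dots> = (\<integral>\<^sup>+t. ?D * (\<integral>\<^sup>+x. (\<integral>\<^sup>+z. ?w x z * k (x + t *\<^sub>R (z - x)) \<partial>lborel) \<partial>lborel) \<partial>unitm)"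
      by (simp add: nn_integral_cmult)
    also have "\<dots> \<le> (\<integral>\<^sup>+t. ?D * (ennreal (4 * (mA + mB)) * I) \<partial>unitm)"
      by (intro nn_integral_mono mult_left_mono t_bound) simp
    also have "\<dots> = ennreal C * I"
      using nn emeasure_unitm_UNIV by (simp add: C_def ennreal_mult mult.assoc)
    finally show "spread A B f \<le> ennreal C * dirichlet g1 g2" unfolding I_def k_def dirichlet_def .
  qed
qed

lemma linked_mono:
  assumes l: "linked A B" and sub: "A' \<subseteq> A" "B' \<subseteq> B"
  shows "linked A' B'"
proof -
  from l obtain C where "C \<ge> 0" "\<forall>f g1 g2. wd S (axis 1 1) f g1 \<longrightarrow> wd S (axis 2 1) f g2 \<longrightarrow>
     spread A B f \<le> ennreal C * dirichlet g1 g2" by (rule linkedE)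
  then show ?thesis by (intro linkedI[of C]) (auto intro: order_trans[OF spread_mono[OF sub]])
qed

lemma linked_sym:
  assumes l: "linked A B" and AB: "A \<in> sets borel" "B \<in> sets borel"
  shows "linked B A"
proof -
  from l obtain C where "C \<ge> 0" "\<forall>f g1 g2. wd S (axis 1 1) f g1 \<longrightarrow> wd S (axis 2 1) f g2 \<longrightarrow>
     spread A B f \<le> ennreal C * dirichlet g1 g2" by (rule linkedE)
  then show ?thesis by (intro linkedI[of C]) (use spread_sym[OF AB wdD(1)] in auto)
qed

lemma linked_union:
  assumes l: "linked A B" "linked A' B"
    and m: "A \<in> sets borel" "A' \<in> sets borel" "B \<in> sets borel"
  shows "linked (A \<union> A') B"
proof -
  from l(1) obtain C where C: "C \<ge> 0" "\<forall>f g1 g2. wd S (axis 1 1) f g1 \<longrightarrow> wd S (axis 2 1) f g2 \<longrightarrow>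
     spread A B f \<le> ennreal C * dirichlet g1 g2" by (rule linkedE)
  from l(2) obtain C' where C': "C' \<ge> 0" "\<forall>f g1 g2. wd S (axis 1 1) f g1 \<longrightarrow> wd S (axis 2 1) f g2 \<longrightarrow>
     spread A' B f \<le> ennreal C' * dirichlet g1 g2" by (rule linkedE)
  show ?thesis
  proof (rule linkedI)
    show "C + C' \<ge> 0" using C C' by simp
    fix f g1 g2 assume w: "wd S (axis 1 1) f g1" "wd S (axis 2 1) f g2"
    have "spread (A \<union> A') B f \<le> spread A B f + spread A' B f" by (rule spread_union[OF m wdD(1)[OF w(1)]])
    also have "\<dots> \<le> ennreal C * dirichlet g1 g2 + ennreal C' * dirichlet g1 g2"
      using C(2) C'(2) w by (intro add_mono) auto
    also have "\<dots> = ennreal (C + C') * dirichlet g1 g2"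
      using C(1) C'(1) by (simp add: distrib_right)
    finally show "spread (A \<union> A') B f \<le> ennreal (C + C') * dirichlet g1 g2" .
  qed
qed

lemma linked_empty: "linked {} B"
  by (rule linkedI[of 0]) (auto simp: spread_def)

text \<open>The intermediate set is averaged over, so its measure must be positive in order to be
  divided out; boundedness of \<open>S\<close> makes the other two measures finite.\<close>

lemma linked_trans:
  assumes l: "linked A B" "linked B D"
    and m: "A \<in> sets borel" "B \<in> sets borel" "D \<in> sets borel"
    and sub: "A \<subseteq> S" "B \<subseteq> S" "D \<subseteq> S" and pos: "emeasure lborel B \<noteq> 0"
  shows "linked A D"
proof -
  from l(1) obtain C where C: "C \<ge> 0" "\<forall>f g1 g2. wd S (axis 1 1) f g1 \<longrightarrow> wd S (axis 2 1) f g2 \<longrightarrow>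
     spread A B f \<le> ennreal C * dirichlet g1 g2" by (rule linkedE)
  from l(2) obtain C' where C': "C' \<ge> 0" "\<forall>f g1 g2. wd S (axis 1 1) f g1 \<longrightarrow> wd S (axis 2 1) f g2 \<longrightarrow>
     spread B D f \<le> ennreal C' * dirichlet g1 g2" by (rule linkedE)
  have fin: "emeasure lborel X = ennreal (measure lborel X)" if "X \<subseteq> S" for X
    using that bounded_S emeasure_bounded_finite[of X] bounded_subset[of S X]
    by (auto simp: emeasure_eq_ennreal_measure less_top)
  define a b d where "a = measure lborel A" "b = measure lborel B" "d = measure lborel D"
  have nn: "a \<ge> 0" "d \<ge> 0" by (auto simp: a_b_d_def)
  have e: "emeasure lborel A = ennreal a" "emeasure lborel B = ennreal b" "emeasure lborel D = ennreal d"
    using fin sub by (auto simp: a_b_d_def)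
  have b0: "b > 0" using pos e(2) by (cases "b > 0") (auto simp: ennreal_neg not_less)
  define E where "E = 2 * (d * C + a * C')"
  have E0: "E \<ge> 0" using nn C C' by (simp add: E_def)
  show ?thesis
  proof (rule linkedI)
    show "E / b \<ge> 0" using E0 b0 by simp
    fix f g1 g2 assume w: "wd S (axis 1 1) f g1" "wd S (axis 2 1) f g2"
    let ?I = "dirichlet g1 g2"
    have "ennreal b * spread A D f \<le> ennreal (2 * d) * spread A B f + ennreal (2 * a) * spread B D f"
      by (rule spread_trans[OF m wdD(1)[OF w(1)] nn e])
    also have "\<dots> \<le> ennreal (2 * d) * (ennreal C * ?I) + ennreal (2 * a) * (ennreal C' * ?I)"
      using C(2) C'(2) w by (intro add_mono mult_left_mono) auto
    also have "\<dots> = ennreal E * ?I"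
    proof -
      have "ennreal (2 * d) * (ennreal C * ?I) = ennreal (2 * d * C) * ?I"
        "ennreal (2 * a) * (ennreal C' * ?I) = ennreal (2 * a * C') * ?I"
        using nn C(1) C'(1) by (simp_all add: ennreal_mult mult.assoc)
      moreover have "ennreal E = ennreal (2 * d * C) + ennreal (2 * a * C')"
        using nn C(1) C'(1) by (subst ennreal_plus[symmetric]) (auto simp: E_def algebra_simps)
      ultimately show ?thesis by (simp add: distrib_right)
    qed
    finally show "spread A D f \<le> ennreal (E / b) * ?I" by (rule ennreal_cancel_pos[OF _ b0 E0])
  qed
qed

end

lemma emeasure_ball_nonzero:
  fixes q :: "'a::euclidean_space"
  assumes "e > 0" shows "emeasure lborel (ball q e) \<noteq> 0"
proof
  assume "emeasure lborel (ball q e) = 0"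
  then have "ball q e \<in> null_sets lborel" by (simp add: null_sets_def)
  then have "negligible (ball q e)" by (simp add: negligible_iff_null_sets null_sets_completionI)
  then show False using open_not_negligible[of "ball q e"] assms by simp
qed

context bounded_open
begin

lemma linked_convex: "convex C \<Longrightarrow> open C \<Longrightarrow> C \<subseteq> S \<Longrightarrow> linked C C"
  by (rule linked_segments) (auto dest: closed_segment_subset)

text \<open>The points of \<open>S\<close> that have a ball linked to the fixed one form an open
  set, and so do the remaining points of \<open>S\<close>: if a ball around q in \<open>S\<close>
  meets the first set at w, a small ball around w, contained in the ball around q, passes the link
  on to q, since a convex set is linked to itself. Connectedness leaves no second part.\<close>

lemma linked_balls:
  assumes conn: "connected S" and p0: "ball p0 r0 \<subseteq> S" "r0 > 0" and q: "q \<in> S"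
  shows "\<exists>e>0. ball q e \<subseteq> S \<and> linked (ball q e) (ball p0 r0)"
proof -
  define Z where "Z = {q \<in> S. \<exists>e>0. ball q e \<subseteq> S \<and> linked (ball q e) (ball p0 r0)}"
  have oZ: "open Z"
  proof (subst open_subopen, intro ballI)
    fix q assume "q \<in> Z"
    then obtain e where e: "e > 0" "ball q e \<subseteq> S" "linked (ball q e) (ball p0 r0)" by (auto simp: Z_def)
    have "ball q e \<subseteq> Z"
    proof
      fix w assume w: "w \<in> ball q e"
      then obtain d where d: "d > 0" "ball w d \<subseteq> ball q e" by (rule openE[OF open_ball])
      then show "w \<in> Z" using e w linked_mono[OF e(3) d(2) order_refl] by (auto simp: Z_def)
    qed
    then show "\<exists>T. open T \<and> q \<in> T \<and> T \<subseteq> Z" using e by (intro exI[of _ "ball q e"]) auto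
  qed
  have oC: "open (S - Z)"
  proof (subst open_subopen, intro ballI)
    fix q assume q: "q \<in> S - Z"
    then obtain e where e: "e > 0" "ball q e \<subseteq> S" using open_S open_contains_ball by blast
    have "w \<notin> Z" if w: "w \<in> ball q e" for w
    proof
      assume "w \<in> Z"
      then obtain d where d: "d > 0" "ball w d \<subseteq> S" "linked (ball w d) (ball p0 r0)" by (auto simp: Z_def)
      obtain d' where d': "d' > 0" "ball w d' \<subseteq> ball q e" by (rule openE[OF open_ball w])
      define m where "m = min d d'"
      have m: "m > 0" "ball w m \<subseteq> ball w d" "ball w m \<subseteq> ball q e" using d d' by (auto simp: m_def)
      have 1: "linked (ball q e) (ball w m)"
        using linked_mono[OF linked_convex[OF convex_ball open_ball e(2)] order_refl m(3)] .
      have 2: "linked (ball w m) (ball p0 r0)" by (rule linked_mono[OF d(3) m(2) order_refl])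
      have "linked (ball q e) (ball p0 r0)"
        by (rule linked_trans[OF 1 2]) (use e p0 m d emeasure_ball_nonzero[OF m(1), of w] in auto)
      then show False using q e by (auto simp: Z_def)
    qed
    then show "\<exists>T. open T \<and> q \<in> T \<and> T \<subseteq> S - Z" using e by (intro exI[of _ "ball q e"]) auto
  qed
  have "p0 \<in> Z" using p0 linked_convex[OF convex_ball open_ball p0(1)] by (auto simp: Z_def)
  moreover have "Z \<inter> S = {} \<or> (S - Z) \<inter> S = {}"
    by (rule connectedD[OF conn oZ oC]) auto
  ultimately have "q \<in> Z" using q by (auto simp: Z_def)
  then show ?thesis by (auto simp: Z_def)
qed

text \<open>A subgraph of an \<open>L\<close>-Lipschitz function is star-shaped with respect to every point that lies
  sufficiently deep below the graph.\<close>

lemma linked_boundary: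
  assumes lip: "lipschitz_domain S" and p: "p \<in> frontier S"
  shows "\<exists>U q e. open U \<and> p \<in> U \<and> e > 0 \<and> ball q e \<subseteq> S \<and> linked (U \<inter> S) (ball q e)"
proof -
  obtain r Q g L0 where r: "r > 0" and Q: "orthogonal_matrix (Q::real^2^2)"
    and gL0: "\<forall>s t. \<bar>g s - g t\<bar> \<le> L0 * \<bar>s - t\<bar>"
    and SB: "S \<inter> ball p r = {x \<in> ball p r. (Q *v (x - p)) $ 2 < g ((Q *v (x - p)) $ 1)}"
    using lip p unfolding lipschitz_domain_def by blast
  define L where "L = max L0 0"
  have L0: "L \<ge> 0" by (simp add: L_def)
  have gL: "\<bar>g s - g t\<bar> \<le> L * \<bar>s - t\<bar>" for s t
  proof -
    have "\<bar>g s - g t\<bar> \<le> L0 * \<bar>s - t\<bar>" using gL0 by blast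
    also have "\<dots> \<le> L * \<bar>s - t\<bar>" by (rule mult_right_mono) (auto simp: L_def)
    finally show ?thesis .
  qed
  define \<xi> where "\<xi> x = Q *v (x - p)" for x
  have nQ: "norm (Q *v y) = norm y" for y :: "real^2"
  proof -
    have "orthogonal_transformation (\<lambda>y. Q *v y)"
      unfolding orthogonal_transformation_matrix using Q by (simp add: matrix_vector_mul_linear)
    then show ?thesis by (rule orthogonal_transformation_norm)
  qed
  have n\<xi>: "norm (\<xi> x - \<xi> y) = norm (x - y)" for x y
    unfolding \<xi>_def matrix_vector_mult_diff_distrib[symmetric] using nQ[of "x - y"] by simp
  have \<xi>p: "\<xi> p = 0" by (simp add: \<xi>_def)
  have n\<xi>0: "norm (\<xi> x) = dist x p" for x using n\<xi>[of x p] \<xi>p by (simp add: dist_norm)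
  have inS: "x \<in> S \<longleftrightarrow> \<xi> x $ 2 < g (\<xi> x $ 1)" if "x \<in> ball p r" for x
  proof -
    have "x \<in> S \<inter> ball p r \<longleftrightarrow> \<xi> x $ 2 < g (\<xi> x $ 1)"
      unfolding SB \<xi>_def using that by simp
    then show ?thesis using that by simp
  qed
  have pS: "p \<notin> S" using p open_S by (simp add: frontier_def interior_open)
  have "\<not> 0 < g 0" using inS[of p] r pS \<xi>p by simp
  moreover have "\<not> g 0 < 0"
  proof
    assume neg: "g 0 < 0"
    \<comment> \<open>A point of \<open>S\<close> closer to p than d would satisfy -d < g 0 + L d,
      which the choice (1 + L) d \<le> - g 0 excludes. Together with the case g 0 > 0 this places p
      on the graph.\<close>
    define d where "d = min r (- g 0 / (1 + L))"
    have d: "d > 0" using r neg L0 by (simp add: d_def divide_neg_pos)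
    have "p \<in> closure S" using p by (simp add: frontier_def)
    then obtain x where x: "x \<in> S" "dist x p < d" using d closure_approachable by blast
    have c: "\<bar>\<xi> x $ i\<bar> < d" for i using component_le_norm_cart[of "\<xi> x" i] n\<xi>0[of x] x by simp
    have "\<xi> x $ 2 < g (\<xi> x $ 1)" using inS[of x] x by (simp add: d_def dist_commute)
    moreover have "g (\<xi> x $ 1) \<le> g 0 + L * d"
      using gL[of "\<xi> x $ 1" 0] mult_left_mono[OF less_imp_le[OF c[of 1]] L0] by simp
    moreover have "(1 + L) * d \<le> - g 0"
    proof -
      have "d \<le> - g 0 / (1 + L)" by (simp add: d_def)
      then show ?thesis using L0 by (simp add: field_simps)
    qed
    ultimately show False using c[of 2] by (simp add: algebra_simps)
  qed
  ultimately have g0: "g 0 = 0" by linarith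
  \<comment> \<open>In rotated coordinates \<open>U\<close> is a box with half-sides a and K a,
    where a + K a = r keeps it inside the ball. Over it the graph stays above -L a, while a disc of
    radius a/2 resting on the bottom stays below -K a + a = -3 L a. The gap 2 L a equals the
    Lipschitz bound for the variation of the graph over a horizontal distance 2 a.\<close>
  define K where "K = 3 * L + 1"
  define a where "a = r / (1 + K)"
  have K1: "K \<ge> 1" using L0 by (simp add: K_def)
  have a0: "a > 0" using r K1 by (simp add: a_def)
  have Ka: "K * a = 3 * (L * a) + a" by (simp add: K_def algebra_simps)
  have La: "L * a \<ge> 0" using L0 a0 by simp
  have glow: "g s \<ge> - (L * a)" if "\<bar>s\<bar> < a" for s
    using gL[of s 0] g0 mult_left_mono[OF less_imp_le[OF that] L0] by simp
  define U where "U = {x. \<bar>\<xi> x $ 1\<bar> < a \<and> \<bar>\<xi> x $ 2\<bar> < K * a}"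
  have cont: "continuous_on UNIV (\<lambda>x. \<xi> x $ i)" for i
    unfolding \<xi>_def matrix_vector_mult_def by (simp, intro continuous_intros)
  have oU: "open U"
  proof -
    have "U = {x. \<bar>\<xi> x $ 1\<bar> < a} \<inter> {x. \<bar>\<xi> x $ 2\<bar> < K * a}" by (auto simp: U_def)
    also have "open \<dots>"
      by (intro open_Int open_Collect_less continuous_on_rabs cont continuous_on_const)
    finally show ?thesis .
  qed
  have pU: "p \<in> U" using \<xi>p a0 K1 by (simp add: U_def)
  have Ur: "x \<in> ball p r" if "x \<in> U" for x
  proof -
    have "norm (\<xi> x) \<le> \<bar>\<xi> x $ 1\<bar> + \<bar>\<xi> x $ 2\<bar>" using norm_le_l1_cart[of "\<xi> x"] by (simp add: sum_2)
    also have "\<dots> < a + K * a" using that by (auto simp: U_def)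
    also have "\<dots> = (1 + K) * a" by (simp add: algebra_simps)
    also have "\<dots> = r" using K1 by (simp add: a_def)
    finally show ?thesis using n\<xi>0[of x] by (simp add: dist_commute)
  qed
  define c :: "real^2" where "c = vector [0, - (K * a) + a / 2]"
  define q where "q = p + transpose Q *v c"
  have \<xi>q: "\<xi> q = c"
  proof -
    have "\<xi> q = Q *v (transpose Q *v c)" by (simp add: \<xi>_def q_def)
    also have "\<dots> = (Q ** transpose Q) *v c" by (rule matrix_vector_mul_assoc)
    also have "\<dots> = c" using Q by (simp add: orthogonal_matrix_def)
    finally show ?thesis .
  qed
  have B: "\<bar>\<xi> z $ 1\<bar> < a" "- (K * a) < \<xi> z $ 2" "\<xi> z $ 2 < - (3 * (L * a))" if "z \<in> ball q (a / 2)" for z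
  proof -
    have "norm (\<xi> z - c) < a / 2" using n\<xi>[of z q] that \<xi>q by (simp add: dist_norm norm_minus_commute)
    then have "\<bar>\<xi> z $ i - c $ i\<bar> < a / 2" for i using component_le_norm_cart[of "\<xi> z - c" i] by simp
    moreover have "c $ 1 = 0" "c $ 2 = - (K * a) + a / 2" by (simp_all add: c_def)
    ultimately have "\<bar>\<xi> z $ 1\<bar> < a / 2" "\<bar>\<xi> z $ 2 - (- (K * a) + a / 2)\<bar> < a / 2"
      by (metis diff_zero, metis)
    then show "\<bar>\<xi> z $ 1\<bar> < a" "- (K * a) < \<xi> z $ 2" "\<xi> z $ 2 < - (3 * (L * a))"
      using a0 Ka by linarith+
  qed
  have BU: "z \<in> U" if "z \<in> ball q (a / 2)" for z
    using B[OF that] La a0 Ka by (auto simp: U_def)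
  have BS: "z \<in> S" if "z \<in> ball q (a / 2)" for z
    using inS[OF Ur[OF BU[OF that]]] B[OF that] glow[of "\<xi> z $ 1"] La by auto
  have lin: "\<xi> ((1 - t) *\<^sub>R x + t *\<^sub>R z) $ i = (1 - t) * \<xi> x $ i + t * \<xi> z $ i" for x z t i
  proof -
    have "(1 - t) *\<^sub>R x + t *\<^sub>R z - p = (1 - t) *\<^sub>R (x - p) + t *\<^sub>R (z - p)" by (simp add: algebra_simps)
    then show ?thesis unfolding \<xi>_def
      by (simp add: matrix_vector_right_distrib matrix_vector_mult_scaleR)
  qed
  have "linked (U \<inter> S) (ball q (a / 2))"
  proof (rule linked_segments)
    show "U \<inter> S \<in> sets borel" using oU open_S by (simp add: open_Int)
    show "ball q (a / 2) \<subseteq> S" using BS by blast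
    fix x z assume x: "x \<in> U \<inter> S" and z: "z \<in> ball q (a / 2)"
    show "closed_segment x z \<subseteq> S"
    proof
      fix w assume "w \<in> closed_segment x z"
      then obtain t where t: "0 \<le> t" "t \<le> 1" and w: "w = (1 - t) *\<^sub>R x + t *\<^sub>R z" by (auto simp: in_segment)
      have conv: "\<bar>(1 - t) * u + t * v\<bar> < m" if "\<bar>u\<bar> < m" "\<bar>v\<bar> < m" for u v m :: real
      proof -
        have "(1 - t) * u + t * v < m" by (rule convex_bound_lt) (use that t in auto)
        moreover have "(1 - t) * (- u) + t * (- v) < m" by (rule convex_bound_lt) (use that t in auto)
        ultimately show ?thesis by (simp add: abs_less_iff)
      qed
      have w1: "\<bar>\<xi> w $ 1\<bar> < a" unfolding w lin using x BU[OF z] by (intro conv) (auto simp: U_def)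
      have "\<bar>\<xi> w $ 2\<bar> < K * a" unfolding w lin using x BU[OF z] by (intro conv) (auto simp: U_def)
      then have wU: "w \<in> U" using w1 by (simp add: U_def)
      have "\<xi> w $ 2 < g (\<xi> w $ 1)"
      \<comment> \<open>Either both end points lie below the lowest possible level of the graph, or
        x is so high that the segment descends by at least t (2 L a), which outweighs the possible
        descent of the graph over the same piece.\<close>
      proof (cases "\<xi> x $ 2 < - (L * a)")
        case True
        have "(1 - t) * \<xi> x $ 2 + t * \<xi> z $ 2 < - (L * a)"
          by (rule convex_bound_lt) (use True B[OF z] La t in auto)
        then show ?thesis using glow[OF w1] unfolding w lin by linarith
      next
        case False
        have "\<xi> x $ 2 < g (\<xi> x $ 1)" using x inS Ur by auto
        moreover have "\<xi> w $ 2 \<le> \<xi> x $ 2 - t * (2 * (L * a))"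
        proof -
          have "t * (2 * (L * a)) \<le> t * (\<xi> x $ 2 - \<xi> z $ 2)"
            using False B(3)[OF z] t by (intro mult_left_mono) auto
          then show ?thesis unfolding w lin by (simp add: algebra_simps)
        qed
        moreover have "g (\<xi> x $ 1) - g (\<xi> w $ 1) \<le> t * (2 * (L * a))"
        proof -
          have "\<bar>\<xi> x $ 1 - \<xi> w $ 1\<bar> = t * \<bar>\<xi> x $ 1 - \<xi> z $ 1\<bar>"
          proof -
            have "\<xi> x $ 1 - \<xi> w $ 1 = t * (\<xi> x $ 1 - \<xi> z $ 1)" unfolding w lin by (simp add: algebra_simps)
            then show ?thesis using t by (simp add: abs_mult)
          qed
          also have "\<dots> \<le> t * (2 * a)"
            using x B(1)[OF z] t by (intro mult_left_mono) (auto simp: U_def)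
          finally have "L * \<bar>\<xi> x $ 1 - \<xi> w $ 1\<bar> \<le> L * (t * (2 * a))" using L0 by (rule mult_left_mono)
          then show ?thesis using gL[of "\<xi> x $ 1" "\<xi> w $ 1"] by (simp add: algebra_simps)
        qed
        ultimately show ?thesis by linarith
      qed
      then show "w \<in> S" using inS[OF Ur[OF wU]] by simp
    qed
  qed auto
  then show ?thesis using oU pU a0 BS by (intro exI[of _ U] exI[of _ q] exI[of _ "a / 2"]) auto
qed

text \<open>Every point of the compact closure has a neighbourhood whose part in \<open>S\<close> is
  linked to one fixed ball: inside by chains of balls, at the boundary by the star-shaped pieces.
  Finitely many of them cover \<open>S\<close>, and the ball then links \<open>S\<close> to
  itself.\<close>

theorem linked_whole:
  assumes conn: "connected S" and lip: "lipschitz_domain S"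
  shows "linked S S"
proof (cases "S = {}")
  case True
  then show ?thesis using linked_empty by simp
next
  case False
  then obtain p0 where "p0 \<in> S" by blast
  then obtain r0 where r0: "r0 > 0" "ball p0 r0 \<subseteq> S" using open_S open_contains_ball by blast
  let ?B = "ball p0 r0"
  have loc: "\<exists>U. open U \<and> p \<in> U \<and> linked (U \<inter> S) ?B" if p: "p \<in> closure S" for p
  proof (cases "p \<in> S")
    case True
    obtain e where e: "e > 0" "ball p e \<subseteq> S" "linked (ball p e) ?B"
      using linked_balls[OF conn r0(2,1) True] by blast
    have "linked (ball p e \<inter> S) ?B" by (rule linked_mono[OF e(3)]) auto
    then show ?thesis using e by (intro exI[of _ "ball p e"]) auto
  next
    case False
    then have "p \<in> frontier S" using p open_S by (simp add: frontier_def interior_open)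
    then obtain U q e where U: "open U" "p \<in> U" "e > 0" "ball q e \<subseteq> S" "linked (U \<inter> S) (ball q e)"
      using linked_boundary[OF lip] by blast
    have "q \<in> S" using U by auto
    then obtain d where d: "d > 0" "ball q d \<subseteq> S" "linked (ball q d) ?B"
      using linked_balls[OF conn r0(2,1)] by blast
    define m where "m = min d e"
    have m: "m > 0" "ball q m \<subseteq> ball q d" "ball q m \<subseteq> ball q e" using d U by (auto simp: m_def)
    have 1: "linked (U \<inter> S) (ball q m)" by (rule linked_mono[OF U(5) order_refl m(3)])
    have 2: "linked (ball q m) ?B" by (rule linked_mono[OF d(3) m(2) order_refl])
    have "linked (U \<inter> S) ?B"
      by (rule linked_trans[OF 1 2]) (use U open_S m d r0 emeasure_ball_nonzero[OF m(1), of q] in \<open>auto simp: open_Int\<close>)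
    then show ?thesis using U by blast
  qed
  then obtain U where U: "\<And>p. p \<in> closure S \<Longrightarrow> open (U p) \<and> p \<in> U p \<and> linked (U p \<inter> S) ?B" by metis
  have "compact (closure S)" using bounded_S by (simp add: compact_closure)
  then obtain F where F: "F \<subseteq> closure S" "finite F" "closure S \<subseteq> (\<Union>p\<in>F. U p)"
    by (rule compactE_image[of _ "closure S" U]) (use U in blast)+
  have "linked ((\<Union>p\<in>F. U p) \<inter> S) ?B"
    using F(2,1)
  proof (induction F rule: finite_induct)
    case empty
    then show ?case using linked_empty by simp
  next
    case (insert p F)
    then have "linked (U p \<inter> S \<union> (\<Union>p\<in>F. U p) \<inter> S) ?B"
      using U open_S by (intro linked_union) (auto intro!: borel_open open_Int open_UN)
    moreover have "(\<Union>p\<in>insert p F. U p) \<inter> S = U p \<inter> S \<union> (\<Union>p\<in>F. U p) \<inter> S" by blast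
    ultimately show ?case by simp
  qed
  moreover have "(\<Union>p\<in>F. U p) \<inter> S = S" using F(3) closure_subset by blast
  ultimately have 1: "linked S ?B" by simp
  have 2: "linked ?B S" by (rule linked_sym[OF 1]) auto
  show ?thesis
    by (rule linked_trans[OF 1 2]) (use r0 emeasure_ball_nonzero[OF r0(1), of p0] in auto)
qed

end

section \<open>From weak derivatives on the domain to Borel representatives on the plane\<close>

context bounded_open
begin

lemma set_integrable_loc_int_bump:
  assumes f: "loc_int S f" and \<psi>: "\<psi> \<in> bumps S"
  shows "set_integrable lebesgue S (\<lambda>x. f x * \<psi> x)"
proof -
  obtain a b where ab: "cbox a b \<subseteq> S" "\<And>x. x \<notin> cbox a b \<Longrightarrow> \<psi> x = 0"
    using \<psi> by (rule bumpsE) blast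
  obtain M where M: "M > 0" "\<forall>x. \<bar>\<psi> x\<bar> \<le> M" using bumps_bounded[OF \<psi>] by auto
  have i: "integrable lebesgue (\<lambda>x. indicator (cbox a b) x * f x)"
    using f ab(1) compact_cbox unfolding loc_int_def set_integrable_def by force
  have "integrable lebesgue (\<lambda>x. (indicator (cbox a b) x * f x) * \<psi> x)"
  proof (rule Bochner_Integration.integrable_bound[OF integrable_mult_right[OF i, of M]])
    show "(\<lambda>x. (indicator (cbox a b) x * f x) * \<psi> x) \<in> borel_measurable lebesgue"
      using bumps_measurable[OF \<psi>]
      by (intro borel_measurable_times[OF borel_measurable_integrable[OF i]]) (simp add: measurable_completion)
    have "norm (k * \<psi> x) \<le> norm (M * k)" for x k
      using mult_left_mono[OF spec[OF M(2), of x] abs_ge_zero[of k]] M(1)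
      by (simp add: abs_mult mult.commute)
    then show "AE x in lebesgue. norm ((indicator (cbox a b) x * f x) * \<psi> x) \<le> norm (M * (indicator (cbox a b) x * f x))"
      by (intro AE_I2)
  qed
  moreover have "(\<lambda>x. (indicator (cbox a b) x * f x) * \<psi> x) = (\<lambda>x. indicator S x *\<^sub>R (f x * \<psi> x))"
    using ab by (auto simp: fun_eq_iff indicator_def)
  ultimately show ?thesis unfolding set_integrable_def by simp
qed

lemma set_integral_bump_eq:
  assumes f: "loc_int S f" and \<psi>: "\<psi> \<in> bumps S" and f'[measurable]: "f' \<in> borel_measurable borel"
    and out: "\<And>x. x \<notin> S \<Longrightarrow> f' x = 0" and ae: "AE x in lborel. x \<in> S \<longrightarrow> f' x = f x"
  shows "(LINT x:S|lebesgue. f x * \<psi> x) = (LBINT x. f' x * \<psi> x)"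
proof -
  note [measurable] = bumps_measurable[OF \<psi>]
  have m: "(\<lambda>x. f' x * \<psi> x) \<in> borel_measurable borel" by measurable
  have "(LINT x:S|lebesgue. f x * \<psi> x) = (\<integral>x. f' x * \<psi> x \<partial>lebesgue)"
    unfolding set_lebesgue_integral_def
  proof (rule integral_cong_AE)
    show "(\<lambda>x. indicator S x *\<^sub>R (f x * \<psi> x)) \<in> borel_measurable lebesgue"
      using set_integrable_loc_int_bump[OF f \<psi>] unfolding set_integrable_def
      by (rule borel_measurable_integrable)
    show "(\<lambda>x. f' x * \<psi> x) \<in> borel_measurable lebesgue" using m by (simp add: measurable_completion)
    show "AE x in lebesgue. indicator S x *\<^sub>R (f x * \<psi> x) = f' x * \<psi> x"
      using AE_completion[OF ae] by eventually_elim (use out in \<open>auto simp: indicator_def\<close>)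
  qed
  also have "\<dots> = (LBINT x. f' x * \<psi> x)" by (rule integral_completion) measurable
  finally show ?thesis .
qed

lemma borel_representative:
  assumes f: "f \<in> borel_measurable (restrict_space lebesgue S)"
  shows "\<exists>f'\<in>borel_measurable borel. (\<forall>x. x \<notin> S \<longrightarrow> f' x = (0::real)) \<and> (AE x in lborel. x \<in> S \<longrightarrow> f' x = f x)"
proof -
  have "(\<lambda>x. indicator S x *\<^sub>R f x) \<in> borel_measurable lebesgue"
    using f borel_measurable_restrict_space_iff[of S lebesgue f] by (simp add: mult.commute)
  then obtain h where h[measurable]: "h \<in> borel_measurable lborel" and ae: "AE x in lborel. indicator S x *\<^sub>R f x = h x"
    using completion_ex_borel_measurable_real by blast
  show ?thesis
  proof (intro bexI[of _ "\<lambda>x. indicator S x * h x"] conjI allI impI)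
    show "AE x in lborel. x \<in> S \<longrightarrow> indicator S x * h x = f x"
      using ae by eventually_elim auto
  qed (use h in auto)
qed

text \<open>The representative \<open>f'\<close> is prescribed rather than produced, so that the
  derivatives in both coordinate directions belong to one and the same function.\<close>

lemma wd_of_weak_pd:
  assumes w: "weak_pd S f j g"
    and mf: "f \<in> borel_measurable (restrict_space lebesgue S)"
    and mg: "g \<in> borel_measurable (restrict_space lebesgue S)"
    and bd: "AE x in lebesgue. x \<in> S \<longrightarrow> \<bar>f x\<bar> \<le> M"
    and sq: "set_integrable lebesgue S (\<lambda>x. (g x)\<^sup>2)"
    and f'm[measurable]: "f' \<in> borel_measurable borel" and f'0: "\<And>x. x \<notin> S \<Longrightarrow> f' x = 0"
    and f'b: "\<And>x. \<bar>f' x\<bar> \<le> M" and f'ae: "AE x in lborel. x \<in> S \<longrightarrow> f' x = f x"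
  shows "\<exists>g'. wd S (axis j 1) f' g' \<and> (AE x in lborel. x \<in> S \<longrightarrow> g' x = g x)"
proof -
  obtain g' where g'[measurable]: "g' \<in> borel_measurable borel" and g'0: "\<And>x. x \<notin> S \<Longrightarrow> g' x = 0"
    and g'ae: "AE x in lborel. x \<in> S \<longrightarrow> g' x = g x"
    using borel_representative[OF mg] by auto
  have lf: "loc_int S f" and lg: "loc_int S g"
    and id: "\<And>\<phi>. test_fun S \<phi> \<Longrightarrow> (LINT x:S|lebesgue. f x * pd j \<phi> x) = - (LINT x:S|lebesgue. g x * \<phi> x)"
    using w unfolding weak_pd_def by auto
  have "wd S (axis j 1) f' g'"
  proof (rule wdI[OF f'm g' f'0 g'0 f'b])
    have "integrable lebesgue (\<lambda>x. (g' x)\<^sup>2)"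
    proof (rule integrable_cong_AE[THEN iffD1])
      show "integrable lebesgue (\<lambda>x. indicator S x *\<^sub>R (g x)\<^sup>2)" using sq unfolding set_integrable_def .
      then show "(\<lambda>x. indicator S x *\<^sub>R (g x)\<^sup>2) \<in> borel_measurable lebesgue" by (rule borel_measurable_integrable)
      have "(\<lambda>x. (g' x)\<^sup>2) \<in> borel_measurable borel" by measurable
      then show "(\<lambda>x. (g' x)\<^sup>2) \<in> borel_measurable lebesgue" by (simp add: measurable_completion)
      show "AE x in lebesgue. indicator S x *\<^sub>R (g x)\<^sup>2 = (g' x)\<^sup>2"
        using AE_completion[OF g'ae] by eventually_elim (use g'0 in \<open>auto simp: indicator_def\<close>)
    qed
    then show "integrable lborel (\<lambda>x. (g' x)\<^sup>2)" by (subst (asm) integrable_completion) auto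
    fix \<phi> assume \<phi>: "\<phi> \<in> bumps S"
    show "(LBINT x. f' x * dird (axis j 1) \<phi> x) = - (LBINT x. g' x * \<phi> x)"
      using id[OF test_fun_bumps[OF \<phi>]] set_integral_bump_eq[OF lf pd_bumps[OF \<phi>, of j] f'm f'0 f'ae]
        set_integral_bump_eq[OF lg \<phi> g' g'0 g'ae] by (simp add: pd_eq_dird)
  qed
  then show ?thesis using g'ae by blast
qed

lemma loc_int_of_integrable:
  assumes "integrable lborel g" shows "loc_int S g"
  using assms integrable_completion[of g lborel] unfolding loc_int_def set_integrable_def
  by (intro allI impI integrable_mult_indicator)
    (auto intro: lmeasurable_compact fmeasurableD dest: borel_measurable_integrable)

lemma AE_eq_of_bumps:
  assumes u: "loc_int S u" and v: "loc_int S v"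
    and eq: "\<And>\<phi>. \<phi> \<in> bumps S \<Longrightarrow> (LINT x:S|lebesgue. u x * \<phi> x) = (LINT x:S|lebesgue. v x * \<phi> x)"
  shows "AE x in lborel. x \<in> S \<longrightarrow> u x = v x"
proof -
  have "AE x in lebesgue. x \<in> S \<longrightarrow> u x - v x = 0"
  proof (rule AE_zero_of_bumps[OF open_S])
    show "loc_int S (\<lambda>x. u x - v x)" using u v unfolding loc_int_def by (auto intro: set_integral_diff(1))
    fix \<phi> assume \<phi>: "\<phi> \<in> bumps S"
    show "(LINT x:S|lebesgue. (u x - v x) * \<phi> x) = 0"
      using set_integral_diff(2)[OF set_integrable_loc_int_bump[OF u \<phi>] set_integrable_loc_int_bump[OF v \<phi>]] eq[OF \<phi>]
      by (simp add: left_diff_distrib)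
  qed
  then show ?thesis by (simp add: AE_completion_iff)
qed

text \<open>The weak Jacobians of the normal and of the Cosserat field are given merely as locally
  integrable; this identifies them with the derivatives that the product rule yields for the
  frame.\<close>

lemma weak_pd_unique:
  assumes w: "weak_pd S f j g" and wd: "wd S (axis j 1) f' g'"
    and ae: "AE x in lborel. x \<in> S \<longrightarrow> f' x = f x"
  shows "AE x in lborel. x \<in> S \<longrightarrow> g x = g' x"
proof (rule AE_eq_of_bumps)
  show lg: "loc_int S g" using w unfolding weak_pd_def by auto
  have lf: "loc_int S f" using w unfolding weak_pd_def by auto
  show lg': "loc_int S g'" by (rule loc_int_of_integrable[OF wd_integrable(2)[OF wd]])
  fix \<phi> assume \<phi>: "\<phi> \<in> bumps S"
  have "(LINT x:S|lebesgue. f x * pd j \<phi> x) = - (LINT x:S|lebesgue. g x * \<phi> x)"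
    using w test_fun_bumps[OF \<phi>] unfolding weak_pd_def by auto
  moreover have "(LINT x:S|lebesgue. f x * pd j \<phi> x) = (LBINT x. f' x * pd j \<phi> x)"
    by (rule set_integral_bump_eq[OF lf pd_bumps[OF \<phi>] wdD(1,3)[OF wd] ae])
  moreover have "(LINT x:S|lebesgue. g' x * \<phi> x) = (LBINT x. g' x * \<phi> x)"
    by (rule set_integral_bump_eq[OF lg' \<phi> wdD(2,4)[OF wd]]) auto
  ultimately show "(LINT x:S|lebesgue. g x * \<phi> x) = (LINT x:S|lebesgue. g' x * \<phi> x)"
    using wdD(6)[OF wd \<phi>] by (simp add: pd_eq_dird)
qed

text \<open>Both derivatives are moved onto the bump, whose partial derivatives are again test
  functions and commute.\<close>

lemma weak_second_derivatives_commute: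
  assumes yi: "weak_pd S u i (d i)" and yj: "weak_pd S u j (d j)"
    and ij: "weak_pd S (d i) j p" and ji: "weak_pd S (d j) i q"
  shows "AE x in lborel. x \<in> S \<longrightarrow> p x = q x"
proof (rule AE_eq_of_bumps)
  show "loc_int S p" "loc_int S q" using ij ji unfolding weak_pd_def by auto
  fix \<phi> assume \<phi>: "\<phi> \<in> bumps S"
  have t: "test_fun S \<phi>" "test_fun S (pd i \<phi>)" "test_fun S (pd j \<phi>)"
    using \<phi> by (auto intro: test_fun_bumps pd_bumps)
  have "(LINT x:S|lebesgue. p x * \<phi> x) = (LINT x:S|lebesgue. u x * pd i (pd j \<phi>) x)"
    using ij yi t unfolding weak_pd_def by simp
  also have "\<dots> = (LINT x:S|lebesgue. u x * pd j (pd i \<phi>) x)"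
    by (simp add: pd_commute_bumps[OF \<phi>, of i j])
  also have "\<dots> = (LINT x:S|lebesgue. q x * \<phi> x)"
    using ji yj t unfolding weak_pd_def by simp
  finally show "(LINT x:S|lebesgue. p x * \<phi> x) = (LINT x:S|lebesgue. q x * \<phi> x)" .
qed

text \<open>Continuity is required on the compact closure, which provides global bounds; the
  difference quotients are required only in the open set, where small steps stay inside.\<close>

definition C1 :: "(real^2 \<Rightarrow> real) \<Rightarrow> (2 \<Rightarrow> real^2 \<Rightarrow> real) \<Rightarrow> bool" where
  "C1 f d \<longleftrightarrow> continuous_on (closure S) f \<and> (\<forall>j. continuous_on (closure S) (d j)) \<and>
     (\<forall>x\<in>S. \<forall>j. ((\<lambda>t. f (x + t *\<^sub>R axis j 1)) has_real_derivative d j x) (at 0))"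

lemma C1_bounded:
  assumes "continuous_on (closure S) f"
  shows "\<exists>M>0. \<forall>x\<in>closure S. \<bar>f x\<bar> \<le> (M::real)"
proof -
  have "compact (f ` closure S)"
    using bounded_S by (intro compact_continuous_image assms) (simp add: compact_closure)
  then obtain M where "M > 0" "\<forall>y\<in>f ` closure S. norm y \<le> M"
    using compact_imp_bounded bounded_pos by metis
  then show ?thesis by auto
qed

lemma C1_wd:
  assumes "C1 f d"
  shows "wd S (axis j 1) (\<lambda>x. indicator S x * f x) (\<lambda>x. indicator S x * d j x)"
proof -
  obtain M where M: "\<forall>x\<in>closure S. \<bar>f x\<bar> \<le> M" using C1_bounded[of f] assms unfolding C1_def by auto
  obtain M' where M': "\<forall>x\<in>closure S. \<bar>d j x\<bar> \<le> M'" using C1_bounded[of "d j"] assms unfolding C1_def by auto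
  have "continuous_on S f" "continuous_on S (d j)"
    using assms closure_subset continuous_on_subset unfolding C1_def by metis+
  then show ?thesis
    by (rule wd_C1[where M=M and M'=M']) (use M M' assms closure_subset in \<open>auto simp: C1_def\<close>)
qed

lemma C1_const: "C1 (\<lambda>_. c) (\<lambda>_ _. 0)"
  unfolding C1_def by auto

lemma C1_add: "C1 f d \<Longrightarrow> C1 f' d' \<Longrightarrow> C1 (\<lambda>x. f x + f' x) (\<lambda>j x. d j x + d' j x)"
  unfolding C1_def by (auto intro!: continuous_intros derivative_eq_intros)

lemma C1_diff: "C1 f d \<Longrightarrow> C1 f' d' \<Longrightarrow> C1 (\<lambda>x. f x - f' x) (\<lambda>j x. d j x - d' j x)"
  unfolding C1_def by (auto intro!: continuous_intros derivative_eq_intros)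

lemma C1_mult: "C1 f d \<Longrightarrow> C1 f' d' \<Longrightarrow> C1 (\<lambda>x. f x * f' x) (\<lambda>j x. d j x * f' x + d' j x * f x)"
  unfolding C1_def
  by (intro conjI allI ballI continuous_intros; (fast | (elim conjE, rule DERIV_cong[OF DERIV_mult], fast, fast, simp)))

lemma C1_chain:
  assumes f: "C1 f d" and h: "continuous_on (f ` closure S) h" "continuous_on (f ` closure S) h'"
    and d: "\<And>y. y \<in> f ` closure S \<Longrightarrow> (h has_real_derivative h' y) (at y)"
  shows "C1 (\<lambda>x. h (f x)) (\<lambda>j x. h' (f x) * d j x)"
  unfolding C1_def
proof (intro conjI allI ballI)
  have cf: "continuous_on (closure S) f" using f by (simp add: C1_def)
  show "continuous_on (closure S) (\<lambda>x. h (f x))" by (rule continuous_on_compose2[OF h(1) cf]) auto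
  fix j show "continuous_on (closure S) (\<lambda>x. h' (f x) * d j x)"
    by (intro continuous_on_mult continuous_on_compose2[OF h(2) cf]) (use f in \<open>auto simp: C1_def\<close>)
  fix x assume x: "x \<in> S"
  show "((\<lambda>t. h (f (x + t *\<^sub>R axis j 1))) has_real_derivative h' (f x) * d j x) (at 0)"
    by (rule DERIV_chain2[where f=h and g="\<lambda>t. f (x + t *\<^sub>R axis j 1)"])
      (use d[of "f x"] x closure_subset f in \<open>auto simp: C1_def\<close>)
qed

lemma C1_inverse:
  assumes "C1 f d" "\<And>x. x \<in> closure S \<Longrightarrow> f x \<noteq> 0"
  shows "\<exists>d'. C1 (\<lambda>x. inverse (f x)) d'"
proof -
  have "C1 (\<lambda>x. inverse (f x)) (\<lambda>j x. (- (inverse (f x) ^ 2)) * d j x)"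
    by (rule C1_chain[OF assms(1)]) (use assms(2) in \<open>auto intro!: continuous_intros derivative_eq_intros simp: power2_eq_square\<close>)
  then show ?thesis by blast
qed

lemma C1_sqrt:
  assumes "C1 f d" "\<And>x. x \<in> closure S \<Longrightarrow> f x > 0"
  shows "\<exists>d'. C1 (\<lambda>x. sqrt (f x)) d'"
proof -
  have "C1 (\<lambda>x. sqrt (f x)) (\<lambda>j x. (inverse (sqrt (f x)) / 2) * d j x)"
  proof (rule C1_chain[OF assms(1)])
    show "continuous_on (f ` closure S) (\<lambda>y. inverse (sqrt y) / 2)"
      by (intro continuous_intros) (use assms(2) in \<open>auto simp: less_imp_neq[THEN not_sym]\<close>)
    show "(sqrt has_real_derivative inverse (sqrt y) / 2) (at y)" if "y \<in> f ` closure S" for y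
      using that assms(2) by (intro DERIV_real_sqrt) auto
  qed (intro continuous_intros)
  then show ?thesis by blast
qed

end

lemma matrix_inv_both:
  assumes "invertible A" shows "A ** matrix_inv A = mat 1 \<and> matrix_inv A ** A = mat 1"
  using assms unfolding invertible_def matrix_inv_def by (rule someI_ex)

section \<open>Geometry of the frames\<close>

definition gdet :: "real^3^3 \<Rightarrow> real" where
  "gdet A = A$1$1 * A$2$2 - A$1$2 * A$1$2"

text \<open>Cramer's rule: \<open>shift1\<close> and \<open>shift2\<close> solve the system with
  matrix \<open>upper2 A\<close> and right-hand side (A13, A23). They are the tangential
  coefficients of the Cosserat field.\<close>

definition shift1 :: "real^3^3 \<Rightarrow> real" where
  "shift1 A = (A$2$2 * A$1$3 - A$1$2 * A$2$3) / gdet A"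

definition shift2 :: "real^3^3 \<Rightarrow> real" where
  "shift2 A = (A$1$1 * A$2$3 - A$1$2 * A$1$3) / gdet A"

text \<open>The quotient of \<open>det A\<close> by the upper \<open>2x2\<close> minor, which is also the inverse of the entry
  \<open>(3,3)\<close> of \<open>A^-1\<close>.\<close>

definition lapse :: "real^3^3 \<Rightarrow> real" where
  "lapse A = A$3$3 - shift1 A * A$1$3 - shift2 A * A$2$3"

context
  fixes A :: "real^3^3"
  assumes symA: "transpose A = A" and posA: "\<forall>v. v \<noteq> 0 \<longrightarrow> v \<bullet> (A *v v) > 0"
begin

lemma sym_entry: "A$i$j = A$j$i"
proof -
  have "A$i$j = transpose A $ i $ j" by (simp add: symA)
  then show ?thesis by (simp add: transpose_def)
qed

lemma posdef_quadratic:
  "(vector [a,b,c] :: real^3) \<noteq> 0 \<Longrightarrow>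
    0 < a*(A$1$1*a + A$1$2*b + A$1$3*c) + b*(A$1$2*a + A$2$2*b + A$2$3*c) + c*(A$1$3*a + A$2$3*b + A$3$3*c)"
  using posA[rule_format, of "vector [a,b,c]"] sym_entry[of 2 1] sym_entry[of 3 1] sym_entry[of 3 2]
  by (simp add: inner_vec_def matrix_vector_mult_def sum_3)

lemma posdef_11: "A$1$1 > 0"
  using posdef_quadratic[of 1 0 0] by (simp add: vec_eq_iff forall_3)

lemma gdet_pos: "gdet A > 0"
proof -
  \<comment> \<open>The quadratic form takes the value \<open>A$1$1 * gdet A\<close> at this
    vector.\<close>
  have "(vector [- A$1$2, A$1$1, 0] :: real^3) \<noteq> 0" using posdef_11 by (simp add: vec_eq_iff forall_3)
  from posdef_quadratic[OF this] have "0 < A$1$1 * gdet A" by (simp add: gdet_def algebra_simps)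
  then show ?thesis using posdef_11 by (simp add: zero_less_mult_iff)
qed

lemma shift_eq1: "A$1$1 * shift1 A + A$1$2 * shift2 A = A$1$3"
proof -
  have "(A$1$1 * shift1 A + A$1$2 * shift2 A) * gdet A = A$1$3 * gdet A"
    using gdet_pos by (simp add: shift1_def shift2_def distrib_right) (simp add: gdet_def algebra_simps)
  then show ?thesis using gdet_pos by simp
qed

lemma shift_eq2: "A$1$2 * shift1 A + A$2$2 * shift2 A = A$2$3"
proof -
  have "(A$1$2 * shift1 A + A$2$2 * shift2 A) * gdet A = A$2$3 * gdet A"
    using gdet_pos by (simp add: shift1_def shift2_def distrib_right) (simp add: gdet_def algebra_simps)
  then show ?thesis using gdet_pos by simp
qed

text \<open>The test vector is orthogonal to the first two basis vectors with respect to
  \<open>A\<close>, and \<open>lapse A\<close>, the Schur complement of the upper block, is the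
  value of the quadratic form there.\<close>

lemma lapse_pos: "lapse A > 0"
proof -
  have "(vector [- shift1 A, - shift2 A, 1] :: real^3) \<noteq> 0" by (simp add: vec_eq_iff forall_3)
  from posdef_quadratic[OF this] have "0 < - shift1 A * (A$1$3 - (A$1$1 * shift1 A + A$1$2 * shift2 A))
     - shift2 A * (A$2$3 - (A$1$2 * shift1 A + A$2$2 * shift2 A)) + lapse A"
    by (simp add: lapse_def algebra_simps)
  then show ?thesis unfolding shift_eq1 shift_eq2 by simp
qed

lemma det_eq_gdet_lapse: "det A = gdet A * lapse A"
proof -
  have "gdet A * lapse A = gdet A * A$3$3 - (gdet A * shift1 A) * A$1$3 - (gdet A * shift2 A) * A$2$3"
    by (simp add: lapse_def algebra_simps)
  also have "gdet A * shift1 A = A$2$2 * A$1$3 - A$1$2 * A$2$3" using gdet_pos by (simp add: shift1_def)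
  also have "gdet A * shift2 A = A$1$1 * A$2$3 - A$1$2 * A$1$3" using gdet_pos by (simp add: shift2_def)
  finally show ?thesis
    using sym_entry[of 2 1] sym_entry[of 3 1] sym_entry[of 3 2] by (simp add: det_3 gdet_def algebra_simps)
qed

text \<open>In the equations for a column of the inverse, subtracting \<open>shift1\<close> times
  the first and \<open>shift2\<close> times the second from the third eliminates the first two
  unknowns and leaves the factor \<open>lapse A\<close> on the third.\<close>

lemma matrix_inv_row3:
  "matrix_inv A $ 3 $ 1 = - shift1 A / lapse A" "matrix_inv A $ 3 $ 2 = - shift2 A / lapse A"
  "matrix_inv A $ 3 $ 3 = 1 / lapse A"
proof -
  have "invertible A" using det_eq_gdet_lapse gdet_pos lapse_pos by (simp add: invertible_det_nz)
  then have "A ** matrix_inv A = mat 1" using matrix_inv_both by blast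
  then have e: "A$l$1 * matrix_inv A$1$k + A$l$2 * matrix_inv A$2$k + A$l$3 * matrix_inv A$3$k = (if l = k then 1 else 0)" for l k
    by (simp add: vec_eq_iff matrix_matrix_mult_def mat_def sum_3)
  have "lapse A * matrix_inv A $ 3 $ k = (if k = 3 then 1 else 0) - shift1 A * (if k = 1 then 1 else 0) - shift2 A * (if k = 2 then 1 else 0)" for k
  proof -
    define p q r where "p = matrix_inv A$1$k" "q = matrix_inv A$2$k" "r = matrix_inv A$3$k"
    have e1: "A$1$1 * p + A$1$2 * q + A$1$3 * r = (if k = 1 then 1 else 0)"
      and e2: "A$1$2 * p + A$2$2 * q + A$2$3 * r = (if k = 2 then 1 else 0)"
      and e3: "A$1$3 * p + A$2$3 * q + A$3$3 * r = (if k = 3 then 1 else 0)"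
      using e[of 1 k] e[of 2 k] e[of 3 k] sym_entry[of 2 1] sym_entry[of 3 1] sym_entry[of 3 2]
      by (auto simp: p_q_r_def)
    have "lapse A * r = (A$1$3 * p + A$2$3 * q + A$3$3 * r)
        - shift1 A * (A$1$1 * p + A$1$2 * q + A$1$3 * r) - shift2 A * (A$1$2 * p + A$2$2 * q + A$2$3 * r)
        + (A$1$1 * shift1 A + A$1$2 * shift2 A - A$1$3) * p + (A$1$2 * shift1 A + A$2$2 * shift2 A - A$2$3) * q"
      by (simp add: lapse_def algebra_simps)
    also have "\<dots> = (if k = 3 then 1 else 0) - shift1 A * (if k = 1 then 1 else 0) - shift2 A * (if k = 2 then 1 else 0)"
      unfolding shift_eq1 shift_eq2 e1 e2 e3 by simp
    finally show ?thesis by (simp only: p_q_r_def)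
  qed
  from this[of 1] this[of 2] this[of 3] lapse_pos
  show "matrix_inv A $ 3 $ 1 = - shift1 A / lapse A" "matrix_inv A $ 3 $ 2 = - shift2 A / lapse A"
    "matrix_inv A $ 3 $ 3 = 1 / lapse A" by (auto simp: field_simps)
qed

lemma det_upper2: "det (upper2 A) = gdet A"
  using sym_entry[of 2 1] by (simp add: det_2 upper2_def ix_def gdet_def)

lemma matrix_inv_upper2:
  "matrix_inv (upper2 A) *v vector [A$1$3, A$2$3] = vector [shift1 A, shift2 A]"
proof -
  have "upper2 A *v vector [shift1 A, shift2 A] = vector [A$1$3, A$2$3]"
    using shift_eq1 shift_eq2 sym_entry[of 2 1]
    by (simp add: vec_eq_iff forall_2 matrix_vector_mult_def sum_2 upper2_def ix_def)
  moreover have "matrix_inv (upper2 A) ** upper2 A = mat 1"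
    using det_upper2 gdet_pos matrix_inv_both[of "upper2 A"] by (simp add: invertible_det_nz)
  ultimately show ?thesis by (metis matrix_vector_mul_assoc matrix_vector_mul_lid)
qed

end

definition Ghat :: "real^3^3 \<Rightarrow> real^3^3" where
  "Ghat A = (\<chi> p q. if p \<noteq> 3 \<and> q \<noteq> 3 then A$p$q else if p = q then 1 else 0)"

text \<open>The inverse is written out by cofactors so that its entries are visibly products of
  entries of \<open>A\<close> and the inverse of \<open>gdet A\<close>, hence continuously
  differentiable along the mid-plane.\<close>

definition Ghat_inv :: "real^3^3 \<Rightarrow> real^3^3" where
  "Ghat_inv A = (\<chi> p q. if p = 3 \<or> q = 3 then if p = q then 1 else 0
     else (if p = 1 then (if q = 1 then A$2$2 else - A$1$2) else (if q = 1 then - A$1$2 else A$1$1)) * inverse (gdet A))"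

lemma Ghat_inv_right:
  assumes "transpose A = A" and "\<forall>v. v \<noteq> 0 \<longrightarrow> v \<bullet> (A *v v) > 0"
  shows "Ghat A ** Ghat_inv A = mat 1"
proof -
  have D: "gdet A \<noteq> 0" using gdet_pos[OF assms] by simp
  have s: "A$2$1 = A$1$2" by (rule sym_entry[OF assms])
  define w where "w = inverse (gdet A)"
  have k: "A$1$1 * (A$2$2 * w) = 1 + A$1$2 * (A$1$2 * w)"
  proof -
    have "(A$1$1 * A$2$2 - A$1$2 * A$1$2) * w = 1" using D by (simp add: w_def gdet_def)
    then show ?thesis by (simp add: algebra_simps)
  qed
  show ?thesis unfolding Ghat_inv_def w_def[symmetric]
    by (simp add: vec_eq_iff forall_3 matrix_matrix_mult_def mat_def sum_3 Ghat_def s)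
      (use k in \<open>simp add: algebra_simps\<close>)
qed

context bounded_open
begin

definition wdm :: "real^2 \<Rightarrow> (real^2 \<Rightarrow> real^'n^'m) \<Rightarrow> (real^2 \<Rightarrow> real^'n^'m) \<Rightarrow> bool" where
  "wdm h A dA \<longleftrightarrow> (\<forall>k p. wd S h (\<lambda>x. A x$k$p) (\<lambda>x. dA x$k$p))"

lemma wdm_mult:
  assumes "wdm h A dA" "wdm h B dB"
  shows "wdm h (\<lambda>x. A x ** B x) (\<lambda>x. dA x ** B x + A x ** dB x)"
  unfolding wdm_def matrix_matrix_mult_def
  using assms by (auto simp: sum.distrib[symmetric] wdm_def intro!: wd_sum wd_mult)

lemma wdm_transpose: "wdm h A dA \<Longrightarrow> wdm h (\<lambda>x. transpose (A x)) (\<lambda>x. transpose (dA x))"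
  unfolding wdm_def transpose_def by simp

lemma wdm_unique:
  fixes A A' :: "real^2 \<Rightarrow> real^'n^'m"
  assumes "wdm h A dA" "wdm h A' dA'" "AE x in lborel. x \<in> S \<longrightarrow> A x = A' x"
  shows "AE x in lborel. dA x = dA' x"
proof -
  have "AE x in lborel. \<forall>k p. dA x$k$p = dA' x$k$p"
  proof (intro eventually_all_finite allI)
    fix k p
    show "AE x in lborel. dA x$k$p = dA' x$k$p"
    proof (rule wd_unique)
      show "wd S h (\<lambda>x. A x$k$p) (\<lambda>x. dA x$k$p)" "wd S h (\<lambda>x. A' x$k$p) (\<lambda>x. dA' x$k$p)"
        using assms by (auto simp: wdm_def)
      show "AE x in lborel. x \<in> S \<longrightarrow> A x$k$p = A' x$k$p"
        using assms(3) by eventually_elim auto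
    qed
  qed
  then show ?thesis by eventually_elim (simp add: vec_eq_iff)
qed

lemma wdm_C1:
  assumes "\<And>k p. C1 (\<lambda>x. A x$k$p) (\<lambda>j x. dA j x$k$p)"
  shows "wdm (axis j 1) (\<lambda>x. indicator S x *\<^sub>R A x) (\<lambda>x. indicator S x *\<^sub>R dA j x)"
  unfolding wdm_def using C1_wd[OF assms] by simp

end

section \<open>Coefficients of the metric on the mid-plane\<close>

lemma continuous_on_lift: "continuous_on T lift"
proof -
  have eq: "lift x = (\<chi> i. if i = 1 then x$1 else if i = 2 then x$2 else 0)" for x
    by (auto simp: lift_def vec_eq_iff forall_3)
  have "continuous_on T (\<lambda>x. lift x)"
    unfolding eq
  proof (intro continuous_on_vec_lambda)
    fix i :: 3
    show "continuous_on T (\<lambda>x::real^2. if i = 1 then x$1 else if i = 2 then x$2 else 0)"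
      by (cases "i = 1"; cases "i = 2") (auto intro!: continuous_intros)
  qed
  then show ?thesis .
qed

lemma lift_axis: "lift (x + t *\<^sub>R axis j 1) = lift x + t *\<^sub>R axis (ix j) 1"
proof -
  have "j = 1 \<or> j = 2" using exhaust_2 by blast
  then show ?thesis by (auto simp: lift_def vec_eq_iff forall_3 axis_def ix_def)
qed

locale thin_metric = bounded_open +
  fixes G :: "real^3 \<Rightarrow> real^3^3"
  assumes metric: "smooth_metric_on (cyl S) G"
begin

lemma lift_cyl: "x \<in> S \<Longrightarrow> lift x \<in> cyl S"
proof -
  assume "x \<in> S"
  moreover have "vector [x$1, x$2] = x" by (simp add: vec_eq_iff forall_2)
  ultimately show "lift x \<in> cyl S" by (simp add: cyl_def lift_def)
qed

lemma lift_closure: "x \<in> closure S \<Longrightarrow> lift x \<in> closure (cyl S)"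
proof -
  have "lift ` closure S \<subseteq> closure (cyl S)"
  proof (rule image_closure_subset)
    show "lift ` S \<subseteq> closure (cyl S)" using lift_cyl closure_subset by blast
  qed (auto intro: continuous_on_lift)
  then show "x \<in> closure S \<Longrightarrow> lift x \<in> closure (cyl S)" by blast
qed

lemma Gbar_sym: "x \<in> closure S \<Longrightarrow> transpose (Gbar G x) = Gbar G x"
  and Gbar_pos: "x \<in> closure S \<Longrightarrow> \<forall>v. v \<noteq> 0 \<longrightarrow> v \<bullet> (Gbar G x *v v) > 0"
  using metric lift_closure unfolding smooth_metric_on_def Gbar_def by auto

lemma C1_G: "C1 (\<lambda>x. Gbar G x$p$q) (\<lambda>j x. pd (ix j) (\<lambda>z. G z$p$q) (lift x))"
proof -
  obtain U where U: "closure (cyl S) \<subseteq> U" "smooth_on U (\<lambda>z. G z$p$q)"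
    using metric unfolding smooth_metric_on_def by auto
  have c: "continuous_on U (iter_pd is (\<lambda>z. G z$p$q))" for "is" using U(2) unfolding smooth_on_def by blast
  have im: "lift ` closure S \<subseteq> U" using lift_closure U(1) by blast
  show ?thesis unfolding C1_def
  proof (intro conjI allI ballI)
    show "continuous_on (closure S) (\<lambda>x. Gbar G x$p$q)"
      using continuous_on_compose2[OF c[of "[]"] continuous_on_lift im] by (simp add: Gbar_def)
    show "continuous_on (closure S) (\<lambda>x. pd (ix j) (\<lambda>z. G z$p$q) (lift x))" for j
      using continuous_on_compose2[OF c[of "[ix j]"] continuous_on_lift im] by simp
    fix x j assume "x \<in> S"
    then have "lift x \<in> U" using im closure_subset by blast
    then have "(\<lambda>t. iter_pd [] (\<lambda>z. G z$p$q) (lift x + t *\<^sub>R axis (ix j) 1)) differentiable at 0"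
      using U(2) unfolding smooth_on_def by blast
    then have "((\<lambda>t. G (lift x + t *\<^sub>R axis (ix j) 1)$p$q) has_real_derivative pd (ix j) (\<lambda>z. G z$p$q) (lift x)) (at 0)"
      unfolding pd_def by (simp add: DERIV_deriv_iff_real_differentiable)
    then show "((\<lambda>t. Gbar G (x + t *\<^sub>R axis j 1)$p$q) has_real_derivative pd (ix j) (\<lambda>z. G z$p$q) (lift x)) (at 0)"
      by (simp add: Gbar_def lift_axis)
  qed
qed

text \<open>For auxiliary coefficients such as the shift, the lapse and \<open>Ghat_inv\<close> only
  the existence of derivatives matters: identities between products determine the derivatives that
  enter the estimate.\<close>

definition C1e :: "(real^2 \<Rightarrow> real) \<Rightarrow> bool" where "C1e f \<longleftrightarrow> (\<exists>d. C1 f d)"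

lemma C1e_intros:
  "C1e (\<lambda>x. Gbar G x$p$q)" "C1e (\<lambda>_. c)"
  "C1e f \<Longrightarrow> C1e g \<Longrightarrow> C1e (\<lambda>x. f x + g x)"
  "C1e f \<Longrightarrow> C1e g \<Longrightarrow> C1e (\<lambda>x. f x - g x)"
  "C1e f \<Longrightarrow> C1e g \<Longrightarrow> C1e (\<lambda>x. f x * g x)"
  unfolding C1e_def using C1_G C1_const C1_add C1_diff C1_mult by blast+

lemma C1e_inverse: "C1e f \<Longrightarrow> (\<And>x. x \<in> closure S \<Longrightarrow> f x > 0) \<Longrightarrow> C1e (\<lambda>x. inverse (f x))"
  unfolding C1e_def using C1_inverse by (metis less_irrefl)

lemma C1e_sqrt: "C1e f \<Longrightarrow> (\<And>x. x \<in> closure S \<Longrightarrow> f x > 0) \<Longrightarrow> C1e (\<lambda>x. sqrt (f x))"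
  unfolding C1e_def using C1_sqrt by metis

lemma C1e_gdet: "C1e (\<lambda>x. gdet (Gbar G x))"
  unfolding gdet_def by (intro C1e_intros)

lemma gdet_Gbar_pos: "x \<in> closure S \<Longrightarrow> gdet (Gbar G x) > 0"
  using gdet_pos[OF Gbar_sym Gbar_pos] by blast

lemma lapse_Gbar_pos: "x \<in> closure S \<Longrightarrow> lapse (Gbar G x) > 0"
  using lapse_pos[OF Gbar_sym Gbar_pos] by blast

lemma C1e_inverse_gdet: "C1e (\<lambda>x. inverse (gdet (Gbar G x)))"
  by (intro C1e_inverse C1e_gdet gdet_Gbar_pos)

lemma C1e_shift: "C1e (\<lambda>x. shift1 (Gbar G x))" "C1e (\<lambda>x. shift2 (Gbar G x))"
  unfolding shift1_def shift2_def divide_inverse by (intro C1e_intros C1e_inverse_gdet)+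

lemma C1e_lapse: "C1e (\<lambda>x. lapse (Gbar G x))"
  unfolding lapse_def by (intro C1e_intros C1e_shift)

lemma C1e_sqrt_lapse: "C1e (\<lambda>x. sqrt (lapse (Gbar G x)))"
  by (intro C1e_sqrt C1e_lapse lapse_Gbar_pos)

lemma C1e_inv_sqrt_gdet: "C1e (\<lambda>x. inverse (sqrt (gdet (Gbar G x))))"
  by (rule C1e_inverse[OF C1e_sqrt[OF C1e_gdet]]) (simp_all add: gdet_Gbar_pos)

lemma C1e_Ghat_inv: "C1e (\<lambda>x. Ghat_inv (Gbar G x)$p$q)"
proof -
  have m: "C1e (\<lambda>x. - f x)" if "C1e f" for f
    using C1e_intros(5)[OF C1e_intros(2)[of "-1"] that] by simp
  show ?thesis
    unfolding Ghat_inv_def by (cases "p = 3 \<or> q = 3"; cases "p = 1"; cases "q = 1"; cases "p = q")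
      (auto intro!: m C1e_intros C1e_inverse_gdet)
qed

definition dGhat :: "2 \<Rightarrow> real^2 \<Rightarrow> real^3^3" where
  "dGhat j x = (\<chi> p q. if p \<noteq> 3 \<and> q \<noteq> 3 then pd (ix j) (\<lambda>z. G z$p$q) (lift x) else 0)"

lemma C1_Ghat: "C1 (\<lambda>x. Ghat (Gbar G x)$p$q) (\<lambda>j x. dGhat j x$p$q)"
  unfolding Ghat_def dGhat_def by (cases "p \<noteq> 3 \<and> q \<noteq> 3") (use C1_G C1_const in auto)

end

section \<open>Frames of isometric immersions\<close>

lemma ix_simps [simp]: "ix 1 = 1" "ix 2 = 2" "ix i \<noteq> 3"
  by (auto simp: ix_def)

lemma L2_component:
  fixes F :: "real^2 \<Rightarrow> real^'n^'m"
  assumes "L2 S F"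
  shows "(\<lambda>x. F x$k$i) \<in> borel_measurable (restrict_space lebesgue S)"
    and "S \<in> sets borel \<Longrightarrow> set_integrable lebesgue S (\<lambda>x. (F x$k$i)\<^sup>2)"
proof -
  have F: "F \<in> borel_measurable (restrict_space lebesgue S)" "set_integrable lebesgue S (\<lambda>x. (norm (F x))\<^sup>2)"
    using assms by (auto simp: L2_def)
  have c: "(\<lambda>A::real^'n^'m. A$k$i) \<in> borel_measurable borel"
    by (intro borel_measurable_continuous_onI continuous_intros)
  show m: "(\<lambda>x. F x$k$i) \<in> borel_measurable (restrict_space lebesgue S)"
    by (rule measurable_compose[OF F(1) c])
  assume [measurable]: "S \<in> sets borel"
  then have S: "S \<inter> space lebesgue \<in> sets lebesgue" by simp
  show "set_integrable lebesgue S (\<lambda>x. (F x$k$i)\<^sup>2)"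
    unfolding set_integrable_def
  proof (rule Bochner_Integration.integrable_bound[OF F(2)[unfolded set_integrable_def]])
    have "(\<lambda>x. indicator S x *\<^sub>R F x$k$i) \<in> borel_measurable lebesgue"
      using m borel_measurable_restrict_space_iff[OF S, of "\<lambda>x. F x$k$i"] by simp
    then have "(\<lambda>x. (indicator S x *\<^sub>R F x$k$i)\<^sup>2) \<in> borel_measurable lebesgue" by simp
    moreover have "(\<lambda>x. (indicator S x *\<^sub>R F x$k$i)\<^sup>2) = (\<lambda>x. indicator S x *\<^sub>R (F x$k$i)\<^sup>2)"
      by (auto simp: indicator_def)
    ultimately show "(\<lambda>x. indicator S x *\<^sub>R (F x$k$i)\<^sup>2) \<in> borel_measurable lebesgue" by simp
    have "\<bar>F x$k$i\<bar> \<le> norm (F x)" for x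
      using component_le_norm_cart[of "F x$k" i] Finite_Cartesian_Product.norm_nth_le[of "F x" k] by linarith
    then have "(F x$k$i)\<^sup>2 \<le> (norm (F x))\<^sup>2" for x
      by (metis abs_ge_zero power2_abs power_mono)
    then show "AE x in lebesgue. norm (indicator S x *\<^sub>R (F x$k$i)\<^sup>2) \<le> norm (indicator S x *\<^sub>R (norm (F x))\<^sup>2)"
      by (intro AE_I2) (auto simp: indicator_def)
  qed
qed

lemma gram_entry:
  fixes D :: "real^'n^'m"
  shows "(transpose D ** D)$i$j = column i D \<bullet> column j D"
  by (simp add: matrix_matrix_mult_def transpose_def inner_vec_def column_def)

text \<open>By Lagrange's identity the squared length of the cross product of the tangent vectors is
  their Gram determinant \<open>gdet A\<close>. So the unit normal may be normalised by a function
  of the metric alone and is otherwise polynomial in \<open>D\<close>, which is what makes it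
  accessible to the product rule.\<close>

lemma frame_pointwise:
  fixes D :: "real^2^3" and M A :: "real^3^3"
  assumes A: "transpose A = A" "\<forall>v. v \<noteq> 0 \<longrightarrow> v \<bullet> (A *v v) > 0"
    and gram: "transpose D ** D = upper2 A"
    and M12: "\<And>k i. M$k$ix i = D$k$i"
    and M3: "\<And>k. M$k$3 = inverse (sqrt (gdet A)) * cross3 (column 1 D) (column 2 D) $ k"
  shows "column 3 M = (1 / norm (cross3 (column 1 D) (column 2 D))) *\<^sub>R cross3 (column 1 D) (column 2 D)"
    and "transpose M ** M = Ghat A" and "det M > 0"
proof -
  define c where "c = cross3 (column 1 D) (column 2 D)"
  have D0: "gdet A > 0" by (rule gdet_pos[OF A])
  have g: "column i D \<bullet> column j D = A$ix i$ix j" for i j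
    using gram_entry[of D i j] gram by (simp add: upper2_def)
  have s21: "A$2$1 = A$1$2" by (rule sym_entry[OF A])
  have "(norm c)\<^sup>2 = (norm (column 1 D))\<^sup>2 * (norm (column 2 D))\<^sup>2 - (column 1 D \<bullet> column 2 D)\<^sup>2"
    unfolding c_def by (rule norm_cross)
  also have "\<dots> = gdet A"
    unfolding power2_norm_eq_inner gdet_def using g[of 1 1] g[of 2 2] g[of 1 2]
    by (simp add: power2_eq_square)
  finally have nc: "norm c = sqrt (gdet A)" by (metis norm_ge_zero real_sqrt_abs abs_of_nonneg)
  have nc0: "norm c > 0" using nc D0 by simp
  have col3: "column 3 M = inverse (norm c) *\<^sub>R c"
    using M3[folded c_def] by (simp add: vec_eq_iff column_def nc)
  then show "column 3 M = (1 / norm (cross3 (column 1 D) (column 2 D))) *\<^sub>R cross3 (column 1 D) (column 2 D)"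
    by (simp add: c_def inverse_eq_divide)
  have col: "column (ix i) M = column i D" for i using M12 by (simp add: vec_eq_iff column_def)
  have c1: "column 1 M = column 1 D" and c2: "column 2 M = column 2 D" using col[of 1] col[of 2] by simp_all
  have perp: "column i D \<bullet> c = 0" "c \<bullet> column i D = 0" for i
    using exhaust_2[of i] by (auto simp: c_def dot_cross_self)
  have cc: "c \<bullet> c = norm c * norm c" by (simp add: dot_square_norm power2_eq_square)
  have "inverse (norm c) * (inverse (norm c) * (norm c * norm c)) = 1"
    using nc0 by (simp only: field_simps) simp
  then show "transpose M ** M = Ghat A"
    using g[of 1 1] g[of 1 2] g[of 2 1] g[of 2 2]
    by (simp add: vec_eq_iff forall_3 gram_entry c1 c2 col3 perp Ghat_def cc)
  have M3': "M$k$3 = inverse (norm c) * c$k" for k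
    using col3 by (simp add: vec_eq_iff column_def)
  have M1': "M$k$1 = D$k$1" "M$k$2 = D$k$2" for k using M12[of k 1] M12[of k 2] by simp_all
  have "det M = inverse (norm c) * (c \<bullet> c)"
    unfolding det_3 M3' M1' by (simp add: inner_vec_def sum_3 c_def cross3_def column_def algebra_simps)
  also have "\<dots> > 0" using nc0 by (simp add: cc)
  finally show "det M > 0" .
qed

context bounded_open
begin

definition wde :: "real^2 \<Rightarrow> (real^2 \<Rightarrow> real) \<Rightarrow> bool" where
  "wde h f \<longleftrightarrow> (\<exists>g. wd S h f g)"

lemma wde_intros:
  "wde h f \<Longrightarrow> wde h g \<Longrightarrow> wde h (\<lambda>x. f x + g x)"
  "wde h f \<Longrightarrow> wde h g \<Longrightarrow> wde h (\<lambda>x. f x - g x)"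
  "wde h f \<Longrightarrow> wde h g \<Longrightarrow> wde h (\<lambda>x. f x * g x)"
  unfolding wde_def using wd_add wd_diff wd_mult by blast+

end

context thin_metric
begin

lemma wde_C1e: "C1e f \<Longrightarrow> wde (axis j 1) (\<lambda>x. indicator S x * f x)"
  unfolding C1e_def wde_def using C1_wd by blast

text \<open>Besides the frame itself this records the two structural relations of its derivatives
  that later determine the connection: symmetry of the second derivatives of the immersion, and the
  differentiated Gram identity.\<close>

definition frame :: "(real^2 \<Rightarrow> real^2^3) \<Rightarrow> (real^2 \<Rightarrow> real^3^3) \<Rightarrow> (2 \<Rightarrow> real^2 \<Rightarrow> real^3^3) \<Rightarrow> bool" where
  "frame Dy M dM \<longleftrightarrow> (\<forall>j. wdm (axis j 1) M (dM j)) \<and> (AE x in lborel. x \<in> S \<longrightarrow>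
     (\<forall>k i. M x$k$ix i = Dy x$k$i) \<and> column 3 (M x) = unit_normal Dy x \<and>
     transpose (M x) ** M x = Ghat (Gbar G x) \<and> det (M x) > 0 \<and>
     (\<forall>k i j. dM j x$k$ix i = dM i x$k$ix j) \<and>
     (\<forall>j. transpose (dM j x) ** M x + transpose (M x) ** dM j x = dGhat j x))"

text \<open>A diagonal entry of the Gram matrix is the squared length of a column. The bound is
  common to all isometric immersions and puts \<open>Dy\<close> among the bounded functions.\<close>

lemma isometry_entry_bound:
  "\<exists>N>0. \<forall>x\<in>closure S. \<forall>D::real^2^3. transpose D ** D = upper2 (Gbar G x) \<longrightarrow> (\<forall>k i. \<bar>D$k$i\<bar> \<le> N)"
proof -
  have cG: "continuous_on (closure S) (\<lambda>x. Gbar G x$p$q)" for p q using C1_G[of p q] by (simp add: C1_def)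
  obtain N1 where N1: "N1 > 0" "\<forall>x\<in>closure S. \<bar>Gbar G x$1$1\<bar> \<le> N1" using C1_bounded[OF cG] by blast
  obtain N2 where N2: "N2 > 0" "\<forall>x\<in>closure S. \<bar>Gbar G x$2$2\<bar> \<le> N2" using C1_bounded[OF cG] by blast
  \<comment> \<open>The summand 1 gives N \<ge> 1, so that the bound N for the squared entries is at
    most \<open>N\<^sup>2\<close>.\<close>
  define N where "N = N1 + N2 + 1"
  have N1': "N \<ge> 1" using N1 N2 by (simp add: N_def)
  show ?thesis
  proof (intro exI[of _ N] conjI ballI allI impI)
    show "N > 0" using N1' by simp
    fix x and D :: "real^2^3" and k i
    assume x: "x \<in> closure S" and D: "transpose D ** D = upper2 (Gbar G x)"
    have "(D$k$i)\<^sup>2 \<le> (\<Sum>k\<in>UNIV. (D$k$i)\<^sup>2)" by (rule member_le_sum) auto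
    also have "\<dots> = (transpose D ** D)$i$i"
      by (simp add: matrix_matrix_mult_def transpose_def power2_eq_square)
    also have "\<dots> = Gbar G x$ix i$ix i" by (simp add: D upper2_def)
    also have "\<dots> \<le> N"
    proof -
      have "Gbar G x$1$1 \<le> N1" "Gbar G x$2$2 \<le> N2" using N1 N2 x by (auto dest: bspec)
      then show ?thesis using exhaust_2[of i] N1 N2 by (auto simp: N_def)
    qed
    also have "\<dots> \<le> N\<^sup>2" using N1' by (simp add: power2_eq_square)
    finally show "\<bar>D$k$i\<bar> \<le> N" using N1' by (simp add: abs_le_square_iff[symmetric])
  qed
qed

lemma frame_exists:
  assumes W: "W22 S y Dy"
    and iso: "AE x in lebesgue. x \<in> S \<longrightarrow> transpose (Dy x) ** Dy x = upper2 (Gbar G x)"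
  shows "\<exists>M dM. frame Dy M dM"
proof -
  have iso': "AE x in lborel. x \<in> S \<longrightarrow> transpose (Dy x) ** Dy x = upper2 (Gbar G x)"
    using iso by (simp add: AE_completion_iff)
  have L2D: "L2 S Dy" and wy: "\<And>k j. weak_pd S (\<lambda>x. y x$k) j (\<lambda>x. Dy x$k$j)"
    using W unfolding W22_def weak_jacobian_def by auto
  obtain H where H: "\<And>j. L2 S (H j)" "\<And>i k j. weak_pd S (\<lambda>x. Dy x$k$i) j (\<lambda>x. H i x$k$j)"
  proof -
    obtain H where "\<forall>j. (\<forall>k i. weak_pd S (\<lambda>x. column j (Dy x)$k) i (\<lambda>x. H j x$k$i)) \<and> L2 S (H j)"
      using W unfolding W22_def weak_jacobian_def by blast
    then show thesis by (intro that[of H]) (auto simp: column_def)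
  qed
  obtain N where N: "N > 0" "\<forall>x\<in>closure S. \<forall>D::real^2^3. transpose D ** D = upper2 (Gbar G x) \<longrightarrow> (\<forall>k i. \<bar>D$k$i\<bar> \<le> N)"
    using isometry_entry_bound by blast
  have bd: "AE x in lborel. x \<in> S \<longrightarrow> \<bar>Dy x$k$i\<bar> \<le> N" for k i
    using iso' by eventually_elim (use N closure_subset in blast)
  have ex: "\<exists>f'. f' \<in> borel_measurable borel \<and> (\<forall>x. x \<notin> S \<longrightarrow> f' x = 0) \<and> (\<forall>x. \<bar>f' x\<bar> \<le> N) \<and>
      (AE x in lborel. x \<in> S \<longrightarrow> f' x = Dy x$k$i)" for i k
  proof -
    obtain f where f[measurable]: "f \<in> borel_measurable borel" "\<forall>x. x \<notin> S \<longrightarrow> f x = 0"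
      "AE x in lborel. x \<in> S \<longrightarrow> f x = Dy x$k$i"
      using borel_representative[OF L2_component(1)[OF L2D]] by blast
    show ?thesis
    \<comment> \<open>Truncation at the bound N changes the representative only on a null set of
      \<open>S\<close> and makes it bounded at every point.\<close>
    proof (intro exI[of _ "\<lambda>x. max (- N) (min N (f x))"] conjI)
      show "AE x in lborel. x \<in> S \<longrightarrow> max (- N) (min N (f x)) = Dy x$k$i"
        using f(3) bd[of k i] by eventually_elim (auto simp: abs_le_iff min_def max_def)
    qed (use f N in \<open>auto simp: abs_le_iff\<close>)
  qed
  define a where "a i k = (SOME f'. f' \<in> borel_measurable borel \<and> (\<forall>x. x \<notin> S \<longrightarrow> f' x = 0) \<and> (\<forall>x. \<bar>f' x\<bar> \<le> N) \<and>
      (AE x in lborel. x \<in> S \<longrightarrow> f' x = Dy x$k$i))" for i k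
  have a: "a i k \<in> borel_measurable borel" "x \<notin> S \<Longrightarrow> a i k x = 0"
      "\<bar>a i k x\<bar> \<le> N" "AE x in lborel. x \<in> S \<longrightarrow> a i k x = Dy x$k$i" for i k x
    using someI_ex[OF ex[of k i]] unfolding a_def[symmetric] by auto
  have wa: "wde (axis j 1) (a i k)" for i j k
  proof -
    have bd': "AE x in lebesgue. x \<in> S \<longrightarrow> \<bar>Dy x$k$i\<bar> \<le> N" using bd by (simp add: AE_completion_iff)
    have "\<exists>g'. wd S (axis j 1) (a i k) g' \<and> (AE x in lborel. x \<in> S \<longrightarrow> g' x = H i x$k$j)"
      by (rule wd_of_weak_pd[OF H(2) L2_component(1)[OF L2D] L2_component(1)[OF H(1)] bd'
            L2_component(2)[OF H(1) borel_S] a(1) a(2) a(3) a(4)])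
    then show ?thesis unfolding wde_def by auto
  qed
  define c where "c x = cross3 (\<chi> k. a 1 k x) (\<chi> k. a 2 k x)" for x
  \<comment> \<open>The third column is the cross product times a metric coefficient, so it has weak
    derivatives by the product rule; the indicator makes the coefficient vanish outside the
    domain.\<close>
  define M :: "real^2 \<Rightarrow> real^3^3" where "M x = (\<chi> k p. if p = 1 then a 1 k x else if p = 2 then a 2 k x
      else (indicator S x * inverse (sqrt (gdet (Gbar G x)))) * c x$k)" for x
  have "wde (axis j 1) (\<lambda>x. M x$k$p)" for j k p
  proof -
    have "wde (axis j 1) (\<lambda>x. c x$k)"
      using exhaust_3[of k] by (auto simp: c_def cross3_def intro!: wde_intros wa)
    then have "wde (axis j 1) (\<lambda>x. (indicator S x * inverse (sqrt (gdet (Gbar G x)))) * c x$k)"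
      by (intro wde_intros wde_C1e C1e_inv_sqrt_gdet)
    then show ?thesis unfolding M_def using wa by (cases "p = 1"; cases "p = 2") simp_all
  qed
  then have "\<exists>g. wd S (axis j 1) (\<lambda>x. M x$k$p) g" for j k p unfolding wde_def by simp
  then obtain g where g: "\<And>j k p. wd S (axis j 1) (\<lambda>x. M x$k$p) (g j k p)" by metis
  define dM :: "2 \<Rightarrow> real^2 \<Rightarrow> real^3^3" where "dM j x = (\<chi> k p. g j k p x)" for j x
  have wM: "wdm (axis j 1) M (dM j)" for j unfolding wdm_def using g by (simp add: dM_def)
  have Ma: "M x$k$ix i = a i k x" for x k i
    using exhaust_2[of i] by (auto simp: M_def)
  have E1: "AE x in lborel. x \<in> S \<longrightarrow> (\<forall>k i. M x$k$ix i = Dy x$k$i)"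
  proof -
    have "AE x in lborel. \<forall>k i. x \<in> S \<longrightarrow> a i k x = Dy x$k$i"
      by (intro eventually_all_finite allI a(4))
    then show ?thesis by eventually_elim (simp add: Ma)
  qed
  have E2: "AE x in lborel. x \<in> S \<longrightarrow> column 3 (M x) = unit_normal Dy x \<and>
     transpose (M x) ** M x = Ghat (Gbar G x) \<and> det (M x) > 0"
    using E1 iso'
  proof eventually_elim
    case (elim x)
    show ?case
    proof
      assume x: "x \<in> S"
      then have xc: "x \<in> closure S" using closure_subset by blast
      have "(\<chi> k. a i k x) = column i (Dy x)" for i
        using elim x Ma[of x _ i] by (simp add: vec_eq_iff column_def)
      then have m3: "M x$k$3 = inverse (sqrt (gdet (Gbar G x))) * cross3 (column 1 (Dy x)) (column 2 (Dy x)) $ k" for k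
        using x by (simp add: M_def c_def)
      have gr: "transpose (Dy x) ** Dy x = upper2 (Gbar G x)" using elim x by blast
      have m12: "M x$k$ix i = Dy x$k$i" for k i using elim x by blast
      from frame_pointwise[OF Gbar_sym[OF xc] Gbar_pos[OF xc] gr m12 m3]
      show "column 3 (M x) = unit_normal Dy x \<and> transpose (M x) ** M x = Ghat (Gbar G x) \<and> det (M x) > 0"
        by (simp add: unit_normal_def Let_def)
    qed
  qed
  \<comment> \<open>The derivatives of the frame agree almost everywhere with the given second
    derivatives \<open>H\<close>, and those are symmetric.\<close>
  have E3: "AE x in lborel. x \<in> S \<longrightarrow> (\<forall>k i j. dM j x$k$ix i = dM i x$k$ix j)"
  proof -
    have h: "AE x in lborel. x \<in> S \<longrightarrow> H i x$k$j = dM j x$k$ix i" for k i j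
    proof (rule weak_pd_unique[OF H(2)[of k i j]])
      show "wd S (axis j 1) (\<lambda>x. M x$k$ix i) (\<lambda>x. dM j x$k$ix i)" using wM[of j] by (simp add: wdm_def)
      show "AE x in lborel. x \<in> S \<longrightarrow> M x$k$ix i = Dy x$k$i" using E1 by eventually_elim auto
    qed
    have s: "AE x in lborel. x \<in> S \<longrightarrow> H i x$k$j = H j x$k$i" for k i j
      by (rule weak_second_derivatives_commute[where d="\<lambda>i x. Dy x$k$i", OF wy wy H(2) H(2)])
    have "AE x in lborel. \<forall>k i j. x \<in> S \<longrightarrow> dM j x$k$ix i = dM i x$k$ix j"
    proof (intro eventually_all_finite allI)
      fix k i j
      show "AE x in lborel. x \<in> S \<longrightarrow> dM j x$k$ix i = dM i x$k$ix j"
        using h[of i k j] h[of j k i] s[of i k j] by eventually_elim auto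
    qed
    then show ?thesis by eventually_elim auto
  qed
  \<comment> \<open>The Gram identity is differentiated: the product rule on one side, the smooth
    matrix field \<open>Ghat\<close> on the other, and uniqueness of weak derivatives.\<close>
  have E4: "AE x in lborel. x \<in> S \<longrightarrow> (\<forall>j. transpose (dM j x) ** M x + transpose (M x) ** dM j x = dGhat j x)"
  proof -
    have "AE x in lborel. \<forall>j. transpose (dM j x) ** M x + transpose (M x) ** dM j x = indicator S x *\<^sub>R dGhat j x"
    proof (intro eventually_all_finite)
      fix j
      show "AE x in lborel. transpose (dM j x) ** M x + transpose (M x) ** dM j x = indicator S x *\<^sub>R dGhat j x"
      proof (rule wdm_unique)
        show "wdm (axis j 1) (\<lambda>x. transpose (M x) ** M x) (\<lambda>x. transpose (dM j x) ** M x + transpose (M x) ** dM j x)"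
          by (intro wdm_mult wdm_transpose wM)
        show "wdm (axis j 1) (\<lambda>x. indicator S x *\<^sub>R Ghat (Gbar G x)) (\<lambda>x. indicator S x *\<^sub>R dGhat j x)"
          by (rule wdm_C1[OF C1_Ghat])
        show "AE x in lborel. x \<in> S \<longrightarrow> transpose (M x) ** M x = indicator S x *\<^sub>R Ghat (Gbar G x)"
          using E2 by eventually_elim auto
      qed
    qed
    then show ?thesis by eventually_elim auto
  qed
  have "AE x in lborel. x \<in> S \<longrightarrow>
     (\<forall>k i. M x$k$ix i = Dy x$k$i) \<and> column 3 (M x) = unit_normal Dy x \<and>
     transpose (M x) ** M x = Ghat (Gbar G x) \<and> det (M x) > 0 \<and>
     (\<forall>k i j. dM j x$k$ix i = dM i x$k$ix j) \<and>
     (\<forall>j. transpose (dM j x) ** M x + transpose (M x) ** dM j x = dGhat j x)"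
    using E1 E2 E3 E4 by eventually_elim simp
  then have "frame Dy M dM" unfolding frame_def using wM by simp
  then show ?thesis by blast
qed

end

section \<open>The rotation between two frames and its derivative\<close>

lemma matrix_entry_bound:
  fixes A B :: "real^3^3"
  assumes "\<And>i j. \<bar>A$i$j\<bar> \<le> a" "\<And>i j. \<bar>B$i$j\<bar> \<le> b"
  shows "\<bar>(A ** B)$i$j\<bar> \<le> 3 * (a * b)"
proof -
  have "\<bar>(A ** B)$i$j\<bar> \<le> (\<Sum>k\<in>UNIV. \<bar>A$i$k * B$k$j\<bar>)"
    unfolding matrix_matrix_mult_def by simp
  also have "\<dots> \<le> (\<Sum>k\<in>(UNIV::3 set). a * b)"
    unfolding abs_mult using assms abs_ge_zero order_trans by (intro sum_mono mult_mono) blast+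
  finally show ?thesis by simp
qed

lemma norm_matrix_square:
  fixes A :: "real^'n^'m"
  shows "(norm A)\<^sup>2 = (\<Sum>k\<in>UNIV. \<Sum>i\<in>UNIV. (A$k$i)\<^sup>2)"
  unfolding power2_norm_eq_inner inner_vec_def by (simp add: power2_eq_square)

lemma gram_invertible:
  fixes M Gh Gi :: "real^3^3"
  assumes "transpose M ** M = Gh" "Gh ** Gi = mat 1"
  shows "(M ** Gi) ** transpose M = mat 1" "Gi ** Gh = mat 1"
proof -
  have "transpose M ** (M ** Gi) = mat 1" using assms by (simp add: matrix_mul_assoc)
  then show "(M ** Gi) ** transpose M = mat 1" by (simp add: matrix_left_right_inverse)
  show "Gi ** Gh = mat 1" using assms(2) by (simp add: matrix_left_right_inverse)
qed

lemma rotation_maps_frame: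
  fixes M M0 Gh Gi :: "real^3^3"
  assumes "transpose M ** M = Gh" "transpose M0 ** M0 = Gh" "Gh ** Gi = mat 1"
  shows "(M ** Gi ** transpose M0) ** M0 = M"
  using gram_invertible(2)[OF assms(1,3)] assms(2) by (simp add: matrix_mul_assoc[symmetric])

text \<open>\<open>R\<close> carries one frame to another with the same Gram matrix, so it preserves
  inner products of a basis and is orthogonal; equal orientation of the frames excludes determinant
  -1.\<close>

lemma rotation_SO3:
  fixes M M0 Gh Gi :: "real^3^3"
  assumes g: "transpose M ** M = Gh" "transpose M0 ** M0 = Gh" "Gh ** Gi = mat 1"
    and d: "det M > 0" "det M0 > 0"
  shows "M ** Gi ** transpose M0 \<in> SO3"
proof -
  define R where "R = M ** Gi ** transpose M0"
  have RM: "R ** M0 = M" unfolding R_def by (rule rotation_maps_frame[OF g])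
  obtain N where N: "M0 ** N = mat 1" using d(2) invertible_det_nz[of M0] by (auto simp: invertible_def)
  have "transpose M0 ** (transpose R ** R) ** M0 = transpose M0 ** M0"
    using RM g by (metis matrix_mul_assoc matrix_transpose_mul)
  then have "transpose N ** transpose M0 ** (transpose R ** R) ** (M0 ** N) = transpose N ** transpose M0 ** (M0 ** N)"
    by (metis matrix_mul_assoc)
  moreover have "transpose N ** transpose M0 = mat 1"
    using N by (metis matrix_transpose_mul transpose_mat)
  ultimately have RR: "transpose R ** R = mat 1" using N by simp
  then have "R ** transpose R = mat 1" by (simp add: matrix_left_right_inverse)
  then have o: "orthogonal_matrix R" using RR by (simp add: orthogonal_matrix_def)
  have "det R * det M0 = det M" using RM det_mul by metis
  then have "det R > 0" using d by (metis zero_less_mult_pos2)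
  moreover have "det R = 1 \<or> det R = - 1" using o by (rule det_orthogonal_matrix)
  ultimately show ?thesis using o by (auto simp: SO3_def R_def)
qed

text \<open>Multiplying the differentiated identity by the transpose of \<open>M\<close> turns its
  second term into the connection matrix of \<open>M0\<close>. What remains is
  \<open>transpose M ** K ** M0\<close>, and the outer factors have the explicit inverses
  \<open>M ** Gi\<close> and \<open>Gi ** transpose M0\<close>.\<close>

lemma rotation_derivative:
  fixes M M0 Gh Gi K dM dM0 :: "real^3^3"
  assumes g: "transpose M ** M = Gh" "transpose M0 ** M0 = Gh" "Gh ** Gi = mat 1"
    and K: "K ** M0 + (M ** Gi ** transpose M0) ** dM0 = dM"
  shows "K = M ** Gi ** (transpose M ** dM - transpose M0 ** dM0) ** Gi ** transpose M0"
proof -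
  have "transpose M ** dM = transpose M ** K ** M0 + (Gh ** Gi) ** (transpose M0 ** dM0)"
    unfolding K[symmetric] g(1)[symmetric] by (simp add: matrix_add_ldistrib matrix_mul_assoc)
  then have "transpose M ** dM - transpose M0 ** dM0 = transpose M ** K ** M0" by (simp add: g(3))
  moreover have "M ** Gi ** (transpose M ** K ** M0) ** Gi ** transpose M0
      = ((M ** Gi) ** transpose M) ** K ** ((M0 ** Gi) ** transpose M0)"
    by (simp add: matrix_mul_assoc)
  ultimately show ?thesis
    using gram_invertible(1)[OF g(1,3)] gram_invertible(1)[OF g(2,3)] by simp
qed

text \<open>The computation behind the Levi-Civita connection: with torsion-freeness
  \<open>c\<close>, the compatibility relation \<open>s\<close> at three permutations of the indices
  is a linear system that isolates one coefficient.\<close>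

lemma koszul:
  fixes A d :: "2 \<Rightarrow> real^3^3"
  assumes s: "\<And>j p q. A j$q$p + A j$p$q = d j$p$q" and c: "\<And>p i j. A j$p$ix i = A i$p$ix j"
  shows "A j$ix k$ix i = 1/2 * (d j$ix k$ix i + d i$ix k$ix j - d k$ix i$ix j)"
  using s[of j "ix i" "ix k"] s[of i "ix j" "ix k"] s[of k "ix j" "ix i"]
    c[of j "ix k" i] c[of j "ix i" k] c[of i "ix j" k] by simp

lemma ix_cases: "p = 3 \<or> (\<exists>i. p = ix i)"
  using exhaust_3[of p] ix_simps by metis

section \<open>Connection coefficients and fundamental forms\<close>

context thin_metric
begin

text \<open>The entry (p, q) is the inner product of the frame vector p with the derivative of the
  frame vector q in direction j.\<close>

definition conn :: "real^3^3 \<Rightarrow> (2 \<Rightarrow> real^3^3) \<Rightarrow> 2 \<Rightarrow> real^3^3" where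
  "conn m d j = transpose m ** d j"

lemma conn_relations:
  assumes c: "\<forall>k i j. d j$k$ix i = d i$k$ix j"
    and g: "\<forall>j. transpose (d j) ** m + transpose m ** d j = dGhat j x"
  shows "conn m d j$q$p + conn m d j$p$q = dGhat j x$p$q"
    and "conn m d j$p$ix i = conn m d i$p$ix j"
proof -
  have "(transpose (d j) ** m + transpose m ** d j)$p$q = dGhat j x$p$q" using g by simp
  moreover have "(transpose (d j) ** m)$p$q = conn m d j$q$p"
    by (simp add: conn_def matrix_matrix_mult_def transpose_def mult.commute)
  ultimately show "conn m d j$q$p + conn m d j$p$q = dGhat j x$p$q"
    by (simp add: conn_def)
  show "conn m d j$p$ix i = conn m d i$p$ix j"
    using c by (simp add: conn_def matrix_matrix_mult_def)
qed

text \<open>The Christoffel symbol of the first kind of the three-dimensional metric on the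
  mid-plane, with two tangential indices and an arbitrary third one.\<close>

definition chris :: "3 \<Rightarrow> 2 \<Rightarrow> 2 \<Rightarrow> real^2 \<Rightarrow> real" where
  "chris m i j x = 1/2 * (pd (ix j) (\<lambda>z. G z$m$ix i) (lift x) + pd (ix i) (\<lambda>z. G z$m$ix j) (lift x)
      - pd m (\<lambda>z. G z$ix i$ix j) (lift x))"

text \<open>The weights (-shift1, -shift2, 1) are \<open>lapse\<close> times the third row of the
  inverse metric, so this is \<open>lapse\<close> times the Christoffel symbol with upper index
  3.\<close>

definition chris_normal :: "2 \<Rightarrow> 2 \<Rightarrow> real^2 \<Rightarrow> real" where
  "chris_normal i j x = chris 3 i j x - shift1 (Gbar G x) * chris 1 i j x - shift2 (Gbar G x) * chris 2 i j x"

text \<open>The right-hand side involves the metric only, so the tangential entries coincide for any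
  two frames and drop out of their difference.\<close>

lemma conn_tangential:
  assumes c: "\<forall>k i j. d j$k$ix i = d i$k$ix j"
    and g: "\<forall>j. transpose (d j) ** m + transpose m ** d j = dGhat j x"
  shows "conn m d j$ix k$ix i = chris (ix k) i j x"
  using koszul[of "conn m d" "\<lambda>j. dGhat j x" j k i] conn_relations[OF c g]
  by (simp add: dGhat_def chris_def)

lemma conn_normal:
  assumes c: "\<forall>k i j. d j$k$ix i = d i$k$ix j"
    and g: "\<forall>j. transpose (d j) ** m + transpose m ** d j = dGhat j x"
  shows "conn m d j$3$ix i = - conn m d j$ix i$3" "conn m d j$3$3 = 0"
  using conn_relations(1)[OF c g, of j "ix i" 3] conn_relations(1)[OF c g, of j 3 3]
  by (simp_all add: dGhat_def)

lemma Gamma_3: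
  assumes x: "x \<in> S"
  shows "Gamma G 3 (ix i) (ix j) (lift x) = chris_normal i j x / lapse (Gbar G x)"
proof -
  have xc: "x \<in> closure S" using x closure_subset by blast
  note inv = matrix_inv_row3[OF Gbar_sym[OF xc] Gbar_pos[OF xc]]
  have "Gamma G 3 (ix i) (ix j) (lift x) = (\<Sum>m\<in>UNIV. matrix_inv (Gbar G x)$3$m * chris m i j x)"
    by (simp add: Gamma_def chris_def Gbar_def sum_distrib_left mult_ac)
  also have "\<dots> = chris_normal i j x / lapse (Gbar G x)"
    by (simp add: sum_3 inv chris_normal_def diff_divide_distrib)
  finally show ?thesis .
qed

text \<open>The inverse metric has (3,3) entry 1/\<open>lapse\<close>, so the prescribed second
  fundamental form is - \<open>chris_normal\<close> divided by the square root of
  \<open>lapse\<close>. In this form it says that the strain of the reference immersion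
  vanishes.\<close>

lemma reference_second_form:
  assumes f: "frame Dy M dM" and n: "weak_jacobian S (unit_normal Dy) Dn"
    and P: "AE x in lebesgue. x \<in> S \<longrightarrow> transpose (Dy x) ** Dn x =
            (- 1 / sqrt (matrix_inv (Gbar G x) $ 3 $ 3)) *\<^sub>R (\<chi> i j. Gamma G 3 (ix i) (ix j) (lift x))"
  shows "AE x in lborel. x \<in> S \<longrightarrow> (\<forall>i j. sqrt (lapse (Gbar G x)) * conn (M x) (\<lambda>j. dM j x) j$ix i$3 = - chris_normal i j x)"
proof -
  have f1: "wdm (axis j 1) M (dM j)" for j using f by (simp add: frame_def)
  have f2: "AE x in lborel. x \<in> S \<longrightarrow> (\<forall>k i. M x$k$ix i = Dy x$k$i) \<and> column 3 (M x) = unit_normal Dy x"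
    using f unfolding frame_def by (auto elim: eventually_mono)
  have "AE x in lborel. \<forall>k j. x \<in> S \<longrightarrow> Dn x$k$j = dM j x$k$3"
  proof (intro eventually_all_finite allI)
    fix k j
    show "AE x in lborel. x \<in> S \<longrightarrow> Dn x$k$j = dM j x$k$3"
    proof (rule weak_pd_unique)
      show "weak_pd S (\<lambda>x. unit_normal Dy x$k) j (\<lambda>x. Dn x$k$j)" using n by (simp add: weak_jacobian_def)
      show "wd S (axis j 1) (\<lambda>x. M x$k$3) (\<lambda>x. dM j x$k$3)" using f1[of j] by (simp add: wdm_def)
      show "AE x in lborel. x \<in> S \<longrightarrow> M x$k$3 = unit_normal Dy x$k"
        using f2 by eventually_elim (metis column_def vec_lambda_beta)
    qed
  qed
  moreover have "AE x in lborel. x \<in> S \<longrightarrow> transpose (Dy x) ** Dn x =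
            (- 1 / sqrt (matrix_inv (Gbar G x) $ 3 $ 3)) *\<^sub>R (\<chi> i j. Gamma G 3 (ix i) (ix j) (lift x))"
    using P by (simp add: AE_completion_iff)
  ultimately show ?thesis using f2
  proof eventually_elim
    case (elim x)
    show ?case
    proof (intro impI allI)
      fix i j assume x: "x \<in> S"
      then have xc: "x \<in> closure S" using closure_subset by blast
      define l where "l = lapse (Gbar G x)"
      have l: "l > 0" unfolding l_def by (rule lapse_Gbar_pos[OF xc])
      have "conn (M x) (\<lambda>j. dM j x) j$ix i$3 = (transpose (Dy x) ** Dn x)$i$j"
      proof -
        have "M x$k$ix i = Dy x$k$i" "Dn x$k$j = dM j x$k$3" for k using elim x by blast+
        then show ?thesis by (simp add: conn_def matrix_matrix_mult_def transpose_def)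
      qed
      also have "\<dots> = (- 1 / sqrt (1 / l)) * (chris_normal i j x / l)"
      proof -
        have "transpose (Dy x) ** Dn x = (- 1 / sqrt (1 / l)) *\<^sub>R (\<chi> i j. Gamma G 3 (ix i) (ix j) (lift x))"
          using elim x matrix_inv_row3(3)[OF Gbar_sym[OF xc] Gbar_pos[OF xc]] by (simp add: l_def)
        then show ?thesis using Gamma_3[OF x, of i j] by (simp add: l_def)
      qed
      also have "\<dots> = - sqrt l * (chris_normal i j x / l)"
        by (simp add: real_sqrt_divide)
      finally have "sqrt l * conn (M x) (\<lambda>j. dM j x) j$ix i$3 = - (sqrt l * sqrt l) * (chris_normal i j x / l)" by simp
      then show "sqrt (lapse (Gbar G x)) * conn (M x) (\<lambda>j. dM j x) j$ix i$3 = - chris_normal i j x"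
        using l by (simp add: l_def)
    qed
  qed
qed

text \<open>The Cosserat field b satisfies \<open>\<partial>\<close>_i y . b = G_3i. Differentiation
  in direction j expresses \<open>\<partial>\<close>_i y . \<open>\<partial>\<close>_j b by the
  derivative of G_3i and by the inner product of b with the second derivative of y. After
  symmetrisation the metric terms combine to Christoffel symbols, and only the second fundamental
  form still depends on y.\<close>

lemma cosserat_energy:
  assumes f: "frame Dy M dM" and b: "weak_jacobian S (cosserat G Dy) Db"
  shows "AE x in lborel. x \<in> S \<longrightarrow> (\<forall>i j. (symm (transpose (Dy x) ** Db x) - (1/2) *\<^sub>R d3G2 G x)$i$j
     = chris_normal i j x + sqrt (lapse (Gbar G x)) * conn (M x) (\<lambda>j. dM j x) j$ix i$3)"
proof -
  have f1: "wdm (axis j 1) M (dM j)" for j using f by (simp add: frame_def)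
  note f2 = f[unfolded frame_def, THEN conjunct2]
  \<comment> \<open>The Cosserat field expanded in the frame, with C1 coefficients, so that the
    product rule applies to it.\<close>
  define \<beta> where "\<beta> k x = (indicator S x * shift1 (Gbar G x)) * M x$k$1 + (indicator S x * shift2 (Gbar G x)) * M x$k$2
     + (indicator S x * sqrt (lapse (Gbar G x))) * M x$k$3" for k x
  have "wde (axis j 1) (\<lambda>x. M x$k$p)" for j k p using f1[of j] by (auto simp: wde_def wdm_def)
  then have "wde (axis j 1) (\<beta> k)" for j k
    unfolding \<beta>_def[abs_def] by (intro wde_intros wde_C1e C1e_shift C1e_sqrt_lapse)
  then have "\<exists>g. wd S (axis j 1) (\<beta> k) g" for j k by (simp add: wde_def)
  then obtain d where d: "\<And>j k. wd S (axis j 1) (\<beta> k) (d j k)" by metis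
  have cos: "AE x in lborel. x \<in> S \<longrightarrow> (\<forall>k. \<beta> k x = cosserat G Dy x$k)"
    using f2
  proof eventually_elim
    case (elim x)
    show ?case
    proof (intro impI allI)
      fix k assume x: "x \<in> S"
      then have xc: "x \<in> closure S" using closure_subset by blast
      note A = Gbar_sym[OF xc] Gbar_pos[OF xc]
      have m: "M x$k$1 = Dy x$k$1" "M x$k$2 = Dy x$k$2" "M x$k$3 = unit_normal Dy x$k"
        using elim x ix_simps(1,2) by (metis, metis, metis column_def vec_lambda_beta)
      have "det (Gbar G x) / det (upper2 (Gbar G x)) = lapse (Gbar G x)"
        using det_eq_gdet_lapse[OF A] det_upper2[OF A] gdet_pos[OF A] by simp
      then have "cosserat G Dy x = Dy x *v vector [shift1 (Gbar G x), shift2 (Gbar G x)]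
          + sqrt (lapse (Gbar G x)) *\<^sub>R unit_normal Dy x"
        by (simp only: cosserat_def matrix_inv_upper2[OF A])
      then show "\<beta> k x = cosserat G Dy x$k"
        using x by (simp add: \<beta>_def m matrix_vector_mult_def sum_2 mult.commute)
    qed
  qed
  have db: "AE x in lborel. \<forall>k j. x \<in> S \<longrightarrow> Db x$k$j = d j k x"
  proof (intro eventually_all_finite allI)
    fix k j
    show "AE x in lborel. x \<in> S \<longrightarrow> Db x$k$j = d j k x"
    proof (rule weak_pd_unique[OF _ d])
      show "weak_pd S (\<lambda>x. cosserat G Dy x$k) j (\<lambda>x. Db x$k$j)" using b by (simp add: weak_jacobian_def)
      show "AE x in lborel. x \<in> S \<longrightarrow> \<beta> k x = cosserat G Dy x$k" using cos by eventually_elim auto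
    qed
  qed
  have prod: "AE x in lborel. \<forall>i j. (\<Sum>k\<in>UNIV. dM j x$k$ix i * \<beta> k x + M x$k$ix i * d j k x)
      = indicator S x * pd (ix j) (\<lambda>z. G z$3$ix i) (lift x)"
  proof (intro eventually_all_finite allI)
    fix i j
    show "AE x in lborel. (\<Sum>k\<in>UNIV. dM j x$k$ix i * \<beta> k x + M x$k$ix i * d j k x)
      = indicator S x * pd (ix j) (\<lambda>z. G z$3$ix i) (lift x)"
    proof (rule wd_unique)
      show "wd S (axis j 1) (\<lambda>x. \<Sum>k\<in>UNIV. M x$k$ix i * \<beta> k x) (\<lambda>x. \<Sum>k\<in>UNIV. dM j x$k$ix i * \<beta> k x + M x$k$ix i * d j k x)"
        by (intro wd_sum wd_mult d) (use f1[of j] in \<open>auto simp: wdm_def\<close>)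
      show "wd S (axis j 1) (\<lambda>x. indicator S x * Gbar G x$3$ix i) (\<lambda>x. indicator S x * pd (ix j) (\<lambda>z. G z$3$ix i) (lift x))"
        by (rule C1_wd[OF C1_G])
      show "AE x in lborel. x \<in> S \<longrightarrow> (\<Sum>k\<in>UNIV. M x$k$ix i * \<beta> k x) = indicator S x * Gbar G x$3$ix i"
        using f2
      proof eventually_elim
        case (elim x)
        show ?case
        proof
          assume x: "x \<in> S"
          then have xc: "x \<in> closure S" using closure_subset by blast
          note A = Gbar_sym[OF xc] Gbar_pos[OF xc]
          have g: "(\<Sum>k\<in>UNIV. M x$k$ix i * M x$k$p) = Ghat (Gbar G x)$ix i$p" for p
          proof -
            have "(\<Sum>k\<in>UNIV. M x$k$ix i * M x$k$p) = (transpose (M x) ** M x)$ix i$p"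
              by (simp add: matrix_matrix_mult_def transpose_def)
            then show ?thesis using elim x by simp
          qed
          have "(\<Sum>k\<in>UNIV. M x$k$ix i * \<beta> k x) = shift1 (Gbar G x) * (\<Sum>k\<in>UNIV. M x$k$ix i * M x$k$1)
              + shift2 (Gbar G x) * (\<Sum>k\<in>UNIV. M x$k$ix i * M x$k$2)
              + sqrt (lapse (Gbar G x)) * (\<Sum>k\<in>UNIV. M x$k$ix i * M x$k$3)"
            using x by (simp add: \<beta>_def sum_distrib_left sum.distrib[symmetric] algebra_simps)
          also have "\<dots> = shift1 (Gbar G x) * Gbar G x$ix i$1 + shift2 (Gbar G x) * Gbar G x$ix i$2"
            unfolding g by (simp add: Ghat_def)
          also have "\<dots> = Gbar G x$3$ix i"
            using shift_eq1[OF A] shift_eq2[OF A] sym_entry[OF A, of 2 1] sym_entry[OF A, of 3 1] sym_entry[OF A, of 3 2]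
              exhaust_2[of i] by (auto simp: algebra_simps)
          finally show "(\<Sum>k\<in>UNIV. M x$k$ix i * \<beta> k x) = indicator S x * Gbar G x$3$ix i" using x by simp
        qed
      qed
    qed
  qed
  show ?thesis using f2 cos db prod
  proof eventually_elim
    case (elim x)
    show ?case
    proof (intro impI allI)
      fix i j assume x: "x \<in> S"
      have c: "\<forall>k i j. dM j x$k$ix i = dM i x$k$ix j"
        "\<forall>j. transpose (dM j x) ** M x + transpose (M x) ** dM j x = dGhat j x" using elim x by auto
      \<comment> \<open>\<open>X i j\<close> is the inner product of the Cosserat field with the
        second derivative of the immersion; it is symmetric, so symmetrising the strain leaves it
        unchanged.\<close>
      define X where "X i j = shift1 (Gbar G x) * conn (M x) (\<lambda>j. dM j x) j$1$ix i + shift2 (Gbar G x) * conn (M x) (\<lambda>j. dM j x) j$2$ix i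
          + sqrt (lapse (Gbar G x)) * conn (M x) (\<lambda>j. dM j x) j$3$ix i" for i j
      have e: "(transpose (Dy x) ** Db x)$i$j = pd (ix j) (\<lambda>z. G z$3$ix i) (lift x) - X i j" for i j
      proof -
        have "(transpose (Dy x) ** Db x)$i$j = (\<Sum>k\<in>UNIV. M x$k$ix i * d j k x)"
          using elim x by (simp add: matrix_matrix_mult_def transpose_def)
        moreover have "(\<Sum>k\<in>UNIV. dM j x$k$ix i * \<beta> k x) = X i j"
          using x by (simp add: \<beta>_def X_def conn_def matrix_matrix_mult_def transpose_def
              sum_distrib_left sum.distrib[symmetric] algebra_simps)
        moreover have "(\<Sum>k\<in>UNIV. dM j x$k$ix i * \<beta> k x) + (\<Sum>k\<in>UNIV. M x$k$ix i * d j k x)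
            = pd (ix j) (\<lambda>z. G z$3$ix i) (lift x)"
          using elim x by (simp add: sum.distrib)
        ultimately show ?thesis by linarith
      qed
      have Xs: "X j i = X i j" unfolding X_def using conn_relations(2)[OF c] by metis
      have t: "conn (M x) (\<lambda>j. dM j x) j$1$ix i = chris 1 i j x" "conn (M x) (\<lambda>j. dM j x) j$2$ix i = chris 2 i j x"
        using conn_tangential[OF c, of j 1 i] conn_tangential[OF c, of j 2 i] by simp_all
      have "(symm (transpose (Dy x) ** Db x) - (1/2) *\<^sub>R d3G2 G x)$i$j
          = 1/2 * ((transpose (Dy x) ** Db x)$i$j + (transpose (Dy x) ** Db x)$j$i) - 1/2 * pd 3 (\<lambda>z. G z$ix i$ix j) (lift x)"
        by (simp add: symm_def d3G2_def transpose_def)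
      \<comment> \<open>The symmetrised derivatives of G_3i and G_3j and the subtracted derivative
        in direction 3 are exactly the three terms of the Christoffel symbol with index 3.\<close>
      also have "\<dots> = chris 3 i j x - X i j"
        unfolding e Xs by (simp add: chris_def field_simps)
      also have "\<dots> = chris_normal i j x + sqrt (lapse (Gbar G x)) * conn (M x) (\<lambda>j. dM j x) j$ix i$3"
        unfolding X_def t conn_normal(1)[OF c] chris_normal_def by simp
      finally show "(symm (transpose (Dy x) ** Db x) - (1/2) *\<^sub>R d3G2 G x)$i$j
         = chris_normal i j x + sqrt (lapse (Gbar G x)) * conn (M x) (\<lambda>j. dM j x) j$ix i$3" .
    qed
  qed
qed

end

text \<open>Otherwise X > c almost everywhere on a set of positive measure, which contradicts the
  bound on the integral. The almost sure property \<open>P\<close> is carried along because the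
  selected value must also be a rotation.\<close>

lemma exists_le_average:
  fixes X :: "'a::euclidean_space \<Rightarrow> ennreal"
  assumes [measurable]: "X \<in> borel_measurable borel" "S \<in> sets borel"
    and m: "emeasure lborel S = ennreal m" "m > 0"
    and I: "(\<integral>\<^sup>+z. indicator S z * X z \<partial>lborel) \<le> ennreal m * c"
    and P: "AE z in lborel. z \<in> S \<longrightarrow> P z"
  shows "\<exists>z\<in>S. P z \<and> X z \<le> c"
proof (rule ccontr)
  assume "\<not> ?thesis"
  then have gt: "AE z in lborel. z \<in> S \<longrightarrow> c < X z" using P by (auto elim!: eventually_mono simp: not_le)
  have nz: "\<not> (AE z in lborel. z \<notin> S)"
  proof
    assume "AE z in lborel. z \<notin> S"
    then have "emeasure lborel S = 0" by (subst (asm) AE_iff_measurable[of S]) auto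
    then show False using m by simp
  qed
  \<comment> \<open>An infinite c cannot be exceeded; finiteness makes the strict comparison of the
    integrals possible.\<close>
  have c: "c \<noteq> \<infinity>"
  proof
    assume "c = \<infinity>"
    then have "AE z in lborel. z \<notin> S" using gt by (auto elim!: eventually_mono)
    then show False using nz by blast
  qed
  have eq: "(\<integral>\<^sup>+z. indicator S z * c \<partial>lborel) = ennreal m * c"
    by (subst nn_integral_multc) (auto simp: m)
  have "(\<integral>\<^sup>+z. indicator S z * c \<partial>lborel) < (\<integral>\<^sup>+z. indicator S z * X z \<partial>lborel)"
  proof (rule nn_integral_less)
    show "(\<integral>\<^sup>+z. indicator S z * c \<partial>lborel) \<noteq> \<infinity>" unfolding eq using c by (simp add: ennreal_mult_eq_top_iff)
    show "AE z in lborel. indicator S z * c \<le> indicator S z * X z"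
      using gt by eventually_elim (auto simp: indicator_def)
    show "\<not> (AE z in lborel. indicator S z * X z \<le> indicator S z * c)"
    proof
      assume "AE z in lborel. indicator S z * X z \<le> indicator S z * c"
      then have "AE z in lborel. z \<notin> S" using gt by eventually_elim (auto simp: indicator_def)
      then show False using nz by blast
    qed
  qed auto
  then show False using I unfolding eq by simp
qed

lemma uniform_bound:
  fixes f :: "'i::finite \<Rightarrow> 'a \<Rightarrow> real"
  assumes "\<And>i. \<exists>B>0. \<forall>x\<in>K. \<bar>f i x\<bar> \<le> B"
  shows "\<exists>B>0. \<forall>x\<in>K. \<forall>i. \<bar>f i x\<bar> \<le> B"
proof -
  obtain B where B: "\<And>i. B i > 0" "\<And>i x. x \<in> K \<Longrightarrow> \<bar>f i x\<bar> \<le> B i" using assms by metis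
  show ?thesis
  proof (intro exI[of _ "\<Sum>i\<in>UNIV. B i"] conjI ballI allI)
    show "(\<Sum>i\<in>UNIV. B i) > 0" using B by (intro sum_pos) auto
    fix x i assume "x \<in> K"
    then have "\<bar>f i x\<bar> \<le> B i" by (rule B)
    also have "\<dots> \<le> (\<Sum>i\<in>UNIV. B i)" using B(1) by (intro member_le_sum) (auto intro: less_imp_le)
    finally show "\<bar>f i x\<bar> \<le> (\<Sum>i\<in>UNIV. B i)" .
  qed
qed

section \<open>The rigidity estimate\<close>

context thin_metric
begin

lemma C1e_bounded: "C1e f \<Longrightarrow> \<exists>B>0. \<forall>x\<in>closure S. \<bar>f x\<bar> \<le> B"
  unfolding C1e_def C1_def using C1_bounded by blast

lemma frame_entry_bound:
  "\<exists>N>0. \<forall>x\<in>closure S. \<forall>m::real^3^3. transpose m ** m = Ghat (Gbar G x) \<longrightarrow> (\<forall>k p. \<bar>m$k$p\<bar> \<le> N)"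
proof -
  have "\<exists>B>0. \<forall>x\<in>closure S. \<bar>Ghat (Gbar G x)$p$p\<bar> \<le> B" for p
    by (rule C1e_bounded) (use C1_Ghat C1e_def in blast)
  from uniform_bound[of "closure S" "\<lambda>p x. Ghat (Gbar G x)$p$p", OF this]
  obtain B where B: "B > 0" "\<forall>x\<in>closure S. \<forall>p. \<bar>Ghat (Gbar G x)$p$p\<bar> \<le> B" by blast
  show ?thesis
  proof (intro exI[of _ "B + 1"] conjI ballI allI impI)
    show "B + 1 > 0" using B by simp
    fix x and m :: "real^3^3" and k p
    assume x: "x \<in> closure S" and m: "transpose m ** m = Ghat (Gbar G x)"
    have "(m$k$p)\<^sup>2 \<le> (\<Sum>k\<in>UNIV. (m$k$p)\<^sup>2)" by (rule member_le_sum) auto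
    also have "\<dots> = (transpose m ** m)$p$p"
      by (simp add: matrix_matrix_mult_def transpose_def power2_eq_square)
    also have "\<dots> \<le> B" unfolding m using B(2) x by (metis abs_le_D1)
    also have "\<dots> \<le> (B + 1)\<^sup>2" using B(1) by (simp add: power2_eq_square algebra_simps)
    finally show "\<bar>m$k$p\<bar> \<le> B + 1" using B(1) by (simp add: abs_le_square_iff[symmetric])
  qed
qed

text \<open>The squared difference of the two second fundamental forms, scaled by the square root of
  \<open>lapse\<close> so that it becomes the integrand of the strain energy; the indicator makes it
  a function on the plane.\<close>

definition defect :: "(real^2 \<Rightarrow> real^3^3) \<Rightarrow> (2 \<Rightarrow> real^2 \<Rightarrow> real^3^3) \<Rightarrow> (real^2 \<Rightarrow> real^3^3) \<Rightarrow> (2 \<Rightarrow> real^2 \<Rightarrow> real^3^3) \<Rightarrow> real^2 \<Rightarrow> real" where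
  "defect M dM M0 dM0 x = (\<Sum>i\<in>UNIV. \<Sum>j\<in>UNIV.
     ((indicator S x * sqrt (lapse (Gbar G x))) * (conn (M x) (\<lambda>j. dM j x) j - conn (M0 x) (\<lambda>j. dM0 j x) j)$ix i$3)\<^sup>2)"

text \<open>The derivative of the rotation field is sandwiched between frames and inverse Gram
  matrices, all bounded by the metric, and its core is a difference of connections in which only
  second fundamental forms survive. The constant is therefore chosen before the frames.\<close>

lemma rotation_gradient_bound:
  "\<exists>C>0. \<forall>Dy M dM Dy0 M0 dM0. frame Dy M dM \<longrightarrow> frame Dy0 M0 dM0 \<longrightarrow>
     (\<exists>K. (\<forall>j. wdm (axis j 1) (\<lambda>x. M x ** (indicator S x *\<^sub>R Ghat_inv (Gbar G x)) ** transpose (M0 x)) (K j)) \<and>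
        (AE x in lborel. \<forall>j k l. (K j x$k$l)\<^sup>2 \<le> C * defect M dM M0 dM0 x))"
proof -
  obtain N where N: "N > 0" "\<forall>x\<in>closure S. \<forall>m::real^3^3. transpose m ** m = Ghat (Gbar G x) \<longrightarrow> (\<forall>k p. \<bar>m$k$p\<bar> \<le> N)"
    using frame_entry_bound by blast
  obtain B where B: "B > 0" "\<forall>x\<in>closure S. \<forall>i. \<bar>Ghat_inv (Gbar G x)$fst i$snd i\<bar> \<le> B"
    using uniform_bound[of "closure S" "\<lambda>i x. Ghat_inv (Gbar G x)$fst i$snd i"] C1e_bounded[OF C1e_Ghat_inv] by blast
  obtain L where L: "L > 0" "\<forall>x\<in>closure S. \<bar>inverse (lapse (Gbar G x))\<bar> \<le> L"
    using C1e_bounded[OF C1e_inverse[OF C1e_lapse lapse_Gbar_pos]] by blast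
  have "\<exists>d. C1 (\<lambda>x. Ghat_inv (Gbar G x)$p$q) d" for p q
    using C1e_Ghat_inv[of p q] by (simp add: C1e_def)
  then obtain dg where dg: "\<And>p q. C1 (\<lambda>x. Ghat_inv (Gbar G x)$p$q) (dg p q)" by metis
  have wG: "wdm (axis j 1) (\<lambda>x. indicator S x *\<^sub>R Ghat_inv (Gbar G x)) (\<lambda>x. indicator S x *\<^sub>R (\<chi> p q. dg p q j x))" for j
    using wdm_C1[of "\<lambda>x. Ghat_inv (Gbar G x)" "\<lambda>j x. \<chi> p q. dg p q j x" j] dg by simp
  \<comment> \<open>81 = 3^4 counts the terms in four 3x3 matrix products, \<open>N * N\<close>
    comes from the two frames, \<open>B * B\<close> from two inverse Gram matrices, and
    \<open>L\<close> removes the factor \<open>lapse\<close> contained in the defect.\<close>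
  define C where "C = (81 * (N * N * (B * B)))\<^sup>2 * L"
  have C0: "C > 0" using N B L by (simp add: C_def)
  show ?thesis
  proof (rule exI[of _ C], intro conjI allI impI C0)
    fix Dy M dM Dy0 M0 dM0
    assume f: "frame Dy M dM" and f0: "frame Dy0 M0 dM0"
    have w: "wdm (axis j 1) M (dM j)" and w0: "wdm (axis j 1) M0 (dM0 j)" for j
      using f f0 by (simp_all add: frame_def)
    note a = f[unfolded frame_def, THEN conjunct2] and a0 = f0[unfolded frame_def, THEN conjunct2]
    define R where "R x = M x ** (indicator S x *\<^sub>R Ghat_inv (Gbar G x)) ** transpose (M0 x)" for x
    have "\<exists>K. wdm (axis j 1) R K" for j
      unfolding R_def[abs_def] using wdm_mult[OF wdm_mult[OF w wG] wdm_transpose[OF w0]] by blast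
    then obtain K where K: "\<And>j. wdm (axis j 1) R (K j)" by metis
    \<comment> \<open>The identity R M0 = M is differentiated and then solved for \<open>K\<close>,
      so the derivative of \<open>Ghat_inv\<close> need not be known.\<close>
    have "AE x in lborel. \<forall>j. K j x ** M0 x + R x ** dM0 j x = dM j x"
    proof (intro eventually_all_finite)
      fix j
      show "AE x in lborel. K j x ** M0 x + R x ** dM0 j x = dM j x"
      proof (rule wdm_unique[OF wdm_mult[OF K w0] w])
        show "AE x in lborel. x \<in> S \<longrightarrow> R x ** M0 x = M x"
          using a a0
        proof eventually_elim
          case (elim x)
          show ?case
          proof
            assume x: "x \<in> S"
            then have xc: "x \<in> closure S" using closure_subset by blast
            show "R x ** M0 x = M x"
              unfolding R_def using x elim
              by (simp add: rotation_maps_frame[OF _ _ Ghat_inv_right[OF Gbar_sym[OF xc] Gbar_pos[OF xc]]])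
          qed
        qed
      qed
    qed
    with a a0 have "AE x in lborel. \<forall>j k l. (K j x$k$l)\<^sup>2 \<le> C * defect M dM M0 dM0 x"
    proof eventually_elim
      case (elim x)
      show ?case
      proof (cases "x \<in> S")
        case False
        have "K j x$k$l = 0" for j k l
          using K[of j] False wdD(4)[of S "axis j 1" "\<lambda>x. R x$k$l" "\<lambda>x. K j x$k$l" x] by (simp add: wdm_def)
        moreover have "0 \<le> C * defect M dM M0 dM0 x"
          using C0 by (intro mult_nonneg_nonneg) (auto simp: defect_def intro!: sum_nonneg)
        ultimately show ?thesis by simp
      next
        case True
        then have xc: "x \<in> closure S" using closure_subset by blast
        define Gi where "Gi = Ghat_inv (Gbar G x)"
        define T where "T j = conn (M x) (\<lambda>j. dM j x) j - conn (M0 x) (\<lambda>j. dM0 j x) j" for j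
        define l where "l = lapse (Gbar G x)"
        have l0: "l > 0" unfolding l_def by (rule lapse_Gbar_pos[OF xc])
        have lL: "inverse l \<le> L" using L(2) xc l0 by (auto simp: l_def dest!: bspec)
        have g: "transpose (M x) ** M x = Ghat (Gbar G x)" "transpose (M0 x) ** M0 x = Ghat (Gbar G x)"
          "Ghat (Gbar G x) ** Gi = mat 1"
          using elim True Ghat_inv_right[OF Gbar_sym[OF xc] Gbar_pos[OF xc]] by (auto simp: Gi_def)
        have c: "\<forall>k i j. dM j x$k$ix i = dM i x$k$ix j"
          "\<forall>j. transpose (dM j x) ** M x + transpose (M x) ** dM j x = dGhat j x"
          and c0: "\<forall>k i j. dM0 j x$k$ix i = dM0 i x$k$ix j"
          "\<forall>j. transpose (dM0 j x) ** M0 x + transpose (M0 x) ** dM0 j x = dGhat j x"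
          using elim True by auto
        have KT: "K j x = M x ** Gi ** T j ** Gi ** transpose (M0 x)" for j
          unfolding T_def conn_def
          by (rule rotation_derivative[OF g]) (use elim True in \<open>auto simp: R_def Gi_def\<close>)
        define F where "F = defect M dM M0 dM0 x"
        have F: "F = (\<Sum>i\<in>UNIV. \<Sum>j\<in>UNIV. (sqrt l * T j$ix i$3)\<^sup>2)"
          using True by (simp add: F_def defect_def T_def l_def)
        have F0: "F \<ge> 0" unfolding F by (intro sum_nonneg) auto
        have T3: "\<bar>T j$ix i$3\<bar> \<le> sqrt (L * F)" for i j
        proof -
          have "(sqrt l * T j$ix i$3)\<^sup>2 \<le> (\<Sum>j\<in>UNIV. (sqrt l * T j$ix i$3)\<^sup>2)" by (rule member_le_sum) auto
          also have "\<dots> \<le> F" unfolding F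
            by (rule member_le_sum[of i UNIV "\<lambda>i. \<Sum>j\<in>UNIV. (sqrt l * T j$ix i$3)\<^sup>2"]) (auto intro: sum_nonneg)
          finally have "l * (T j$ix i$3)\<^sup>2 \<le> F" using l0 by (simp add: power_mult_distrib)
          then have "(T j$ix i$3)\<^sup>2 \<le> inverse l * F" using l0 by (simp add: field_simps)
          also have "\<dots> \<le> L * F" using lL F0 by (rule mult_right_mono)
          finally show ?thesis using real_sqrt_le_mono by fastforce
        qed
        \<comment> \<open>Tangential entries cancel and the (3,3) entry is zero; the remaining
          entries are normal ones, equal up to sign to those estimated in \<open>T3\<close>.\<close>
        have T: "\<bar>T j$p$q\<bar> \<le> sqrt (L * F)" for j p q
        proof -
          have LF: "0 \<le> sqrt (L * F)" using L F0 by simp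
          have 1: "T j$ix i$ix k = 0" for i k
            by (simp add: T_def conn_tangential[OF c] conn_tangential[OF c0])
          have 2: "T j$3$3 = 0" by (simp add: T_def conn_normal[OF c] conn_normal[OF c0])
          have 3: "T j$3$ix i = - T j$ix i$3" for i by (simp add: T_def conn_normal[OF c] conn_normal[OF c0])
          show ?thesis
            using ix_cases[of p] ix_cases[of q] 1 2 3 T3 LF by auto
        qed
        have bM: "\<bar>M x$k$p\<bar> \<le> N" "\<bar>transpose (M0 x)$k$p\<bar> \<le> N" for k p
          using N(2) xc g(1,2) by (auto simp: transpose_def)
        have bG: "\<bar>Gi$p$q\<bar> \<le> B" for p q
          using B(2) xc unfolding Gi_def by (metis fst_conv snd_conv)
        have "\<bar>K j x$k$q\<bar> \<le> 3 * (3 * (3 * (3 * (N * B) * sqrt (L * F)) * B) * N)" for j k q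
          unfolding KT by (intro matrix_entry_bound bM bG T)
        also have "\<dots> = 81 * (N * N * (B * B)) * sqrt (L * F)" by (simp add: algebra_simps)
        finally have "\<bar>K j x$k$q\<bar>\<^sup>2 \<le> (81 * (N * N * (B * B)) * sqrt (L * F))\<^sup>2" for j k q
          by (intro power_mono) auto
        then show ?thesis
          using L F0 by (simp add: power_mult_distrib C_def F_def[symmetric] mult.assoc)
      qed
    qed
    then show "\<exists>K. (\<forall>j. wdm (axis j 1) (\<lambda>x. M x ** (indicator S x *\<^sub>R Ghat_inv (Gbar G x)) ** transpose (M0 x)) (K j)) \<and>
        (AE x in lborel. \<forall>j k l. (K j x$k$l)\<^sup>2 \<le> C * defect M dM M0 dM0 x)"
      using K unfolding R_def[abs_def] by blast
  qed
qed

lemma defect_measurable: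
  assumes f: "frame Dy M dM" and f0: "frame Dy0 M0 dM0"
  shows "defect M dM M0 dM0 \<in> borel_measurable borel"
proof -
  have w: "(\<lambda>x. M x$k$p) \<in> borel_measurable borel" "(\<lambda>x. dM j x$k$p) \<in> borel_measurable borel"
    if "frame Dy M dM" for Dy M dM j k p
  proof -
    have "wd S (axis j 1) (\<lambda>x. M x$k$p) (\<lambda>x. dM j x$k$p)" using that by (simp add: frame_def wdm_def)
    then show "(\<lambda>x. M x$k$p) \<in> borel_measurable borel" "(\<lambda>x. dM j x$k$p) \<in> borel_measurable borel"
      by (auto dest: wdD(1,2))
  qed
  have c: "(\<lambda>x. conn (M x) (\<lambda>j. dM j x) j$p$q) \<in> borel_measurable borel" if "frame Dy M dM" for Dy M dM j p q
    using w[OF that] by (simp add: conn_def matrix_matrix_mult_def transpose_def)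
  have l: "(\<lambda>x. indicator S x * sqrt (lapse (Gbar G x))) \<in> borel_measurable borel"
    using wde_C1e[OF C1e_sqrt_lapse] unfolding wde_def by (auto dest: wdD(1))
  show ?thesis unfolding defect_def[abs_def] vector_minus_component
    by (intro borel_measurable_sum borel_measurable_power borel_measurable_times borel_measurable_diff l c[OF f] c[OF f0])
qed

theorem rigidity_nonempty:
  assumes conn: "connected S" and lip: "lipschitz_domain S" and ne: "S \<noteq> {}"
  shows "\<exists>C>0. \<forall>y0 Dy0 Dnu0 y Dy Db.
      W22 S y0 Dy0
      \<and> (AE x in lebesgue. x \<in> S \<longrightarrow> transpose (Dy0 x) ** Dy0 x = upper2 (Gbar G x))
      \<and> weak_jacobian S (unit_normal Dy0) Dnu0
      \<and> (AE x in lebesgue. x \<in> S \<longrightarrow> transpose (Dy0 x) ** Dnu0 x =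
            (- 1 / sqrt (matrix_inv (Gbar G x) $ 3 $ 3)) *\<^sub>R (\<chi> i j. Gamma G 3 (ix i) (ix j) (lift x)))
      \<and> W22 S y Dy
      \<and> (AE x in lebesgue. x \<in> S \<longrightarrow> transpose (Dy x) ** Dy x = upper2 (Gbar G x))
      \<and> weak_jacobian S (cosserat G Dy) Db
      \<longrightarrow> (\<exists>R\<in>SO3.
            (\<integral>\<^sup>+ x \<in> S. ennreal ((norm (Dy x - R ** Dy0 x))\<^sup>2) \<partial>lebesgue)
            \<le> ennreal C * (\<integral>\<^sup>+ x \<in> S. ennreal ((norm (symm (transpose (Dy x) ** Db x)
                                 - (1/2) *\<^sub>R d3G2 G x))\<^sup>2) \<partial>lebesgue))"
proof -
  obtain C0 where C0: "C0 \<ge> 0" "\<forall>f g1 g2. wd S (axis 1 1) f g1 \<longrightarrow> wd S (axis 2 1) f g2 \<longrightarrow>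
     spread S S f \<le> ennreal C0 * dirichlet g1 g2"
    by (rule linkedE[OF linked_whole[OF conn lip]])
  obtain C1 where C1: "C1 > 0" "\<forall>Dy M dM Dy0 M0 dM0. frame Dy M dM \<longrightarrow> frame Dy0 M0 dM0 \<longrightarrow>
     (\<exists>K. (\<forall>j. wdm (axis j 1) (\<lambda>x. M x ** (indicator S x *\<^sub>R Ghat_inv (Gbar G x)) ** transpose (M0 x)) (K j)) \<and>
        (AE x in lborel. \<forall>j k l. (K j x$k$l)\<^sup>2 \<le> C1 * defect M dM M0 dM0 x))"
    using rotation_gradient_bound by blast
  obtain N where N: "N > 0" "\<forall>x\<in>closure S. \<forall>m::real^3^3. transpose m ** m = Ghat (Gbar G x) \<longrightarrow> (\<forall>k p. \<bar>m$k$p\<bar> \<le> N)"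
    using frame_entry_bound by blast
  define m where "m = measure lborel S"
  have em: "emeasure lborel S = ennreal m"
    using emeasure_S by (simp add: m_def emeasure_eq_ennreal_measure less_top)
  have m0: "m > 0"
  proof -
    obtain p e where pe: "e > 0" "ball p e \<subseteq> S" using ne open_S open_contains_ball by blast
    have "emeasure lborel (ball p e) \<le> emeasure lborel S" by (intro emeasure_mono pe) simp
    then have "emeasure lborel S \<noteq> 0" using emeasure_ball_nonzero[OF pe(1), of p] by auto
    then show ?thesis using em by (cases "m > 0") (auto simp: ennreal_neg not_less)
  qed
  \<comment> \<open>Nine matrix entries, and for each of them two coordinate directions with the
    bound \<open>C1\<close> on the squared derivative.\<close>
  define E where "E = 9 * (C0 * (2 * C1))"
  have E0: "E \<ge> 0" using C0 C1 by (simp add: E_def)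
  \<comment> \<open>The factor 6 is 3 for the square of a sum of three terms, times the two columns
    of the gradient; \<open>E / m\<close> comes from averaging over the domain, and 1 is added to
    make the constant positive.\<close>
  define C where "C = 6 * N\<^sup>2 * (E / m) + 1"
  have C0': "C > 0" using E0 m0 by (simp add: C_def add_nonneg_pos)
  show ?thesis
  proof (rule exI[of _ C], intro conjI C0' allI impI, elim conjE)
    fix y0 Dy0 Dnu0 y Dy Db
    assume h: "W22 S y0 Dy0"
      "AE x in lebesgue. x \<in> S \<longrightarrow> transpose (Dy0 x) ** Dy0 x = upper2 (Gbar G x)"
      "weak_jacobian S (unit_normal Dy0) Dnu0"
      "AE x in lebesgue. x \<in> S \<longrightarrow> transpose (Dy0 x) ** Dnu0 x =
            (- 1 / sqrt (matrix_inv (Gbar G x) $ 3 $ 3)) *\<^sub>R (\<chi> i j. Gamma G 3 (ix i) (ix j) (lift x))"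
      "W22 S y Dy"
      "AE x in lebesgue. x \<in> S \<longrightarrow> transpose (Dy x) ** Dy x = upper2 (Gbar G x)"
      "weak_jacobian S (cosserat G Dy) Db"
    obtain M dM where f: "frame Dy M dM" using frame_exists[OF h(5,6)] by blast
    obtain M0 dM0 where f0: "frame Dy0 M0 dM0" using frame_exists[OF h(1,2)] by blast
    note a = f[unfolded frame_def, THEN conjunct2] and a0 = f0[unfolded frame_def, THEN conjunct2]
    define R where "R x = M x ** (indicator S x *\<^sub>R Ghat_inv (Gbar G x)) ** transpose (M0 x)" for x
    obtain K where K: "\<forall>j. wdm (axis j 1) R (K j)"
      and KF: "AE x in lborel. \<forall>j k l. (K j x$k$l)\<^sup>2 \<le> C1 * defect M dM M0 dM0 x"
      using C1(2) f f0 unfolding R_def[abs_def] by blast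
    have wK: "wd S (axis j 1) (\<lambda>x. R x$k$l) (\<lambda>x. K j x$k$l)" for j k l using K by (simp add: wdm_def)
    have [measurable]: "(\<lambda>x. R x$k$l) \<in> borel_measurable borel" for k l using wdD(1)[OF wK] .
    let ?F = "defect M dM M0 dM0"
    have [measurable]: "?F \<in> borel_measurable borel" by (rule defect_measurable[OF f f0])
    define I where "I = (\<integral>\<^sup>+x. ennreal (?F x) \<partial>lborel)"
    define W where "W x = symm (transpose (Dy x) ** Db x) - (1/2) *\<^sub>R d3G2 G x" for x
    \<comment> \<open>Subtracting the vanishing strain of the reference immersion cancels
      \<open>chris_normal\<close> and leaves the scaled difference of the connections, entry by
      entry.\<close>
    have I_eq: "(\<integral>\<^sup>+ x \<in> S. ennreal ((norm (W x))\<^sup>2) \<partial>lebesgue) = I"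
    proof -
      have "AE x in lborel. ennreal ((norm (W x))\<^sup>2) * indicator S x = ennreal (?F x)"
        using cosserat_energy[OF f h(7)] reference_second_form[OF f0 h(3,4)]
      proof eventually_elim
        case (elim x)
        show ?case
        proof (cases "x \<in> S")
          case True
          have "W x$i$j = sqrt (lapse (Gbar G x)) * (conn (M x) (\<lambda>j. dM j x) j - conn (M0 x) (\<lambda>j. dM0 j x) j)$ix i$3" for i j
          proof -
            have "W x$i$j = chris_normal i j x + sqrt (lapse (Gbar G x)) * conn (M x) (\<lambda>j. dM j x) j$ix i$3"
              "sqrt (lapse (Gbar G x)) * conn (M0 x) (\<lambda>j. dM0 j x) j$ix i$3 = - chris_normal i j x"
              using elim True unfolding W_def by blast+
            then show ?thesis by (simp add: right_diff_distrib)
          qed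
          then show ?thesis using True by (simp add: norm_matrix_square defect_def)
        next
          case False
          then show ?thesis by (simp add: defect_def)
        qed
      qed
      then show ?thesis unfolding I_def nn_integral_completion by (rule nn_integral_cong_AE)
    qed
    let ?r = "\<lambda>z x. \<Sum>k\<in>UNIV. \<Sum>l\<in>UNIV. ennreal ((R z$k$l - R x$k$l)\<^sup>2)"
    \<comment> \<open>The squared distance of the whole field to its value at z; its integral over z
      is the sum of the spreads of the nine entries.\<close>
    define X where "X z = (\<integral>\<^sup>+x. indicator S x * ?r z x \<partial>lborel)" for z
    have [measurable]: "X \<in> borel_measurable borel" unfolding X_def[abs_def] by measurable
    have one: "spread S S (\<lambda>x. R x$k$l) \<le> ennreal (C0 * (2 * C1)) * I" for k l
    proof -
      have "spread S S (\<lambda>x. R x$k$l) \<le> ennreal C0 * dirichlet (\<lambda>x. K 1 x$k$l) (\<lambda>x. K 2 x$k$l)"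
        using C0(2) wK by blast
      also have "dirichlet (\<lambda>x. K 1 x$k$l) (\<lambda>x. K 2 x$k$l) \<le> (\<integral>\<^sup>+x. ennreal (2 * C1) * ennreal (?F x) \<partial>lborel)"
        unfolding dirichlet_def
      proof (rule nn_integral_mono_AE)
        show "AE x in lborel. ennreal ((K 1 x$k$l)\<^sup>2 + (K 2 x$k$l)\<^sup>2) \<le> ennreal (2 * C1) * ennreal (?F x)"
          using KF
        proof eventually_elim
          case (elim x)
          have "(K 1 x$k$l)\<^sup>2 \<le> C1 * ?F x" "(K 2 x$k$l)\<^sup>2 \<le> C1 * ?F x" using elim by blast+
          then have "(K 1 x$k$l)\<^sup>2 + (K 2 x$k$l)\<^sup>2 \<le> 2 * C1 * ?F x" by simp
          then have "ennreal ((K 1 x$k$l)\<^sup>2 + (K 2 x$k$l)\<^sup>2) \<le> ennreal (2 * C1 * ?F x)" by (rule ennreal_leI)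
          then show ?case using C1 by (simp add: ennreal_mult')
        qed
      qed
      also have "\<dots> = ennreal (2 * C1) * I" unfolding I_def by (rule nn_integral_cmult) measurable
      finally show ?thesis using C0(1) C1(1) by (simp add: ennreal_mult mult.assoc mult_left_mono)
    qed
    have "(\<integral>\<^sup>+z. indicator S z * X z \<partial>lborel) = (\<integral>\<^sup>+z. (\<integral>\<^sup>+x. (\<Sum>k\<in>UNIV. \<Sum>l\<in>UNIV. indicator S z * indicator S x * ennreal ((R z$k$l - R x$k$l)\<^sup>2)) \<partial>lborel) \<partial>lborel)"
    proof (rule nn_integral_cong)
      fix z
      show "indicator S z * X z = (\<integral>\<^sup>+x. (\<Sum>k\<in>UNIV. \<Sum>l\<in>UNIV. indicator S z * indicator S x * ennreal ((R z$k$l - R x$k$l)\<^sup>2)) \<partial>lborel)"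
        unfolding X_def by (subst nn_integral_cmult[symmetric], measurable) (simp only: sum_distrib_left mult.assoc)
    qed
    also have "\<dots> = (\<Sum>k\<in>UNIV. \<Sum>l\<in>UNIV. spread S S (\<lambda>x. R x$k$l))"
      unfolding spread_def by (simp add: nn_integral_sum)
    also have "\<dots> \<le> (\<Sum>k\<in>(UNIV::3 set). \<Sum>l\<in>(UNIV::3 set). ennreal (C0 * (2 * C1)) * I)"
      by (intro sum_mono one)
    also have "\<dots> = ennreal E * I"
    proof -
      have "ennreal E = 9 * ennreal (C0 * (2 * C1))" unfolding E_def by (subst ennreal_mult') auto
      then show ?thesis by (simp add: mult.assoc)
    qed
    also have "\<dots> = ennreal m * (ennreal (E / m) * I)"
      using m0 E0 by (simp add: mult.assoc[symmetric] ennreal_mult[symmetric])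
    finally have XI: "(\<integral>\<^sup>+z. indicator S z * X z \<partial>lborel) \<le> ennreal m * (ennreal (E / m) * I)" .
    have "AE z in lborel. z \<in> S \<longrightarrow> R z \<in> SO3"
      using a a0
    proof eventually_elim
      case (elim z)
      show ?case
      proof
        assume z: "z \<in> S"
        then have zc: "z \<in> closure S" using closure_subset by blast
        show "R z \<in> SO3"
          unfolding R_def using z elim
          by (simp add: rotation_SO3[OF _ _ Ghat_inv_right[OF Gbar_sym[OF zc] Gbar_pos[OF zc]]])
      qed
    qed
    from exists_le_average[OF _ _ em m0 XI this]
    obtain z where z: "z \<in> S" "R z \<in> SO3" "X z \<le> ennreal (E / m) * I" by auto
    have "(\<integral>\<^sup>+ x \<in> S. ennreal ((norm (Dy x - R z ** Dy0 x))\<^sup>2) \<partial>lebesgue)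
        \<le> (\<integral>\<^sup>+x. ennreal (6 * N\<^sup>2) * (indicator S x * ?r z x) \<partial>lborel)"
      unfolding nn_integral_completion
    proof (rule nn_integral_mono_AE)
      show "AE x in lborel. ennreal ((norm (Dy x - R z ** Dy0 x))\<^sup>2) * indicator S x
          \<le> ennreal (6 * N\<^sup>2) * (indicator S x * ?r z x)"
        using a a0
      proof eventually_elim
        case (elim x)
        show ?case
        proof (cases "x \<in> S")
          case True
          then have xc: "x \<in> closure S" using closure_subset by blast
          have g: "transpose (M x) ** M x = Ghat (Gbar G x)" "transpose (M0 x) ** M0 x = Ghat (Gbar G x)"
            using elim True by auto
          have RM: "R x ** M0 x = M x"
            unfolding R_def using True rotation_maps_frame[OF g Ghat_inv_right[OF Gbar_sym[OF xc] Gbar_pos[OF xc]]] by simp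
          define \<rho> where "\<rho> = (\<Sum>k\<in>UNIV. \<Sum>l\<in>UNIV. (R z$k$l - R x$k$l)\<^sup>2)"
          \<comment> \<open>The gradient of y is formed by the first two columns of R(x) M0(x), so
            the difference is R(x) - R(z) applied to the tangent vectors of the reference
            immersion.\<close>
          have e: "(Dy x - R z ** Dy0 x)$k$i = (\<Sum>l\<in>UNIV. (R x$k$l - R z$k$l) * M0 x$l$ix i)" for k i
          proof -
            have "M x$k$ix i = Dy x$k$i" and d0: "M0 x$l$ix i = Dy0 x$l$i" for l using elim True by blast+
            then have "Dy x$k$i = (R x ** M0 x)$k$ix i" using RM by simp
            then show ?thesis using d0
              by (simp add: matrix_matrix_mult_def left_diff_distrib sum_subtractf)
          qed
          have "((Dy x - R z ** Dy0 x)$k$i)\<^sup>2 \<le> 3 * N\<^sup>2 * (\<Sum>l\<in>UNIV. (R z$k$l - R x$k$l)\<^sup>2)" for k i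
          proof -
            have t: "((R x$k$l - R z$k$l) * M0 x$l$ix i)\<^sup>2 \<le> (R z$k$l - R x$k$l)\<^sup>2 * N\<^sup>2" for l
            proof -
              have "\<bar>M0 x$l$ix i\<bar> \<le> N" using N(2) xc g(2) by blast
              then have "(M0 x$l$ix i)\<^sup>2 \<le> N\<^sup>2" using N(1) by (metis abs_le_square_iff abs_of_pos)
              then show ?thesis unfolding power_mult_distrib power2_commute[of "R x$k$l"]
                by (intro mult_left_mono) auto
            qed
            have s3: "(p + q + r)\<^sup>2 \<le> 3 * (p\<^sup>2 + q\<^sup>2 + r\<^sup>2)" for p q r :: real
              using sum_squares_bound[of p q] sum_squares_bound[of q r] sum_squares_bound[of p r]
              by (simp add: power2_eq_square algebra_simps)
            show ?thesis unfolding e sum_3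
              by (rule order_trans[OF s3]) (use t[of 1] t[of 2] t[of 3] in \<open>simp add: algebra_simps\<close>)
          qed
          then have "(norm (Dy x - R z ** Dy0 x))\<^sup>2 \<le> (\<Sum>k\<in>UNIV. \<Sum>i\<in>(UNIV::2 set). 3 * N\<^sup>2 * (\<Sum>l\<in>UNIV. (R z$k$l - R x$k$l)\<^sup>2))"
            unfolding norm_matrix_square by (intro sum_mono)
          also have "\<dots> = 6 * N\<^sup>2 * \<rho>" unfolding \<rho>_def by (simp add: sum_distrib_left mult.assoc)
          finally have "ennreal ((norm (Dy x - R z ** Dy0 x))\<^sup>2) \<le> ennreal (6 * N\<^sup>2 * \<rho>)" by (rule ennreal_leI)
          also have "\<dots> = ennreal (6 * N\<^sup>2) * ennreal \<rho>" by (rule ennreal_mult') simp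
          also have "ennreal \<rho> = ?r z x"
            unfolding \<rho>_def by (simp add: sum_ennreal sum_nonneg)
          finally show ?thesis using True by simp
        qed simp
      qed
    qed
    also have "\<dots> = ennreal (6 * N\<^sup>2) * X z" unfolding X_def by (rule nn_integral_cmult) measurable
    also have "\<dots> \<le> ennreal (6 * N\<^sup>2) * (ennreal (E / m) * I)" using z(3) by (rule mult_left_mono) simp
    also have "\<dots> = ennreal (6 * N\<^sup>2 * (E / m)) * I"
      using E0 m0 by (subst ennreal_mult) (simp_all add: mult.assoc)
    also have "\<dots> \<le> ennreal C * I" by (intro mult_right_mono ennreal_leI) (simp_all add: C_def)
    finally show "\<exists>R\<in>SO3. (\<integral>\<^sup>+ x \<in> S. ennreal ((norm (Dy x - R ** Dy0 x))\<^sup>2) \<partial>lebesgue)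
            \<le> ennreal C * (\<integral>\<^sup>+ x \<in> S. ennreal ((norm (symm (transpose (Dy x) ** Db x)
                                 - (1/2) *\<^sub>R d3G2 G x))\<^sup>2) \<partial>lebesgue)"
      using z(2) I_eq unfolding W_def by auto
  qed
qed

end

theorem lemma4p2:
  fixes \<omega> :: "(real^2) set" and G :: "real^3 \<Rightarrow> real^3^3"
  assumes "open \<omega>" and "bounded \<omega>" and "connected \<omega>" and "lipschitz_domain \<omega>"
    and "smooth_metric_on (cyl \<omega>) G"
    and "\<forall>x\<in>\<omega>. riem G 1 2 1 2 (lift x) = 0 \<and> riem G 1 2 1 3 (lift x) = 0
                \<and> riem G 1 2 2 3 (lift x) = 0"
  shows "\<exists>C>0. \<forall>y0 Dy0 Dnu0 y Dy Db.
      W22 \<omega> y0 Dy0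
      \<and> (AE x in lebesgue. x \<in> \<omega> \<longrightarrow> transpose (Dy0 x) ** Dy0 x = upper2 (Gbar G x))
      \<and> weak_jacobian \<omega> (unit_normal Dy0) Dnu0
      \<and> (AE x in lebesgue. x \<in> \<omega> \<longrightarrow> transpose (Dy0 x) ** Dnu0 x =
            (- 1 / sqrt (matrix_inv (Gbar G x) $ 3 $ 3)) *\<^sub>R (\<chi> i j. Gamma G 3 (ix i) (ix j) (lift x)))
      \<and> W22 \<omega> y Dy
      \<and> (AE x in lebesgue. x \<in> \<omega> \<longrightarrow> transpose (Dy x) ** Dy x = upper2 (Gbar G x))
      \<and> weak_jacobian \<omega> (cosserat G Dy) Db
      \<longrightarrow> (\<exists>R\<in>SO3.
            (\<integral>\<^sup>+ x \<in> \<omega>. ennreal ((norm (Dy x - R ** Dy0 x))\<^sup>2) \<partial>lebesgue)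
            \<le> ennreal C * (\<integral>\<^sup>+ x \<in> \<omega>. ennreal ((norm (symm (transpose (Dy x) ** Db x)
                                 - (1/2) *\<^sub>R d3G2 G x))\<^sup>2) \<partial>lebesgue))"
proof (cases "\<omega> = {}")
  case True
  \<comment> \<open>On the empty domain both integrals vanish and any rotation serves; averaging
    over z requires positive measure.\<close>
  have "mat 1 \<in> SO3" by (simp add: SO3_def orthogonal_matrix_def)
  then show ?thesis using True by (intro exI[of _ 1]) auto
next
  case False
  interpret thin_metric \<omega> G
    by unfold_locales (use assms in auto)
  show ?thesis by (rule rigidity_nonempty[OF assms(3,4) False])
qed

end
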